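(* Let $\Omega\subset\mathbb{R}^d$ be open and bounded, $\Gamma\subset\mathbb{R}^s$ compact, $U:=\Omega\times\Gamma$. Let $f:U\times\mathbb{R}^{d,d,s}\to[0,\infty]$ be lower semicontinuous (jointly) in both variables, convex in the second variable, such that $t\mapsto f(t,0)$ is locally bounded, and such that its conjugate $f^*$ is continuous with $$\sup_{t\in U,\ \|\xi\|<r}|f^*(t,\xi)|<\infty\qquad\forall r>0.$$ For $\mu\in\mathcal{M}(U)$ define $\mathcal{F}(\mu)$ as the infimum of $\mathfrak{B}_f((E,\mu))$ over all pairs $(H,E)\in\mathcal{M}(U,\mathbb{R}^{d,s,d,s}\times\mathbb{R}^{d,d,s})$ such that $H$ is symmetric (i.e. $H_{i,k,j,l}=H_{i,l,j,k}$ for all $i,j\in\{1,\dots,d\}$, $k,l\in\{1,\dots,s\}$) and $$-\int_U\operatorname{div}_x^2\phi\,\mathrm{d}\mu+\int_U\langle\nabla_z\phi,\mathrm{d}E\rangle+\int_U\langle\nabla_z^2\phi,\mathrm{d}H\rangle=0\qquad\forall\phi\in C_c^2(U,\mathbb{R}^{d,d}).$$ Then for every $u\in C^2(\Omega,\Gamma)$ with $F(u):=\int_\Omega f(x,u(x),\nabla^2u(x))\,\mathrm{d}x<\infty$, one has $$\mathcal{F}(\delta_u)=F(u).$$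
   Context: Points of $U$ are written $t=(x,z)$ with $x\in\Omega$, $z\in\Gamma$, and $f(t,p)=f(x,z,p)$; derivatives with index $x$ (resp. $z$) are with respect to the $\Omega$- (resp. $\Gamma$-) variable. $C_0(U,\mathbb{R}^k)$ is the closure in the supremum norm of the compactly supported continuous functions; $\mathcal{M}(U,\mathbb{R}^k)$ is the space of (finite) $\mathbb{R}^k$-valued Radon measures on $U$, $\mathcal{M}(U)=\mathcal{M}(U,\mathbb{R})$. The graph-concentrated measure $\delta_u$ is defined by $\int_U\phi\,\mathrm{d}\delta_u:=\int_\Omega\phi(x,u(x))\,\mathrm{d}x$ for all $\phi\in C_0(U,\mathbb{R})$. The infimum of the empty set is $+\infty$. Tensor conventions ($i,j\in\{1,\dots,d\}$, $k,l\in\{1,\dots,s\}$; $\langle\cdot,\cdot\rangle$ is the Euclidean entrywise inner product): $(\nabla^2u)_{i,j,k}=\partial_{x_i}\partial_{x_j}u_k$; for $\phi=(\phi_{i,j})$: $\operatorname{div}_x^2\phi=\sum_{i,j}\partial_{x_i}\partial_{x_j}\phi_{i,j}$, $(\nabla_z\phi)_{i,j,k}=\partial_{z_k}\phi_{i,j}$, $(\nabla_z^2\phi)_{i,k,j,l}=\partial_{z_k}\partial_{z_l}\phi_{i,j}$. The auxiliary measure $H$ plays the role of the tensor product $\nabla u\otimes\nabla u$ carried by the graph of $u$. $C_c^2(U,\mathbb{R}^{d,d})$ denotes twice continuously differentiable functions with compact support in the first variable; concretely, functions $\phi$ of class $C^2$ on $\Omega\times\mathbb{R}^s$ for which there is a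 compact $K\subset\Omega$ with $\phi(x,z)=0$ for $x\notin K$, used on $\Omega\times\Gamma$. Conjugate in the last variable: $f^*(t,\xi):=\sup_{p}\langle\xi,p\rangle-f(t,p)$. The generalized Benamou-Brenier functional is, for $(E,\mu)\in\mathcal{M}(U,\mathbb{R}^{d,d,s}\times\mathbb{R})$, $$\mathfrak{B}_f((E,\mu)):=\sup_{(\phi^\xi,\phi^\lambda)\in\mathcal{K}_f}\int_U\langle\phi^\xi,\mathrm{d}E\rangle+\int_U\phi^\lambda\,\mathrm{d}\mu,$$ $$\mathcal{K}_f:=\{(\phi^{\xi},\phi^{\lambda})\in C_0(U,\mathbb{R}^{d,d,s}\times\mathbb{R}) : f^*(t,\phi^{\xi}(t))+\phi^{\lambda}(t)\le 0\ \ \forall t\in U\}.$$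
   Formalization: Added hypothesis: all first partial derivatives of u are square integrable on Ω. Without it no finite H is admissible, so F(δ_u)=+∞ while F(u)<∞ (e.g. u affine onto (0,1) on infinitely many shrinking intervals), and the stated equality fails. *)

theory Defs
  imports "HOL-Analysis.Analysis"
begin

section \<open>Finite vector-valued Radon measures\<close>

(* A finite vector-valued Radon measure on U is a countably additive set function on the
   Borel subsets of U.  Regularity is automatic here: U = \<Omega> \<times> \<Gamma> is locally compact and
   sigma-compact.  Values off the Borel subsets of U are irrelevant. *)

definition radon_measure_on ::
  "'a::topological_space set \<Rightarrow> ('a set \<Rightarrow> 'b::real_normed_vector) \<Rightarrow> bool" where
  "radon_measure_on U \<nu> \<longleftrightarrow>
     (\<forall>A :: nat \<Rightarrow> 'a set. range A \<subseteq> sets (restrict_space borel U) \<longrightarrow> disjoint_family A \<longrightarrow>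
        (\<lambda>n. \<nu> (A n)) sums \<nu> (\<Union>n. A n))"

(* Positive part of the Jordan decomposition.  Negative values are sent to 0 by ennreal, which
   is harmless because B = {} competes in the supremum. *)

definition pos_part_measure :: "'a::topological_space set \<Rightarrow> ('a set \<Rightarrow> real) \<Rightarrow> 'a measure" where
  "pos_part_measure U \<nu> = measure_of U (sets (restrict_space borel U))
     (\<lambda>A. SUP B\<in>{B \<in> sets (restrict_space borel U). B \<subseteq> A}. ennreal (\<nu> B))"

definition signed_integral ::
  "'a::topological_space set \<Rightarrow> ('a set \<Rightarrow> real) \<Rightarrow> ('a \<Rightarrow> real) \<Rightarrow> real" where
  "signed_integral U \<nu> \<phi> =
     integral\<^sup>L (pos_part_measure U \<nu>) \<phi> - integral\<^sup>L (pos_part_measure U (\<lambda>A. - \<nu> A)) \<phi>"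

(* The integral of <phi, d nu>; for nested vector types the standard basis consists of the unit
   tensors, so this is the entrywise pairing. *)

definition vector_integral ::
  "'a::topological_space set \<Rightarrow> ('a set \<Rightarrow> 'b::euclidean_space) \<Rightarrow> ('a \<Rightarrow> 'b) \<Rightarrow> real" where
  "vector_integral U \<nu> \<phi> = (\<Sum>b\<in>Basis. signed_integral U (\<lambda>A. \<nu> A \<bullet> b) (\<lambda>t. \<phi> t \<bullet> b))"


section \<open>Function spaces and derivatives\<close>

definition cont_cpt_support ::
  "'a::topological_space set \<Rightarrow> ('a \<Rightarrow> 'b::real_normed_vector) \<Rightarrow> bool" where
  "cont_cpt_support U \<psi> \<longleftrightarrow>
     continuous_on U \<psi> \<and> (\<exists>K. compact K \<and> K \<subseteq> U \<and> (\<forall>t\<in>U - K. \<psi> t = 0))"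

(* Sup-norm closure of the compactly supported continuous functions; only values on U matter. *)

definition C0_on :: "'a::topological_space set \<Rightarrow> ('a \<Rightarrow> 'b::real_normed_vector) \<Rightarrow> bool" where
  "C0_on U \<phi> \<longleftrightarrow>
     (\<forall>\<epsilon>>0. \<exists>\<psi>. cont_cpt_support U \<psi> \<and> (\<forall>t\<in>U. norm (\<phi> t - \<psi> t) \<le> \<epsilon>))"

definition C2_on ::
  "'a::real_normed_vector set \<Rightarrow> ('a \<Rightarrow> 'b::real_normed_vector) \<Rightarrow> bool" where
  "C2_on S f \<longleftrightarrow>
     (\<exists>(f' :: 'a \<Rightarrow> ('a, 'b) blinfun) (f'' :: 'a \<Rightarrow> ('a, ('a, 'b) blinfun) blinfun).
        (\<forall>x\<in>S. (f has_derivative blinfun_apply (f' x)) (at x)) \<and>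
        (\<forall>x\<in>S. (f' has_derivative blinfun_apply (f'' x)) (at x)) \<and>
        continuous_on S f'')"

definition dir_deriv ::
  "'a::real_normed_vector \<Rightarrow> ('a \<Rightarrow> real) \<Rightarrow> 'a \<Rightarrow> real" where
  "dir_deriv v g t = deriv (\<lambda>h. g (t + h *\<^sub>R v)) 0"

abbreviation part_deriv :: "'d::finite \<Rightarrow> (real^'d \<Rightarrow> real) \<Rightarrow> real^'d \<Rightarrow> real" where
  "part_deriv i \<equiv> dir_deriv (axis i 1)"

abbreviation part_x ::
  "'d::finite \<Rightarrow> ((real^'d) \<times> (real^'s::finite) \<Rightarrow> real) \<Rightarrow> (real^'d) \<times> (real^'s) \<Rightarrow> real" where
  "part_x i \<equiv> dir_deriv (axis i 1, 0)"

abbreviation part_z ::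
  "'s::finite \<Rightarrow> ((real^'d::finite) \<times> (real^'s) \<Rightarrow> real) \<Rightarrow> (real^'d) \<times> (real^'s) \<Rightarrow> real" where
  "part_z k \<equiv> dir_deriv (0, axis k 1)"

(* A tensor with indices (i,j,k) in d,d,s has type real^'s^'d^'d and entries p $ i $ j $ k;
   one with indices (i,k,j,l) in d,s,d,s has type real^'s^'d^'s^'d. *)

definition hessian :: "(real^'d::finite \<Rightarrow> real^'s::finite) \<Rightarrow> real^'d \<Rightarrow> real^'s^'d^'d" where
  "hessian u x = (\<chi> i j k. part_deriv i (part_deriv j (\<lambda>y. u y $ k)) x)"

definition div2_x ::
  "((real^'d::finite) \<times> (real^'s::finite) \<Rightarrow> real^'d^'d) \<Rightarrow> (real^'d) \<times> (real^'s) \<Rightarrow> real" where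
  "div2_x \<phi> t = (\<Sum>i\<in>UNIV. \<Sum>j\<in>UNIV. part_x i (part_x j (\<lambda>t. \<phi> t $ i $ j)) t)"

definition grad_z ::
  "((real^'d::finite) \<times> (real^'s::finite) \<Rightarrow> real^'d^'d) \<Rightarrow> (real^'d) \<times> (real^'s) \<Rightarrow> real^'s^'d^'d" where
  "grad_z \<phi> t = (\<chi> i j k. part_z k (\<lambda>t. \<phi> t $ i $ j) t)"

definition hess_z ::
  "((real^'d::finite) \<times> (real^'s::finite) \<Rightarrow> real^'d^'d) \<Rightarrow>
    (real^'d) \<times> (real^'s) \<Rightarrow> real^'s^'d^'s^'d" where
  "hess_z \<phi> t = (\<chi> i k j l. part_z k (part_z l (\<lambda>t. \<phi> t $ i $ j)) t)"

definition test_fun ::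
  "(real^'d::finite) set \<Rightarrow> ((real^'d) \<times> (real^'s::finite) \<Rightarrow> real^'d^'d) \<Rightarrow> bool" where
  "test_fun \<Omega> \<phi> \<longleftrightarrow> C2_on (\<Omega> \<times> UNIV) \<phi> \<and>
     (\<exists>K. compact K \<and> K \<subseteq> \<Omega> \<and> (\<forall>x\<in>\<Omega> - K. \<forall>z. \<phi> (x, z) = 0))"


section \<open>The integrand\<close>

definition lsc_on :: "'a::topological_space set \<Rightarrow> ('a \<Rightarrow> ennreal) \<Rightarrow> bool" where
  "lsc_on S g \<longleftrightarrow> (\<forall>x\<in>S. g x \<le> Liminf (at x within S) g)"

definition convex_ennreal :: "('b::real_vector \<Rightarrow> ennreal) \<Rightarrow> bool" where
  "convex_ennreal g \<longleftrightarrow>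
     (\<forall>p q. \<forall>\<theta>\<in>{0..1}.
        g ((1 - \<theta>) *\<^sub>R p + \<theta> *\<^sub>R q) \<le> ennreal (1 - \<theta>) * g p + ennreal \<theta> * g q)"

definition locally_bounded_on :: "'a::topological_space set \<Rightarrow> ('a \<Rightarrow> ennreal) \<Rightarrow> bool" where
  "locally_bounded_on S g \<longleftrightarrow>
     (\<forall>t\<in>S. \<exists>V C. open V \<and> t \<in> V \<and> (\<forall>t'\<in>V \<inter> S. g t' \<le> ennreal C))"

definition conj_fun :: "('a \<Rightarrow> 'b::real_inner \<Rightarrow> ennreal) \<Rightarrow> 'a \<Rightarrow> 'b \<Rightarrow> ereal" where
  "conj_fun f t \<xi> = (SUP p. ereal (\<xi> \<bullet> p) - enn2ereal (f t p))"


section \<open>The Benamou-Brenier functional and the lifted functional\<close>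

definition BB_constraints ::
  "'a::topological_space set \<Rightarrow> ('a \<Rightarrow> 'b::real_inner \<Rightarrow> ennreal) \<Rightarrow> (('a \<Rightarrow> 'b) \<times> ('a \<Rightarrow> real)) set" where
  "BB_constraints U f =
     {(\<phi>, \<eta>). C0_on U (\<lambda>t. (\<phi> t, \<eta> t)) \<and>
        (\<forall>t\<in>U. conj_fun f t (\<phi> t) + ereal (\<eta> t) \<le> 0)}"

definition BB_functional ::
  "'a::topological_space set \<Rightarrow> ('a \<Rightarrow> 'b::euclidean_space \<Rightarrow> ennreal) \<Rightarrow>
    ('a set \<Rightarrow> 'b) \<Rightarrow> ('a set \<Rightarrow> real) \<Rightarrow> ereal" where
  "BB_functional U f E \<mu> =
     (SUP (\<phi>, \<eta>)\<in>BB_constraints U f.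
        ereal (vector_integral U E \<phi> + signed_integral U \<mu> \<eta>))"

definition symmetric_H ::
  "'a::topological_space set \<Rightarrow> ('a set \<Rightarrow> real^'s::finite^'d::finite^'s^'d) \<Rightarrow> bool" where
  "symmetric_H U H \<longleftrightarrow>
     (\<forall>A\<in>sets (restrict_space borel U). \<forall>i j k l. H A $ i $ k $ j $ l = H A $ i $ l $ j $ k)"

(* Both H and E are finite measures.  For the graph measure of u, testing the equation with
   \<phi>(x,z) = \<eta>(x) |z|^2/2 times the identity gives, when the Hessian of u is integrable,
   that an admissible pair forces the gradient of u to be square integrable on \<Omega>. *)

definition admissible ::
  "(real^'d::finite) set \<Rightarrow> (real^'s::finite) set \<Rightarrow> (((real^'d) \<times> (real^'s)) set \<Rightarrow> real) \<Rightarrow>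
    ((((real^'d) \<times> (real^'s)) set \<Rightarrow> real^'s^'d^'s^'d) \<times>
     (((real^'d) \<times> (real^'s)) set \<Rightarrow> real^'s^'d^'d)) set" where
  "admissible \<Omega> \<Gamma> \<mu> =
     {(H, E). radon_measure_on (\<Omega> \<times> \<Gamma>) H \<and> radon_measure_on (\<Omega> \<times> \<Gamma>) E \<and>
        symmetric_H (\<Omega> \<times> \<Gamma>) H \<and>
        (\<forall>\<phi>. test_fun \<Omega> \<phi> \<longrightarrow>
           - signed_integral (\<Omega> \<times> \<Gamma>) \<mu> (div2_x \<phi>)
           + vector_integral (\<Omega> \<times> \<Gamma>) E (grad_z \<phi>)
           + vector_integral (\<Omega> \<times> \<Gamma>) H (hess_z \<phi>) = 0)}"

definition lifted_functional ::
  "(real^'d::finite) set \<Rightarrow> (real^'s::finite) set \<Rightarrow>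
    ((real^'d) \<times> (real^'s) \<Rightarrow> real^'s^'d^'d \<Rightarrow> ennreal) \<Rightarrow>
    (((real^'d) \<times> (real^'s)) set \<Rightarrow> real) \<Rightarrow> ereal" where
  "lifted_functional \<Omega> \<Gamma> f \<mu> = (INF (H, E)\<in>admissible \<Omega> \<Gamma> \<mu>. BB_functional (\<Omega> \<times> \<Gamma>) f E \<mu>)"

definition energy ::
  "(real^'d::finite) set \<Rightarrow> ((real^'d) \<times> (real^'s::finite) \<Rightarrow> real^'s^'d^'d \<Rightarrow> ennreal) \<Rightarrow>
    (real^'d \<Rightarrow> real^'s) \<Rightarrow> ennreal" where
  "energy \<Omega> f u = (\<integral>\<^sup>+x\<in>\<Omega>. f (x, u x) (hessian u x) \<partial>lborel)"

definition is_graph_measure ::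
  "(real^'d::finite) set \<Rightarrow> (real^'s::finite) set \<Rightarrow> (real^'d \<Rightarrow> real^'s) \<Rightarrow>
    (((real^'d) \<times> (real^'s)) set \<Rightarrow> real) \<Rightarrow> bool" where
  "is_graph_measure \<Omega> \<Gamma> u \<delta> \<longleftrightarrow> radon_measure_on (\<Omega> \<times> \<Gamma>) \<delta> \<and>
     (\<forall>\<phi> :: (real^'d) \<times> (real^'s) \<Rightarrow> real. C0_on (\<Omega> \<times> \<Gamma>) \<phi> \<longrightarrow>
        signed_integral (\<Omega> \<times> \<Gamma>) \<delta> \<phi> = (LINT x:\<Omega>|lborel. \<phi> (x, u x)))"

lemma C0_on_imp_continuous_on:
  fixes \<phi> :: "'a::topological_space \<Rightarrow> 'b::real_normed_vector"
  assumes "C0_on U \<phi>"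
  shows "continuous_on U \<phi>"
proof -
  have "\<forall>n. \<exists>\<psi>. cont_cpt_support U \<psi> \<and> (\<forall>t\<in>U. norm (\<phi> t - \<psi> t) \<le> 1 / Suc n)"
    using assms unfolding C0_on_def by (metis of_nat_0_less_iff zero_less_Suc zero_less_divide_1_iff)
  then obtain \<psi> where \<psi>: "\<And>n. cont_cpt_support U (\<psi> n)"
      "\<And>n t. t \<in> U \<Longrightarrow> norm (\<phi> t - \<psi> n t) \<le> 1 / Suc n"
    by metis
  have "uniform_limit U \<psi> \<phi> sequentially"
  proof (rule uniform_limitI)
    fix e :: real assume "e > 0"
    then obtain N where N: "1 / real (Suc N) < e"
      using nat_approx_posE by blast
    show "\<forall>\<^sub>F n in sequentially. \<forall>t\<in>U. dist (\<psi> n t) (\<phi> t) < e"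
    proof (rule eventually_sequentiallyI[of N], intro ballI)
      fix n t assume "N \<le> n" "t \<in> U"
      then have "norm (\<phi> t - \<psi> n t) \<le> 1 / Suc n" using \<psi>(2) by blast
      also have "\<dots> \<le> 1 / Suc N" using \<open>N \<le> n\<close> by (intro divide_left_mono) auto
      finally show "dist (\<psi> n t) (\<phi> t) < e" using N by (simp add: dist_norm norm_minus_commute)
    qed
  qed
  moreover have "\<forall>\<^sub>F n in sequentially. continuous_on U (\<psi> n)"
    using \<psi>(1) by (simp add: cont_cpt_support_def)
  ultimately show ?thesis
    by (intro uniform_limit_theorem) auto
qed

(* The defining property of the graph measure is satisfiable: push Lebesgue measure forward. *)

lemma is_graph_measure_exists:
  fixes u :: "real^'d::finite \<Rightarrow> real^'s::finite"
  assumes "open \<Omega>" "bounded \<Omega>" "compact \<Gamma>" "continuous_on \<Omega> u" "u ` \<Omega> \<subseteq> \<Gamma>"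
  shows "\<exists>\<delta>. is_graph_measure \<Omega> \<Gamma> u \<delta>"
proof -
  define U where "U = \<Omega> \<times> \<Gamma>"
  define S where "S = sets (restrict_space borel U)"
  define L where "L = restrict_space lborel \<Omega>"
  define G where "G = (\<lambda>x. (x, u x))"
  define M where "M = distr L (restrict_space borel U) G"
  have \<Omega>: "\<Omega> \<in> sets borel" using assms by simp
  have "emeasure lborel \<Omega> < \<infinity>" using assms(2) by (rule emeasure_bounded_finite)
  then have "finite_measure L"
    unfolding L_def using \<Omega> by (intro finite_measureI) (simp add: emeasure_restrict_space space_restrict_space)
  have setsL: "sets L = sets (restrict_space borel \<Omega>)"
    unfolding L_def by (intro sets_restrict_space_cong) simp
  have G: "G \<in> measurable L (restrict_space borel U)"
  proof (rule measurable_restrict_space2)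
    show "G \<in> space L \<rightarrow> U"
      using assms(5) by (auto simp: L_def space_restrict_space G_def U_def)
    have "continuous_on \<Omega> G" unfolding G_def using assms(4) by (intro continuous_intros)
    then have "G \<in> borel_measurable (restrict_space borel \<Omega>)"
      by (rule borel_measurable_continuous_on_restrict)
    then show "G \<in> borel_measurable L"
      using measurable_cong_sets[OF setsL refl] by blast
  qed
  interpret L: finite_measure L by fact
  interpret M: finite_measure M unfolding M_def by (rule L.finite_measure_distr[OF G])
  have setsM: "sets M = S" by (simp add: M_def S_def)
  have spaceM: "space M = U" by (simp add: M_def space_restrict_space)
  define \<delta> where "\<delta> = (\<lambda>A. measure M A)"
  have r: "radon_measure_on U \<delta>"
    unfolding radon_measure_on_def \<delta>_def
    using M.finite_measure_UNION setsM S_def by auto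
  have SU: "S \<subseteq> Pow U" using sets.space_closed[of M] setsM spaceM by simp
  have sig: "sigma_sets U S = S"
    using sets.sigma_sets_eq[of M] setsM spaceM by simp
  have p: "pos_part_measure U \<delta> = M"
  proof -
    have "pos_part_measure U \<delta> = measure_of U S (emeasure M)"
      unfolding pos_part_measure_def S_def[symmetric]
    proof (rule measure_of_eq[OF SU])
      fix A assume "A \<in> sigma_sets U S"
      then have A: "A \<in> S" using sig by simp
      show "(SUP B\<in>{B \<in> S. B \<subseteq> A}. ennreal (\<delta> B)) = emeasure M A"
      proof (rule antisym)
        show "(SUP B\<in>{B \<in> S. B \<subseteq> A}. ennreal (\<delta> B)) \<le> emeasure M A"
          using A by (intro SUP_least)
            (auto simp: \<delta>_def setsM M.emeasure_eq_measure intro!: ennreal_leI M.finite_measure_mono)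
        show "emeasure M A \<le> (SUP B\<in>{B \<in> S. B \<subseteq> A}. ennreal (\<delta> B))"
          using A by (intro SUP_upper2[of A]) (auto simp: \<delta>_def M.emeasure_eq_measure)
      qed
    qed
    also have "\<dots> = M" using measure_of_of_measure[of M] setsM spaceM by simp
    finally show ?thesis .
  qed
  have n: "pos_part_measure U (\<lambda>A. - \<delta> A) = null_measure M"
  proof -
    have "pos_part_measure U (\<lambda>A. - \<delta> A) = measure_of U S (emeasure (null_measure M))"
      unfolding pos_part_measure_def S_def[symmetric]
    proof (rule measure_of_eq[OF SU])
      fix A assume "A \<in> sigma_sets U S"
      have "\<And>B. ennreal (- \<delta> B) = 0" by (simp add: \<delta>_def ennreal_neg)
      moreover have "{} \<in> {B \<in> S. B \<subseteq> A}" using setsM by auto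
      ultimately show "(SUP B\<in>{B \<in> S. B \<subseteq> A}. ennreal (- \<delta> B)) = emeasure (null_measure M) A"
        by (auto simp: SUP_constant bot_ennreal)
    qed
    also have "\<dots> = null_measure M"
      using measure_of_of_measure[of "null_measure M"] setsM spaceM by simp
    finally show ?thesis .
  qed
  have "signed_integral U \<delta> \<phi> = (LINT x:\<Omega>|lborel. \<phi> (x, u x))" if "C0_on U \<phi>" for \<phi>
  proof -
    have "\<phi> \<in> borel_measurable (restrict_space borel U)"
      using C0_on_imp_continuous_on[OF that] by (rule borel_measurable_continuous_on_restrict)
    then have "integral\<^sup>L M \<phi> = integral\<^sup>L L (\<lambda>x. \<phi> (G x))"
      unfolding M_def by (intro integral_distr[OF G])
    also have "\<dots> = (LINT x:\<Omega>|lborel. \<phi> (x, u x))"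
      unfolding L_def G_def set_lebesgue_integral_def using \<Omega>
      by (subst integral_restrict_space) auto
    finally have 1: "integral\<^sup>L M \<phi> = (LINT x:\<Omega>|lborel. \<phi> (x, u x))" .
    have 2: "integral\<^sup>L (null_measure M) \<phi> = 0"
      by (rule integral_eq_zero_AE)
         (auto simp: eventually_ae_filter null_sets_def intro!: bexI[of _ "space M"])
    show ?thesis unfolding signed_integral_def p n 1 2 by simp
  qed
  then have "is_graph_measure \<Omega> \<Gamma> u \<delta>"
    unfolding is_graph_measure_def using r by (simp add: U_def)
  then show ?thesis by blast
qed

end

theory Submission
  imports Defs
begin

text \<open>
  Pushing the Hessian of \<open>u\<close> and the symmetrized \<open>\<nabla>u \<otimes> \<nabla>u\<close> forward to the graph gives an admissible
  pair (integrate the chain rule for \<open>\<phi>(x, u(x))\<close>), and the Fenchel-Young inequality bounds its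
  Benamou-Brenier value by \<open>F(u)\<close>.  The Hessian is integrable because \<open>f\<close> grows superlinearly.

  Conversely, let \<open>(H, E)\<close> be any admissible pair.  Test functions \<open>\<langle>\<xi>(x), z\<rangle>\<close> have vanishing z-Hessian,
  so comparison with the canonical pair gives \<open>\<integral>\<langle>\<xi>, dE\<rangle> = \<integral>\<langle>\<xi>, \<nabla>\<^sup>2u\<rangle>\<close> for each \<open>\<xi>\<close> depending on \<open>x\<close> only,
  without any information about \<open>E\<close> itself.  Such \<open>\<xi>\<close> already suffice: by the Fenchel-Moreau theorem
  \<open>f(x, u, \<nabla>\<^sup>2u)\<close> is a countable supremum of the continuous functions \<open>\<langle>\<xi>, \<nabla>\<^sup>2u\<rangle> - f\<^sup>*(x, u, \<xi>)\<close>, and a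
  \<open>C\<^sup>2\<close> partition of unity selects a nearly optimal \<open>\<xi>\<close> locally.
\<close>

section \<open>Calculus of twice continuously differentiable functions\<close>

text \<open>The density of the canonical \<open>H\<close> is quadratic in the gradient of
  \<open>u\<close>, and \<open>H\<close> must have finite mass. Finite energy controls only the
  Hessian, which says little about the gradient on an irregular domain. Take d = s = 1, \<Gamma> =
  [0,1], f(t,p) = |p|^2/2, and let \<Omega> be a bounded disjoint union of open intervals of length
  2^-n on which \<open>u\<close> is affine with slope 2^n and values in [0,1]. The Hessian vanishes
  and F(u) = 0, but the squared gradient is not integrable, so no admissible pair exists and the
  infimum is infinite. This is the reason for \<open>u_grad_L2\<close>. The canonical pair then
  serves twice: it bounds the infimum from above, and it evaluates the integrals against an unknown
  \<open>E\<close> in the lower bound.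

  Since \<xi> enters the constraint through a test function, it must be C2 with compact support in
  \<Omega>. Measurable selection of a good \<xi> is therefore replaced by continuity, finitely many
  indices and C2 weights. Finiteness of the conjugate everywhere is what makes real-valued duality
  possible although \<open>f\<close> may be infinite.\<close>

definition C1_on ::
  "'a::real_normed_vector set \<Rightarrow> ('a \<Rightarrow> 'b::real_normed_vector) \<Rightarrow> bool" where
  "C1_on S f \<longleftrightarrow> (\<exists>f' :: 'a \<Rightarrow> ('a, 'b) blinfun.
     (\<forall>x\<in>S. (f has_derivative blinfun_apply (f' x)) (at x)) \<and> continuous_on S f')"

text \<open>With C2 split into one derivative and a C1 condition on it, every closure rule for C2
  reduces to the C1 rule for the formula of the derivative.\<close>

lemma C2_on_iff_C1_on:
  fixes f :: "'a::real_normed_vector \<Rightarrow> 'b::real_normed_vector"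
  shows "C2_on S f \<longleftrightarrow> (\<exists>f' :: 'a \<Rightarrow> ('a, 'b) blinfun.
     (\<forall>x\<in>S. (f has_derivative blinfun_apply (f' x)) (at x)) \<and> C1_on S f')"
  unfolding C2_on_def C1_on_def by blast

lemma C1_onI:
  fixes f :: "'a::real_normed_vector \<Rightarrow> 'b::real_normed_vector"
    and f' :: "'a \<Rightarrow> ('a, 'b) blinfun"
  assumes "\<And>x. x \<in> S \<Longrightarrow> (f has_derivative blinfun_apply (f' x)) (at x)"
    and "continuous_on S f'"
  shows "C1_on S f"
  using assms unfolding C1_on_def by blast

lemma C2_onI:
  fixes f :: "'a::real_normed_vector \<Rightarrow> 'b::real_normed_vector"
    and f' :: "'a \<Rightarrow> ('a, 'b) blinfun"
  assumes "\<And>x. x \<in> S \<Longrightarrow> (f has_derivative blinfun_apply (f' x)) (at x)"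
    and "C1_on S f'"
  shows "C2_on S f"
  using assms unfolding C2_on_iff_C1_on by blast

lemma C1_on_imp_continuous_on: "C1_on S f \<Longrightarrow> continuous_on S f"
  unfolding C1_on_def
  by (meson continuous_at_imp_continuous_on has_derivative_continuous)

lemma C2_on_imp_C1_on: "C2_on S f \<Longrightarrow> C1_on S f"
  unfolding C2_on_iff_C1_on using C1_on_imp_continuous_on C1_onI by blast

lemma C2_on_subset: "C2_on S f \<Longrightarrow> T \<subseteq> S \<Longrightarrow> C2_on T f"
  unfolding C2_on_def by (meson continuous_on_subset subsetD)

lemma C1_on_const: "C1_on S (\<lambda>x. c)"
  by (rule C1_onI[where f' = "\<lambda>x. 0"]) (auto intro!: derivative_eq_intros)

lemma C2_on_const: "C2_on S (\<lambda>x. c)"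
  by (rule C2_onI[where f' = "\<lambda>x. 0"]) (auto intro!: derivative_eq_intros C1_on_const)

lemma C2_on_bounded_linear:
  assumes "bounded_linear f"
  shows "C2_on S f"
proof (rule C2_onI[where f' = "\<lambda>x. Blinfun f"])
  show "(f has_derivative blinfun_apply (Blinfun f)) (at x)" for x
    using assms by (simp add: bounded_linear_Blinfun_apply bounded_linear_imp_has_derivative)
qed (rule C1_on_const)

lemma C1_on_add:
  fixes f g :: "'a::real_normed_vector \<Rightarrow> 'b::real_normed_vector"
  assumes "C1_on S f" "C1_on S g"
  shows "C1_on S (\<lambda>x. f x + g x)"
proof -
  obtain f' g' :: "'a \<Rightarrow> ('a, 'b) blinfun"
    where "\<And>x. x \<in> S \<Longrightarrow> (f has_derivative blinfun_apply (f' x)) (at x)" "continuous_on S f'"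
      "\<And>x. x \<in> S \<Longrightarrow> (g has_derivative blinfun_apply (g' x)) (at x)" "continuous_on S g'"
    using assms unfolding C1_on_def by blast
  then show ?thesis
    by (intro C1_onI[where f' = "\<lambda>x. f' x + g' x"])
      (auto simp: plus_blinfun.rep_eq intro!: has_derivative_add continuous_intros)
qed

lemma C2_on_add:
  fixes f g :: "'a::real_normed_vector \<Rightarrow> 'b::real_normed_vector"
  assumes "C2_on S f" "C2_on S g"
  shows "C2_on S (\<lambda>x. f x + g x)"
proof -
  obtain f' g' :: "'a \<Rightarrow> ('a, 'b) blinfun"
    where "\<And>x. x \<in> S \<Longrightarrow> (f has_derivative blinfun_apply (f' x)) (at x)" "C1_on S f'"
      "\<And>x. x \<in> S \<Longrightarrow> (g has_derivative blinfun_apply (g' x)) (at x)" "C1_on S g'"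
    using assms unfolding C2_on_iff_C1_on by blast
  then show ?thesis
    by (intro C2_onI[where f' = "\<lambda>x. f' x + g' x"])
      (auto simp: plus_blinfun.rep_eq intro!: has_derivative_add C1_on_add)
qed

lemma C2_on_sum:
  assumes "\<And>i. i \<in> I \<Longrightarrow> C2_on S (f i)"
  shows "C2_on S (\<lambda>x. \<Sum>i\<in>I. f i x)"
  using assms
  by (induction I rule: infinite_finite_induct) (auto intro: C2_on_const C2_on_add)

lemma C1_on_compose:
  fixes f :: "'b::real_normed_vector \<Rightarrow> 'c::real_normed_vector"
    and g :: "'a::real_normed_vector \<Rightarrow> 'b"
  assumes "C1_on T f" "C1_on S g" "g ` S \<subseteq> T"
  shows "C1_on S (\<lambda>x. f (g x))"
proof -
  obtain f' g' where f': "\<And>x. x \<in> T \<Longrightarrow> (f has_derivative blinfun_apply (f' x)) (at x)" "continuous_on T f'"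
    and g': "\<And>x. x \<in> S \<Longrightarrow> (g has_derivative blinfun_apply (g' x)) (at x)" "continuous_on S g'"
    using assms unfolding C1_on_def by metis
  show ?thesis
  proof (rule C1_onI[where f' = "\<lambda>x. f' (g x) o\<^sub>L g' x"])
    fix x assume "x \<in> S"
    then have "((\<lambda>x. f (g x)) has_derivative (\<lambda>h. f' (g x) (g' x h))) (at x)"
      using assms(3) by (intro has_derivative_compose[OF g'(1) f'(1)]) auto
    then show "((\<lambda>x. f (g x)) has_derivative blinfun_apply (f' (g x) o\<^sub>L g' x)) (at x)"
      by (simp add: blinfun_compose.rep_eq o_def)
  next
    have "continuous_on S (\<lambda>x. f' (g x))"
      using assms(3) C1_on_imp_continuous_on[OF assms(2)] f'(2)
      by (auto intro: continuous_on_compose2)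
    then show "continuous_on S (\<lambda>x. f' (g x) o\<^sub>L g' x)"
      using g'(2) by (intro bounded_bilinear.continuous_on[OF bounded_bilinear_blinfun_compose])
  qed
qed

text \<open>The product rule in operator form. \<open>prod_left\<close> and
  \<open>prod_right\<close> are bounded linear in the factor and composition of operators is itself
  a bounded bilinear product, so the derivative of a product has the same shape as the product and
  the rule can be iterated to reach C2.\<close>

lemma (in bounded_bilinear) has_derivative_prod_blinfun:
  fixes f' :: "('d::real_normed_vector, 'a) blinfun" and g' :: "('d, 'b) blinfun"
  assumes "(f has_derivative blinfun_apply f') (at x)"
    and "(g has_derivative blinfun_apply g') (at x)"
  shows "((\<lambda>x. prod (f x) (g x)) has_derivative
    blinfun_apply ((prod_left (g x) o\<^sub>L f') + (prod_right (f x) o\<^sub>L g'))) (at x)"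
  by (rule has_derivative_eq_rhs[OF FDERIV[OF assms]])
    (simp add: fun_eq_iff blinfun.add_left prod_left.rep_eq prod_right.rep_eq add.commute)

lemma (in bounded_bilinear) C1_on:
  assumes "C1_on S f" "C1_on S g"
  shows "C1_on S (\<lambda>x. prod (f x) (g x))"
proof -
  obtain f' g' where f': "\<And>x. x \<in> S \<Longrightarrow> (f has_derivative blinfun_apply (f' x)) (at x)" "continuous_on S f'"
    and g': "\<And>x. x \<in> S \<Longrightarrow> (g has_derivative blinfun_apply (g' x)) (at x)" "continuous_on S g'"
    using assms unfolding C1_on_def by metis
  have "continuous_on S (\<lambda>x. prod_left (g x))" "continuous_on S (\<lambda>x. prod_right (f x))"
    using assms[THEN C1_on_imp_continuous_on]
    by (auto intro: bounded_linear.continuous_on bounded_linear_prod_left bounded_linear_prod_right)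
  then show ?thesis
    using f' g'
    by (intro C1_onI[where f' = "\<lambda>x. (prod_left (g x) o\<^sub>L f' x) + (prod_right (f x) o\<^sub>L g' x)"]
        has_derivative_prod_blinfun continuous_on_add
        bounded_bilinear.continuous_on[OF bounded_bilinear_blinfun_compose]) auto
qed

lemma C1_on_bounded_linear:
  assumes "bounded_linear f" "C1_on S g"
  shows "C1_on S (\<lambda>x. f (g x))"
  using C1_on_compose[OF C2_on_imp_C1_on[OF C2_on_bounded_linear[OF assms(1)]] assms(2)]
  by blast

lemma (in bounded_bilinear) C2_on:
  assumes "C2_on S f" "C2_on S g"
  shows "C2_on S (\<lambda>x. prod (f x) (g x))"
proof -
  obtain f' g' where f': "\<And>x. x \<in> S \<Longrightarrow> (f has_derivative blinfun_apply (f' x)) (at x)" "C1_on S f'"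
    and g': "\<And>x. x \<in> S \<Longrightarrow> (g has_derivative blinfun_apply (g' x)) (at x)" "C1_on S g'"
    using assms unfolding C2_on_iff_C1_on by metis
  have "C1_on S (\<lambda>x. prod_left (g x))" "C1_on S (\<lambda>x. prod_right (f x))"
    using assms[THEN C2_on_imp_C1_on]
    by (auto intro: C1_on_bounded_linear bounded_linear_prod_left bounded_linear_prod_right)
  then show ?thesis
    using f' g'
    by (intro C2_onI[where f' = "\<lambda>x. (prod_left (g x) o\<^sub>L f' x) + (prod_right (f x) o\<^sub>L g' x)"]
        has_derivative_prod_blinfun C1_on_add
        bounded_bilinear.C1_on[OF bounded_bilinear_blinfun_compose]) auto
qed

lemma C2_on_compose:
  fixes f :: "'b::real_normed_vector \<Rightarrow> 'c::real_normed_vector"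
    and g :: "'a::real_normed_vector \<Rightarrow> 'b"
  assumes "C2_on T f" "C2_on S g" "g ` S \<subseteq> T"
  shows "C2_on S (\<lambda>x. f (g x))"
proof -
  obtain f' g' where f': "\<And>x. x \<in> T \<Longrightarrow> (f has_derivative blinfun_apply (f' x)) (at x)" "C1_on T f'"
    and g': "\<And>x. x \<in> S \<Longrightarrow> (g has_derivative blinfun_apply (g' x)) (at x)" "C1_on S g'"
    using assms unfolding C2_on_iff_C1_on by metis
  show ?thesis
  proof (rule C2_onI[where f' = "\<lambda>x. f' (g x) o\<^sub>L g' x"])
    fix x assume "x \<in> S"
    then have "((\<lambda>x. f (g x)) has_derivative (\<lambda>h. f' (g x) (g' x h))) (at x)"
      using assms(3) by (intro has_derivative_compose[OF g'(1) f'(1)]) auto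
    then show "((\<lambda>x. f (g x)) has_derivative blinfun_apply (f' (g x) o\<^sub>L g' x)) (at x)"
      by (simp add: blinfun_compose.rep_eq o_def)
  next
    show "C1_on S (\<lambda>x. f' (g x) o\<^sub>L g' x)"
      using C1_on_compose[OF f'(2) C2_on_imp_C1_on[OF assms(2)] assms(3)] g'(2)
      by (rule bounded_bilinear.C1_on[OF bounded_bilinear_blinfun_compose])
  qed
qed

section \<open>Iterated directional derivatives and their symmetry\<close>

lemma has_real_derivative_along_line:
  assumes "(f has_derivative F) (at (a + s *\<^sub>R v))"
  shows "((\<lambda>s. f (a + s *\<^sub>R v)) has_real_derivative F v) (at s)"
proof -
  have "((\<lambda>s. a + s *\<^sub>R v) has_derivative (\<lambda>h. h *\<^sub>R v)) (at s)"
    by (auto intro!: derivative_eq_intros)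
  from has_derivative_compose[OF this assms]
  have "((\<lambda>s. f (a + s *\<^sub>R v)) has_derivative (\<lambda>h. F (h *\<^sub>R v))) (at s)" .
  moreover have "F (h *\<^sub>R v) = F v * h" for h
    using has_derivative_linear[OF assms] by (simp add: linear_cmul)
  ultimately show ?thesis
    unfolding has_field_derivative_def by simp
qed

lemma dir_deriv_eq:
  assumes "(f has_derivative F) (at t)"
  shows "dir_deriv v f t = F v"
  unfolding dir_deriv_def
  by (rule DERIV_imp_deriv) (rule has_real_derivative_along_line, simp add: assms)

text \<open>Curried derivatives with continuity only for fixed directions: this passes to components
  of vectors and tensors without operator norms. In \<open>f'' y v w\<close> the direction
  \<open>w\<close> is differentiated first, in agreement with
  \<open>dir_deriv v (dir_deriv w f)\<close>.\<close>

definition twice_derivative_on ::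
  "'a::real_normed_vector set \<Rightarrow> ('a \<Rightarrow> 'b::real_normed_vector) \<Rightarrow>
    ('a \<Rightarrow> 'a \<Rightarrow> 'b) \<Rightarrow> ('a \<Rightarrow> 'a \<Rightarrow> 'a \<Rightarrow> 'b) \<Rightarrow> bool" where
  "twice_derivative_on S f f' f'' \<longleftrightarrow>
     (\<forall>y\<in>S. (f has_derivative f' y) (at y)) \<and>
     (\<forall>y\<in>S. \<forall>w. ((\<lambda>y. f' y w) has_derivative (\<lambda>v. f'' y v w)) (at y)) \<and>
     (\<forall>v w. continuous_on S (\<lambda>y. f'' y v w))"

lemma twice_derivative_onD:
  assumes "twice_derivative_on S f f' f''"
  shows "y \<in> S \<Longrightarrow> (f has_derivative f' y) (at y)"
    and "y \<in> S \<Longrightarrow> ((\<lambda>y. f' y w) has_derivative (\<lambda>v. f'' y v w)) (at y)"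
    and "continuous_on S (\<lambda>y. f'' y v w)"
  using assms unfolding twice_derivative_on_def by blast+

lemma C2_on_obtain_derivatives:
  assumes "C2_on S f"
  obtains f' f'' where "twice_derivative_on S f f' f''"
proof -
  obtain f' f'' where f': "\<And>x. x \<in> S \<Longrightarrow> (f has_derivative blinfun_apply (f' x)) (at x)"
    and f'': "\<And>x. x \<in> S \<Longrightarrow> (f' has_derivative blinfun_apply (f'' x)) (at x)"
    and cont: "continuous_on S f''"
    using assms unfolding C2_on_def by metis
  have "((\<lambda>y. f' y w) has_derivative (\<lambda>v. f'' y v w)) (at y)" if "y \<in> S" for y w
    using f''[OF that] by (auto intro!: derivative_eq_intros)
  moreover have "continuous_on S (\<lambda>y. f'' y v w)" for v w
    using cont by (intro continuous_intros)
  ultimately have "twice_derivative_on S f (\<lambda>y. blinfun_apply (f' y)) (\<lambda>y v. blinfun_apply (f'' y v))"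
    using f' unfolding twice_derivative_on_def by blast
  then show ?thesis by (rule that)
qed

lemma twice_derivative_on_bounded_linear:
  assumes T: "bounded_linear T" and f: "twice_derivative_on S f f' f''"
  shows "twice_derivative_on S (\<lambda>y. T (f y)) (\<lambda>y w. T (f' y w)) (\<lambda>y v w. T (f'' y v w))"
  unfolding twice_derivative_on_def
proof (intro conjI ballI allI)
  fix y v w
  show "((\<lambda>y. T (f y)) has_derivative (\<lambda>w. T (f' y w))) (at y)" if "y \<in> S"
    using twice_derivative_onD(1)[OF f that] by (rule bounded_linear.has_derivative[OF T])
  show "((\<lambda>y. T (f' y w)) has_derivative (\<lambda>v. T (f'' y v w))) (at y)" if "y \<in> S"
    using twice_derivative_onD(2)[OF f that] by (rule bounded_linear.has_derivative[OF T])
  show "continuous_on S (\<lambda>y. T (f'' y v w))"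
    using twice_derivative_onD(3)[OF f] by (rule bounded_linear.continuous_on[OF T])
qed

lemma twice_derivative_on_continuous:
  assumes "twice_derivative_on S f f' f''"
  shows "continuous_on S f" "continuous_on S (\<lambda>y. f' y w)"
  using twice_derivative_onD(1,2)[OF assms]
  by (meson continuous_at_imp_continuous_on has_derivative_continuous)+

lemma twice_derivative_on_eq_0:
  assumes f: "twice_derivative_on S f f' f''" and "open T" "T \<subseteq> S"
    and zero: "\<And>y. y \<in> T \<Longrightarrow> f y = 0" and y: "y \<in> T"
  shows "f' y w = 0" "f'' y v w = 0"
proof -
  have f'0: "f' y = (\<lambda>_. 0)" if "y \<in> T" for y
  proof (rule has_derivative_unique)
    show "(f has_derivative f' y) (at y)" using twice_derivative_onD(1)[OF f] that assms(3) by blast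
    show "(f has_derivative (\<lambda>_. 0)) (at y)"
      by (rule has_derivative_transform_within_open[OF has_derivative_const assms(2) that])
        (simp add: zero)
  qed
  show "f' y w = 0" using f'0[OF y] by simp
  have "(\<lambda>v. f'' y v w) = (\<lambda>_. 0)"
  proof (rule has_derivative_unique)
    show "((\<lambda>y. f' y w) has_derivative (\<lambda>v. f'' y v w)) (at y)"
      using twice_derivative_onD(2)[OF f] y assms(3) by blast
    show "((\<lambda>y. f' y w) has_derivative (\<lambda>_. 0)) (at y)"
      by (rule has_derivative_transform_within_open[OF has_derivative_const assms(2) y])
        (simp add: f'0)
  qed
  then show "f'' y v w = 0" by (rule fun_cong)
qed

lemma dir_deriv_dir_deriv_eq:
  assumes f: "twice_derivative_on S f f' f''" and "open S" "t \<in> S"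
  shows "dir_deriv v (dir_deriv w f) t = f'' t v w"
proof (rule dir_deriv_eq[where F = "\<lambda>v. f'' t v w"])
  show "(dir_deriv w f has_derivative (\<lambda>v. f'' t v w)) (at t)"
    by (rule has_derivative_transform_within_open[OF twice_derivative_onD(2)[OF f] assms(2,3)])
      (auto simp: dir_deriv_eq[OF twice_derivative_onD(1)[OF f]] assms)
qed

text \<open>Two mean value theorems: one along \<open>v\<close> for the increment of
  \<open>f\<close> in direction \<open>w\<close>, one along \<open>w\<close> for the resulting
  increment of \<open>f'\<close>. The left side is symmetric in \<open>v\<close> and
  \<open>w\<close>, the right side is not visibly so; this is the source of the symmetry of
  \<open>f''\<close>.\<close>

lemma second_difference:
  fixes f :: "'a::real_normed_vector \<Rightarrow> real"
  assumes f': "\<And>y. y \<in> ball x r \<Longrightarrow> (f has_derivative f' y) (at y)"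
    and f'': "\<And>y w. y \<in> ball x r \<Longrightarrow> ((\<lambda>y. f' y w) has_derivative (\<lambda>v. f'' y v w)) (at y)"
    and h: "h > 0" "h * (norm v + norm w) < r"
  shows "\<exists>y\<in>ball x r. f (x + h *\<^sub>R v + h *\<^sub>R w) - f (x + h *\<^sub>R v) - f (x + h *\<^sub>R w) + f x
           = h\<^sup>2 * f'' y w v"
proof -
  have inb: "x + s *\<^sub>R v + t *\<^sub>R w \<in> ball x r" if "0 \<le> s" "s \<le> h" "0 \<le> t" "t \<le> h" for s t
  proof -
    have "norm (s *\<^sub>R v + t *\<^sub>R w) \<le> s * norm v + t * norm w"
      using that by (intro norm_triangle_le) auto
    also have "\<dots> \<le> h * norm v + h * norm w"
      using that by (intro add_mono mult_right_mono) auto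
    also have "\<dots> < r" using h by (simp add: algebra_simps)
    finally have "norm (s *\<^sub>R v + t *\<^sub>R w) < r" .
    then have "dist (x + (s *\<^sub>R v + t *\<^sub>R w)) x < r"
      by (simp add: dist_norm)
    then show ?thesis by (simp add: dist_commute add.assoc)
  qed
  let ?g = "\<lambda>s. f ((x + h *\<^sub>R w) + s *\<^sub>R v) - f (x + s *\<^sub>R v)"
  have "\<exists>\<sigma>>0. \<sigma> < h \<and> ?g h - ?g 0 =
      (h - 0) * (f' ((x + h *\<^sub>R w) + \<sigma> *\<^sub>R v) v - f' (x + \<sigma> *\<^sub>R v) v)"
  proof (rule MVT2[OF h(1)])
    fix s assume s: "0 \<le> s" "s \<le> h"
    have "(x + h *\<^sub>R w) + s *\<^sub>R v \<in> ball x r" "x + s *\<^sub>R v \<in> ball x r"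
      using inb[of s h] inb[of s 0] s by (auto simp: algebra_simps)
    then show "(?g has_real_derivative
        (f' ((x + h *\<^sub>R w) + s *\<^sub>R v) v - f' (x + s *\<^sub>R v) v)) (at s)"
      by (intro DERIV_diff has_real_derivative_along_line f')
  qed
  then obtain \<sigma> where \<sigma>: "0 < \<sigma>" "\<sigma> < h" and 1: "?g h - ?g 0 =
      h * (f' ((x + \<sigma> *\<^sub>R v) + h *\<^sub>R w) v - f' (x + \<sigma> *\<^sub>R v) v)"
    by (auto simp: algebra_simps)
  let ?k = "\<lambda>t. f' ((x + \<sigma> *\<^sub>R v) + t *\<^sub>R w) v"
  have "\<exists>\<tau>>0. \<tau> < h \<and> ?k h - ?k 0 = (h - 0) * f'' ((x + \<sigma> *\<^sub>R v) + \<tau> *\<^sub>R w) w v"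
  proof (rule MVT2[OF h(1)])
    fix t assume t: "0 \<le> t" "t \<le> h"
    let ?y = "(x + \<sigma> *\<^sub>R v) + t *\<^sub>R w"
    have "((\<lambda>y. f' y v) has_derivative (\<lambda>u. f'' ?y u v)) (at ?y)"
      using inb[of \<sigma> t] \<sigma> t by (intro f'') auto
    then show "(?k has_real_derivative f'' ?y w v) (at t)"
      by (rule has_real_derivative_along_line)
  qed
  then obtain \<tau> where \<tau>: "0 < \<tau>" "\<tau> < h"
    and 2: "?k h - ?k 0 = h * f'' ((x + \<sigma> *\<^sub>R v) + \<tau> *\<^sub>R w) w v"
    by auto
  show ?thesis
  proof (rule bexI)
    show "(x + \<sigma> *\<^sub>R v) + \<tau> *\<^sub>R w \<in> ball x r" using inb[of \<sigma> \<tau>] \<sigma> \<tau> by auto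
    have "f (x + h *\<^sub>R v + h *\<^sub>R w) - f (x + h *\<^sub>R v) - f (x + h *\<^sub>R w) + f x = ?g h - ?g 0"
      by (simp add: algebra_simps)
    also have "\<dots> = h * (?k h - ?k 0)" using 1 by simp
    also have "\<dots> = h\<^sup>2 * f'' ((x + \<sigma> *\<^sub>R v) + \<tau> *\<^sub>R w) w v"
      unfolding 2 by (simp add: power2_eq_square)
    finally show "f (x + h *\<^sub>R v + h *\<^sub>R w) - f (x + h *\<^sub>R v) - f (x + h *\<^sub>R w) + f x
           = h\<^sup>2 * f'' ((x + \<sigma> *\<^sub>R v) + \<tau> *\<^sub>R w) w v" .
  qed
qed

text \<open>The symmetric second difference equals both \<open>f'' y w v\<close> and
  \<open>f'' z v w\<close>, up to the factor \<open>h\<^sup>2\<close>, at two points near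
  \<open>x\<close>. Continuity of \<open>f''\<close> carries the equality to
  \<open>x\<close>.\<close>

lemma second_derivative_symmetric:
  fixes f :: "'a::real_normed_vector \<Rightarrow> real"
  assumes f: "twice_derivative_on S f f' f''" and "open S" "x \<in> S"
  shows "f'' x v w = f'' x w v"
proof (rule ccontr)
  assume ne: "f'' x v w \<noteq> f'' x w v"
  \<comment> \<open>Half the supposed gap: each of the two values may deviate from its value at
    \<open>x\<close> by less than \<open>e\<close>, which cannot bridge the gap.\<close>
  define e where "e = \<bar>f'' x v w - f'' x w v\<bar> / 2"
  have e: "e > 0" using ne by (simp add: e_def)
  note c = twice_derivative_onD(3)[OF f]
  have ev: "\<forall>\<^sub>F y in nhds x. \<bar>f'' y a b - f'' x a b\<bar> < e" for a b
  proof -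
    have "((\<lambda>y. f'' y a b) \<longlongrightarrow> f'' x a b) (nhds x)"
      using c[of a b] assms(2,3) by (simp add: continuous_on_eq_continuous_at isCont_def tendsto_nhds_iff)
    then show ?thesis using e by (auto dest!: tendstoD simp: dist_real_def)
  qed
  have "\<forall>\<^sub>F y in nhds x. y \<in> S \<and> \<bar>f'' y v w - f'' x v w\<bar> < e \<and> \<bar>f'' y w v - f'' x w v\<bar> < e"
    using ev[of v w] ev[of w v] eventually_nhds_in_open[OF assms(2,3)] by eventually_elim auto
  then obtain r where r: "r > 0" and
    rb: "\<And>y. y \<in> ball x r \<Longrightarrow> y \<in> S \<and> \<bar>f'' y v w - f'' x v w\<bar> < e \<and> \<bar>f'' y w v - f'' x w v\<bar> < e"
    unfolding eventually_nhds_metric by (auto simp: dist_commute)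
  \<comment> \<open>Keeps the whole parallelogram inside the ball, as
    \<open>h * (norm v + norm w)\<close> is at most r/2; the summand 1 covers the case that both
    vectors vanish.\<close>
  define h where "h = r / (2 * (norm v + norm w + 1))"
  have h: "h > 0" using r by (auto simp: h_def intro!: divide_pos_pos add_nonneg_pos)
  have hr: "h * (norm v + norm w) < r"
  proof -
    have "h * (norm v + norm w) \<le> h * (norm v + norm w + 1)" using h by (intro mult_left_mono) auto
    also have "\<dots> = r / 2"
    proof -
      have "norm v + norm w + 1 > 0" by (intro add_nonneg_pos) auto
      then show ?thesis by (simp add: h_def field_simps)
    qed
    finally show ?thesis using r by simp
  qed
  obtain y where y: "y \<in> ball x r"
    "f (x + h *\<^sub>R v + h *\<^sub>R w) - f (x + h *\<^sub>R v) - f (x + h *\<^sub>R w) + f x = h\<^sup>2 * f'' y w v"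
    using second_difference[of x r f f' f'' h v w] twice_derivative_onD(1,2)[OF f] rb h hr by blast
  obtain z where z: "z \<in> ball x r"
    "f (x + h *\<^sub>R w + h *\<^sub>R v) - f (x + h *\<^sub>R w) - f (x + h *\<^sub>R v) + f x = h\<^sup>2 * f'' z v w"
    using second_difference[of x r f f' f'' h w v] twice_derivative_onD(1,2)[OF f] rb h hr
    by (metis add.commute)
  have "h\<^sup>2 * f'' y w v = h\<^sup>2 * f'' z v w"
    using y(2) z(2) by (simp add: algebra_simps)
  then have "f'' y w v = f'' z v w" using h by simp
  then have "\<bar>f'' x v w - f'' x w v\<bar> < 2 * e"
    using rb[OF y(1)] rb[OF z(1)] by linarith
  then show False by (simp add: e_def)
qed

section \<open>Partitions of unity\<close>

lemma C1_on_real_derivative: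
  fixes s :: "real \<Rightarrow> real"
  assumes "\<And>x. (s has_real_derivative s' x) (at x)" "continuous_on UNIV s'"
  shows "C1_on UNIV s"
proof (rule C1_onI[where f' = "\<lambda>x. blinfun_scaleR_left (s' x)"])
  show "(s has_derivative blinfun_apply (blinfun_scaleR_left (s' x))) (at x)" for x
    using assms(1)[of x] unfolding has_field_derivative_def
    by (rule has_derivative_eq_rhs) (auto simp: fun_eq_iff)
  show "continuous_on UNIV (\<lambda>x. blinfun_scaleR_left (s' x))"
    by (rule bounded_linear.continuous_on[OF bounded_linear_blinfun_scaleR_left assms(2)])
qed

lemma C2_on_real_derivative:
  fixes s :: "real \<Rightarrow> real"
  assumes "\<And>x. (s has_real_derivative s' x) (at x)" "C1_on UNIV s'"
  shows "C2_on UNIV s"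
proof (rule C2_onI[where f' = "\<lambda>x. blinfun_scaleR_left (s' x)"])
  show "(s has_derivative blinfun_apply (blinfun_scaleR_left (s' x))) (at x)" for x
    using assms(1)[of x] unfolding has_field_derivative_def
    by (rule has_derivative_eq_rhs) (auto simp: fun_eq_iff)
  show "C1_on UNIV (\<lambda>x. blinfun_scaleR_left (s' x))"
    by (rule C1_on_bounded_linear[OF bounded_linear_blinfun_scaleR_left assms(2)])
qed

lemma DERIV_square_pos_part:
  "((\<lambda>t::real. (max t 0)\<^sup>2) has_real_derivative 2 * max t 0) (at t)"
proof -
  consider "t > 0" | "t < 0" | "t = 0" by linarith
  then show ?thesis
  proof cases
    case 1
    have "((\<lambda>t. t\<^sup>2) has_real_derivative 2 * max t 0) (at t)"
      using 1 by (auto intro!: derivative_eq_intros)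
    then show ?thesis
      by (rule has_field_derivative_transform_within_open[of _ _ _ "{0<..}"]) (use 1 in auto)
  next
    case 2
    have "((\<lambda>t. 0) has_real_derivative 2 * max t 0) (at t)"
      using 2 by (auto intro!: derivative_eq_intros)
    then show ?thesis
      by (rule has_field_derivative_transform_within_open[of _ _ _ "{..<0}"]) (use 2 in auto)
  next
    case 3
    have "((\<lambda>h::real. (max h 0)\<^sup>2 / h) \<longlongrightarrow> 0) (at 0)"
    proof (rule Lim_null_comparison[where g = "\<lambda>h. \<bar>h\<bar>"])
      have "norm ((max h 0)\<^sup>2 / h) \<le> \<bar>h\<bar>" for h :: real
        by (cases "h > 0") (auto simp: power2_eq_square max_def)
      then show "\<forall>\<^sub>F h in at 0. norm ((max h 0)\<^sup>2 / h) \<le> \<bar>h :: real\<bar>" by simp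
      show "((\<lambda>h::real. \<bar>h\<bar>) \<longlongrightarrow> 0) (at 0)" by (rule tendsto_eq_intros | simp)+
    qed
    then show ?thesis using 3 by (simp add: has_field_derivative_iff)
  qed
qed

text \<open>Among the powers of the positive part, the cube is the first of class C2: the second
  derivative 6 max(t, 0) is still continuous.\<close>

lemma C2_on_cube_pos_part: "C2_on UNIV (\<lambda>t::real. (max t 0)^3)"
proof (rule C2_on_real_derivative)
  fix t :: real
  have eq: "(\<lambda>t::real. (max t 0)^3) = (\<lambda>t. t * (max t 0)\<^sup>2)"
    by (auto simp: fun_eq_iff max_def power3_eq_cube power2_eq_square)
  have "((\<lambda>t. t * (max t 0)\<^sup>2) has_real_derivative 1 * (max t 0)\<^sup>2 + 2 * max t 0 * t) (at t)"
    by (intro DERIV_mult DERIV_square_pos_part DERIV_ident)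
  also have "1 * (max t 0)\<^sup>2 + 2 * max t 0 * t = 3 * (max t 0)\<^sup>2"
    by (auto simp: max_def power2_eq_square)
  finally show "((\<lambda>t. (max t 0)^3) has_real_derivative 3 * (max t 0)\<^sup>2) (at t)"
    unfolding eq .
next
  show "C1_on UNIV (\<lambda>t::real. 3 * (max t 0)\<^sup>2)"
    by (rule C1_on_real_derivative[OF DERIV_cmult[OF DERIV_square_pos_part]])
      (intro continuous_intros)
qed

lemma C2_on_UNIV_compose: "C2_on UNIV f \<Longrightarrow> C2_on S g \<Longrightarrow> C2_on S (\<lambda>x. f (g x))"
  by (rule C2_on_compose) auto

text \<open>The witness is 1 - (1 - t_+^3)_+^3 with t_+ the positive part. The inner truncation
  makes it constant left of 0, the outer one right of 1, and both joints are C2 because of the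
  cubes.\<close>

lemma C2_step_function:
  obtains s :: "real \<Rightarrow> real" where "C2_on UNIV s" "\<And>t. 0 \<le> s t" "\<And>t. s t \<le> 1"
    "\<And>t. t \<le> 0 \<Longrightarrow> s t = 0" "\<And>t. t \<ge> 1 \<Longrightarrow> s t = 1"
proof
  let ?c = "\<lambda>t::real. (max t 0)^3"
  let ?s = "\<lambda>t. 1 + - ?c (1 + - ?c t)"
  note m = C2_on_UNIV_compose[OF C2_on_bounded_linear[OF bounded_linear_minus[OF bounded_linear_ident]]]
  show "C2_on UNIV ?s"
    by (intro C2_on_add C2_on_const m C2_on_UNIV_compose[OF C2_on_cube_pos_part] C2_on_cube_pos_part)
  show "?s t \<ge> 0" for t
    by (simp add: power_le_one)
  show "?s t \<le> 1" for t by simp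
  show "?s t = 0" if "t \<le> 0" for t using that by (simp add: max_def)
  show "?s t = 1" if "t \<ge> 1" for t
  proof -
    have "?c t \<ge> 1" using that by (simp add: max_def)
    then show ?thesis by (simp add: max_def)
  qed
qed

lemma C2_bump_function:
  fixes x :: "'a::euclidean_space"
  assumes "r > 0"
  obtains b :: "'a \<Rightarrow> real" where "C2_on UNIV b" "\<And>y. 0 \<le> b y" "\<And>y. b y \<le> 1"
    "\<And>y. y \<notin> cball x r \<Longrightarrow> b y = 0" "\<And>y. y \<in> ball x (r / 2) \<Longrightarrow> b y = 1"
proof -
  obtain s :: "real \<Rightarrow> real" where s: "C2_on UNIV s" "\<And>t. 0 \<le> s t" "\<And>t. s t \<le> 1"
    "\<And>t. t \<le> 0 \<Longrightarrow> s t = 0" "\<And>t. t \<ge> 1 \<Longrightarrow> s t = 1"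
    using C2_step_function by blast
  \<comment> \<open>The quadratic 2 - 2 |y - x|^2 / r^2 is nonpositive from radius r on and at least
    3/2 inside radius r/2, so the step function turns it into the bump. Using the squared norm
    avoids the kink of the norm at \<open>x\<close>.\<close>
  define k where "k = (\<lambda>y. 2 + (- 2 / r\<^sup>2) * ((y + - x) \<bullet> (y + - x)))"
  have k: "k y = 2 - 2 * ((norm (y - x))\<^sup>2 / r\<^sup>2)" for y
    by (simp add: k_def dot_square_norm)
  have "C2_on UNIV (\<lambda>y::'a. y + - x)"
    by (intro C2_on_add C2_on_const C2_on_bounded_linear bounded_linear_ident)
  from bounded_bilinear.C2_on[OF bounded_bilinear_inner this this]
  have "C2_on UNIV k"
    unfolding k_def
    by (intro C2_on_add C2_on_const
      C2_on_UNIV_compose[OF C2_on_bounded_linear[OF bounded_linear_mult_right]])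
  then have "C2_on UNIV (\<lambda>y. s (k y))" by (rule C2_on_UNIV_compose[OF s(1)])
  moreover have "s (k y) = 0" if "y \<notin> cball x r" for y
  proof (rule s(4))
    have "r\<^sup>2 \<le> (norm (y - x))\<^sup>2"
      using that assms by (intro power_mono) (auto simp: dist_norm norm_minus_commute)
    then have "1 \<le> (norm (y - x))\<^sup>2 / r\<^sup>2" using assms by simp
    then show "k y \<le> 0" unfolding k by linarith
  qed
  moreover have "s (k y) = 1" if "y \<in> ball x (r / 2)" for y
  proof (rule s(5))
    have "(norm (y - x))\<^sup>2 \<le> (r / 2)\<^sup>2"
      using that assms by (intro power_mono) (auto simp: dist_norm norm_minus_commute)
    then have "(norm (y - x))\<^sup>2 / r\<^sup>2 \<le> 1 / 4" using assms by (simp add: field_simps power2_eq_square)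
    then show "k y \<ge> 1" unfolding k by linarith
  qed
  ultimately show ?thesis using that[of "\<lambda>y. s (k y)"] s(2,3) by blast
qed

text \<open>Each new bump is multiplied by the product of 1 - b over the earlier ones, so the sum
  telescopes. No division by the sum of the bumps occurs, hence no quotient rule and no region where
  that sum must be positive.\<close>

lemma C2_subpartition_of_unity:
  fixes b :: "'i \<Rightarrow> 'a::real_normed_vector \<Rightarrow> real"
  assumes "finite F" "\<And>i. C2_on UNIV (b i)" "\<And>i y. 0 \<le> b i y" "\<And>i y. b i y \<le> 1"
  shows "\<exists>\<beta>. (\<forall>i. C2_on UNIV (\<beta> i)) \<and> (\<forall>i y. 0 \<le> \<beta> i y \<and> \<beta> i y \<le> b i y) \<and>
    (\<forall>y. (\<Sum>i\<in>F. \<beta> i y) = 1 - (\<Prod>i\<in>F. 1 - b i y))"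
  using assms(1)
proof induction
  case empty
  show ?case using assms by (intro exI[of _ b]) auto
next
  case (insert j F)
  then obtain \<beta> where \<beta>: "\<And>i. C2_on UNIV (\<beta> i)" "\<And>i y. 0 \<le> \<beta> i y" "\<And>i y. \<beta> i y \<le> b i y"
    "\<And>y. (\<Sum>i\<in>F. \<beta> i y) = 1 - (\<Prod>i\<in>F. 1 - b i y)"
    by metis
  \<comment> \<open>By the induction hypothesis the bracket equals the product of the factors
    \<open>1 - b i y\<close>; in this form its C2 regularity comes from the weights already
    built.\<close>
  define g where "g = (\<lambda>y. b j y * (1 + (\<Sum>i\<in>F. - 1 * \<beta> i y)))"
  have g: "g y = b j y * (\<Prod>i\<in>F. 1 - b i y)" for y
    using \<beta>(4)[of y] by (simp add: g_def sum_negf)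
  have P: "0 \<le> (\<Prod>i\<in>F. 1 - b i y)" "(\<Prod>i\<in>F. 1 - b i y) \<le> 1" for y
    using assms by (auto intro!: prod_nonneg prod_le_1)
  have "C2_on UNIV g" unfolding g_def
    by (intro bounded_bilinear.C2_on[OF bounded_bilinear_mult] C2_on_add C2_on_const C2_on_sum assms \<beta>)
  moreover have "0 \<le> g y" "g y \<le> b j y" for y
    using P[of y] assms(3)[of j y] by (auto simp: g mult_left_le)
  moreover have "(\<Sum>i\<in>insert j F. (\<beta>(j := g)) i y) = 1 - (\<Prod>i\<in>insert j F. 1 - b i y)" for y
  proof -
    have "(\<Sum>i\<in>F. (\<beta>(j := g)) i y) = (\<Sum>i\<in>F. \<beta> i y)"
      using insert.hyps by (intro sum.cong) auto
    then show ?thesis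
      using insert.hyps by (simp add: \<beta>(4) g algebra_simps)
  qed
  ultimately show ?case
    using \<beta> by (intro exI[of _ "\<beta>(j := g)"]) auto
qed

text \<open>The half-radius balls cover \<open>K\<close>, so at a point of \<open>K\<close> some
  bump equals 1, its factor in the product vanishes, and the weights sum to exactly 1. The
  full-radius closed balls supply the compact supports.\<close>

lemma C2_partition_of_unity:
  fixes K :: "'a::euclidean_space set"
  assumes "compact K" and V: "\<And>x. x \<in> K \<Longrightarrow> open (V x)" "\<And>x. x \<in> K \<Longrightarrow> x \<in> V x"
  obtains F and \<beta> :: "'a \<Rightarrow> 'a \<Rightarrow> real" where "finite F" "F \<subseteq> K" "\<And>x. C2_on UNIV (\<beta> x)"
    "\<And>x y. 0 \<le> \<beta> x y" "\<And>y. (\<Sum>x\<in>F. \<beta> x y) \<le> 1" "\<And>y. y \<in> K \<Longrightarrow> (\<Sum>x\<in>F. \<beta> x y) = 1"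
    "\<And>x. x \<in> F \<Longrightarrow> \<exists>C. compact C \<and> C \<subseteq> V x \<and> (\<forall>y. y \<notin> C \<longrightarrow> \<beta> x y = 0)"
proof -
  have "\<exists>r>0. x \<in> K \<longrightarrow> cball x r \<subseteq> V x" for x
    using V[of x] open_contains_cball[of "V x"] zero_less_one by blast
  then obtain r where r: "\<And>x. r x > 0" "\<And>x. x \<in> K \<Longrightarrow> cball x (r x) \<subseteq> V x" by metis
  have "\<exists>b :: 'a \<Rightarrow> real. C2_on UNIV b \<and> (\<forall>y. 0 \<le> b y) \<and> (\<forall>y. b y \<le> 1) \<and>
      (\<forall>y. y \<notin> cball x (r x) \<longrightarrow> b y = 0) \<and> (\<forall>y \<in> ball x (r x / 2). b y = 1)" for x
    using C2_bump_function[OF r(1)[of x], of x] by metis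
  then obtain b :: "'a \<Rightarrow> 'a \<Rightarrow> real" where b: "\<And>x. C2_on UNIV (b x)" "\<And>x y. 0 \<le> b x y" "\<And>x y. b x y \<le> 1"
    "\<And>x y. y \<notin> cball x (r x) \<Longrightarrow> b x y = 0" "\<And>x y. y \<in> ball x (r x / 2) \<Longrightarrow> b x y = 1"
    by metis
  obtain F where F: "F \<subseteq> K" "finite F" "K \<subseteq> (\<Union>x\<in>F. ball x (r x / 2))"
    using compactE_image[OF assms(1), of K "\<lambda>x. ball x (r x / 2)"] r(1) by force
  obtain \<beta> where \<beta>: "\<And>i. C2_on UNIV (\<beta> i)" "\<And>i y. 0 \<le> \<beta> i y" "\<And>i y. \<beta> i y \<le> b i y"
    "\<And>y. (\<Sum>i\<in>F. \<beta> i y) = 1 - (\<Prod>i\<in>F. 1 - b i y)"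
    using C2_subpartition_of_unity[of F b] F(2) b(1-3) by metis
  show ?thesis
  proof (rule that[OF F(2,1) \<beta>(1,2)])
    show "(\<Sum>x\<in>F. \<beta> x y) \<le> 1" for y
      unfolding \<beta>(4) using b(3) by (auto intro!: prod_nonneg)
    show "(\<Sum>x\<in>F. \<beta> x y) = 1" if y: "y \<in> K" for y
    proof -
      obtain x where "x \<in> F" "y \<in> ball x (r x / 2)" using F(3) y by blast
      then show ?thesis unfolding \<beta>(4) using F(2) b(5) by auto
    qed
    show "\<exists>C. compact C \<and> C \<subseteq> V x \<and> (\<forall>y. y \<notin> C \<longrightarrow> \<beta> x y = 0)" if "x \<in> F" for x
    proof (intro exI conjI allI impI)
      show "cball x (r x) \<subseteq> V x" using r(2) F(1) that by blast
      show "\<beta> x y = 0" if "y \<notin> cball x (r x)" for y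
        using \<beta>(2,3)[of x y] b(4)[OF that] by simp
    qed auto
  qed
qed

section \<open>Integration of derivatives of compactly supported functions\<close>

text \<open>Extension by zero is differentiable on the whole space because \<Omega> and the
  complement of \<open>K\<close> are open and cover it. On the whole space the derivative is a
  dominated limit of difference quotients, so neither Fubini nor a choice of coordinates is
  involved.\<close>

lemma integral_directional_derivative_eq_0:
  fixes W :: "'a::euclidean_space \<Rightarrow> real"
  assumes "open \<Omega>" "compact K" "K \<subseteq> \<Omega>"
    and zero: "\<And>x. x \<in> \<Omega> - K \<Longrightarrow> W x = 0"
    and W': "\<And>x. x \<in> \<Omega> \<Longrightarrow> (W has_derivative W' x) (at x)"
    and cont: "continuous_on \<Omega> (\<lambda>x. W' x e)"
  shows "(\<integral>x. W' x e \<partial>restrict_space lborel \<Omega>) = 0"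
proof -
  define V where "V = (\<lambda>x. if x \<in> \<Omega> then W x else 0)"
  define D where "D = (\<lambda>x. if x \<in> \<Omega> then W' x e else 0)"
  have oK: "open (- K)" using assms(2) by (simp add: compact_imp_closed open_Compl)
  have V0: "V x = 0" if "x \<notin> K" for x using zero that by (auto simp: V_def)
  have dV0: "(V has_derivative (\<lambda>_. 0)) (at x)" if "x \<notin> K" for x
    by (rule has_derivative_transform_within_open[OF has_derivative_const oK]) (use that V0 in auto)
  have dV1: "(V has_derivative W' x) (at x)" if "x \<in> \<Omega>" for x
    by (rule has_derivative_transform_within_open[OF W' assms(1)]) (use that in \<open>auto simp: V_def\<close>)
  \<comment> \<open>On the overlap of \<Omega> with the complement of \<open>K\<close> both local
    derivatives are available, and uniqueness forces the directional derivative to vanish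
    there.\<close>
  have D0: "D x = 0" if "x \<notin> K" for x
    using has_derivative_unique[OF dV0[OF that] dV1] by (auto simp: D_def fun_eq_iff)
  have dV: "\<exists>F. (V has_derivative F) (at x) \<and> F e = D x" for x
    using dV0[of x] dV1[of x] assms(3) D0[of x] by (cases "x \<in> K") (auto simp: D_def)
  have line: "((\<lambda>s. V (x + s *\<^sub>R e)) has_real_derivative D (x + s *\<^sub>R e)) (at s)" for x s
    using dV[of "x + s *\<^sub>R e"] by (metis has_real_derivative_along_line)
  have contV: "continuous_on UNIV V"
    using dV by (meson continuous_at_imp_continuous_on has_derivative_continuous)
  have "continuous_on (\<Omega> \<union> - K) D"
  proof (rule continuous_on_open_Un[OF assms(1) oK])
    show "continuous_on \<Omega> D" using cont by (rule continuous_on_eq) (simp add: D_def)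
    show "continuous_on (- K) D" by (rule continuous_on_eq[of _ "\<lambda>_. 0"]) (auto simp: D0)
  qed
  then have contD: "continuous_on UNIV D" using assms(3) by (auto intro: continuous_on_subset)
  have "bounded (D ` K)"
    using assms(2) contD by (intro compact_imp_bounded compact_continuous_image) (auto intro: continuous_on_subset)
  then obtain M where M: "M > 0" "\<And>x. x \<in> K \<Longrightarrow> \<bar>D x\<bar> \<le> M"
    unfolding bounded_pos by auto
  have DM: "\<bar>D x\<bar> \<le> M" for x using M D0[of x] by (cases "x \<in> K") auto
  obtain R0 where R0: "\<And>x. x \<in> K \<Longrightarrow> norm x \<le> R0"
    using compact_imp_bounded[OF assms(2)] unfolding bounded_iff by blast
  \<comment> \<open>The steps satisfy h n \<le> 1, so outside this radius both \<open>x\<close> and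
    \<open>x + h n *\<^sub>R e\<close> lie off \<open>K\<close> and the quotient is zero. This makes
    the dominating function independent of n.\<close>
  define R where "R = R0 + norm e"
  define h where "h = (\<lambda>n::nat. 1 / real (Suc n))"
  have h: "0 < h n" "h n \<le> 1" for n by (auto simp: h_def)
  \<comment> \<open>The difference quotients integrate to 0 by translation invariance of Lebesgue measure.\<close>
  define q where "q = (\<lambda>n x. (V (x + h n *\<^sub>R e) - V x) / h n)"
  have q_le: "norm (q n x) \<le> M * indicator (cball 0 R) x" for n x
  proof (cases "x \<in> cball 0 R")
    case True
    have "\<exists>z>0. z < h n \<and> V (x + h n *\<^sub>R e) - V (x + 0 *\<^sub>R e) = (h n - 0) * D (x + z *\<^sub>R e)"
      by (rule MVT2[OF h(1)]) (rule line)
    then obtain z where "V (x + h n *\<^sub>R e) - V x = h n * D (x + z *\<^sub>R e)" by auto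
    then have "q n x = D (x + z *\<^sub>R e)" using h(1)[of n] by (simp add: q_def)
    then show ?thesis using True DM by simp
  next
    case False
    have "norm e * h n \<le> norm e" using h[of n] by (intro mult_left_le) auto
    moreover have "norm x > R0 + norm e" using False by (simp add: R_def)
    moreover have "norm x \<le> norm (x + h n *\<^sub>R e) + norm e * h n"
      using norm_triangle_ineq4[of "x + h n *\<^sub>R e" "h n *\<^sub>R e"] h(1)[of n] by (simp add: mult.commute)
    ultimately have "norm x > R0" "norm (x + h n *\<^sub>R e) > R0"
      using norm_ge_zero[of e] by linarith+
    then have "x \<notin> K" "x + h n *\<^sub>R e \<notin> K" using R0 by fastforce+
    then show ?thesis using V0 M(1) by (simp add: q_def)
  qed
  have [measurable]: "V \<in> borel_measurable borel" "D \<in> borel_measurable borel"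
    using contV contD by (auto intro: borel_measurable_continuous_onI)
  have [measurable]: "q n \<in> borel_measurable borel" for n
    unfolding q_def by measurable
  have intV: "integrable lborel V"
  proof -
    have "integrable lborel (\<lambda>x. indicator K x *\<^sub>R V x)"
      using borel_integrable_compact[OF assms(2), of V] contV continuous_on_subset by blast
    moreover have "(\<lambda>x. indicator K x *\<^sub>R V x) = V" using V0 by (auto simp: fun_eq_iff indicator_def)
    ultimately show ?thesis by simp
  qed
  have shift: "integrable lborel (\<lambda>x. V (x + a))" "(\<integral>x. V (x + a) \<partial>lborel) = (\<integral>x. V x \<partial>lborel)" for a
  proof -
    have d: "lborel = distr lborel lborel ((+) a)"
      using lborel_distr_plus[of a] by (simp cong: distr_cong)
    have "integrable (distr lborel lborel ((+) a)) V" using intV d by metis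
    then show "integrable lborel (\<lambda>x. V (x + a))"
      by (subst (asm) integrable_distr_eq) (auto simp: add.commute)
    have "(\<integral>x. V x \<partial>lborel) = (\<integral>x. V x \<partial>(distr lborel lborel ((+) a)))" using d by metis
    also have "\<dots> = (\<integral>x. V (x + a) \<partial>lborel)"
      by (subst integral_distr) (auto simp: add.commute)
    finally show "(\<integral>x. V (x + a) \<partial>lborel) = (\<integral>x. V x \<partial>lborel)" by simp
  qed
  have q0: "(\<integral>x. q n x \<partial>lborel) = 0" for n
    unfolding q_def using shift intV by simp
  have lim: "(\<lambda>n. q n x) \<longlonglongrightarrow> D x" for x
  proof -
    have "((\<lambda>s. (V (x + s *\<^sub>R e) - V x) / s) \<longlongrightarrow> D x) (at 0)"
      using line[of x 0] by (simp add: has_field_derivative_iff)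
    moreover have "filterlim h (at 0) sequentially"
      unfolding filterlim_at using LIMSEQ_inverse_real_of_nat h(1)
      by (auto simp: h_def inverse_eq_divide)
    ultimately show ?thesis
      unfolding q_def by (rule filterlim_compose)
  qed
  have "(\<lambda>n. \<integral>x. q n x \<partial>lborel) \<longlonglongrightarrow> (\<integral>x. D x \<partial>lborel)"
  proof (rule integral_dominated_convergence[where w = "\<lambda>x. M * indicator (cball 0 R) x"])
    show "integrable lborel (\<lambda>x. M * indicator (cball 0 R) x :: real)"
      using emeasure_bounded_finite[of "cball 0 R"]
      by (intro integrable_mult_right integrable_real_indicator) auto
    show "AE x in lborel. (\<lambda>n. q n x) \<longlonglongrightarrow> D x" using lim by simp
    show "AE x in lborel. norm (q n x) \<le> M * indicator (cball 0 R) x" for n using q_le by simp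
  qed auto
  then have "(\<integral>x. D x \<partial>lborel) = 0"
    unfolding q0 using LIMSEQ_unique tendsto_const by blast
  moreover have "(\<integral>x. W' x e \<partial>restrict_space lborel \<Omega>) = (\<integral>x. indicator \<Omega> x *\<^sub>R W' x e \<partial>lborel)"
    using assms(1) by (subst integral_restrict_space) auto
  moreover have "\<dots> = (\<integral>x. D x \<partial>lborel)"
    by (intro Bochner_Integration.integral_cong) (auto simp: D_def)
  ultimately show ?thesis by simp
qed

section \<open>Measures carried by a graph\<close>

text \<open>The image under x -> (x, u x) of the vector measure on \<Omega> with Lebesgue density
  \<open>w\<close>.\<close>

definition graph_density ::
  "'a::euclidean_space set \<Rightarrow> ('a \<Rightarrow> 'b) \<Rightarrow> ('a \<Rightarrow> 'c::euclidean_space) \<Rightarrow> ('a \<times> 'b) set \<Rightarrow> 'c" where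
  "graph_density \<Omega> u w A = (\<integral>x. indicat_real A (x, u x) *\<^sub>R w x \<partial>restrict_space lborel \<Omega>)"

text \<open>Only Borel subsets of \<open>U\<close> enter the Jordan decomposition. This restriction
  is essential below: components of \<open>graph_density\<close> can be pulled out of the integral
  only on such sets, where the integrand is integrable.\<close>

lemma signed_integral_cong:
  assumes "\<And>A. A \<in> sets (restrict_space borel U) \<Longrightarrow> \<mu> A = \<nu> A"
    and "\<And>t. t \<in> U \<Longrightarrow> \<phi> t = \<psi> t"
  shows "signed_integral U \<mu> \<phi> = signed_integral U \<nu> \<psi>"
proof -
  have "pos_part_measure U \<mu> = pos_part_measure U \<nu>"
    "pos_part_measure U (\<lambda>A. - \<mu> A) = pos_part_measure U (\<lambda>A. - \<nu> A)"
    unfolding pos_part_measure_def using assms(1)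
    by (auto intro!: arg_cong[where f = "measure_of _ _"] SUP_cong simp: fun_eq_iff)
  moreover have "space (pos_part_measure U \<nu>') = U" for \<nu>'
    using sets.space_closed[of "restrict_space borel U"]
    by (simp add: pos_part_measure_def space_measure_of_conv)
  ultimately show ?thesis
    unfolding signed_integral_def using assms(2)
    by (auto intro!: arg_cong2[where f = minus] Bochner_Integration.integral_cong)
qed

locale graph =
  fixes \<Omega> :: "'a::euclidean_space set" and \<Gamma> :: "'b::euclidean_space set" and u :: "'a \<Rightarrow> 'b"
  assumes open_domain: "open \<Omega>" and bounded_domain: "bounded \<Omega>"
    and continuous_u: "continuous_on \<Omega> u" and range_u: "u ` \<Omega> \<subseteq> \<Gamma>"
begin

abbreviation L :: "'a measure" where "L \<equiv> restrict_space lborel \<Omega>"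

lemma space_L: "space L = \<Omega>"
  by (simp add: space_restrict_space)

lemma sets_L: "sets L = sets (restrict_space borel \<Omega>)"
  by (intro sets_restrict_space_cong) simp

lemma finite_measure_L: "finite_measure L"
  using open_domain emeasure_bounded_finite[OF bounded_domain]
  by (intro finite_measureI) (simp add: emeasure_restrict_space space_restrict_space)

lemma measurable_L_continuous: "continuous_on \<Omega> w \<Longrightarrow> w \<in> borel_measurable L"
  using borel_measurable_continuous_on_restrict measurable_cong_sets[OF sets_L refl] by blast

lemma measurable_graph_map: "(\<lambda>x. (x, u x)) \<in> measurable L (restrict_space borel (\<Omega> \<times> \<Gamma>))"
proof (rule measurable_restrict_space2)
  show "(\<lambda>x. (x, u x)) \<in> space L \<rightarrow> \<Omega> \<times> \<Gamma>" using range_u by (auto simp: space_L)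
  show "(\<lambda>x. (x, u x)) \<in> borel_measurable L"
    using continuous_u by (intro measurable_L_continuous continuous_intros)
qed

lemma measurable_indicator_graph:
  assumes "A \<in> sets (restrict_space borel (\<Omega> \<times> \<Gamma>))"
  shows "(\<lambda>x. indicat_real A (x, u x)) \<in> borel_measurable L"
  using measurable_compose[OF measurable_graph_map borel_measurable_indicator[OF assms]] .

lemma integrable_continuous_compact_support:
  fixes w :: "'a \<Rightarrow> 'c::euclidean_space"
  assumes "continuous_on \<Omega> w" "compact K" "K \<subseteq> \<Omega>" "\<And>x. x \<in> \<Omega> - K \<Longrightarrow> w x = 0"
  shows "integrable L w"
proof -
  interpret finite_measure L by (rule finite_measure_L)
  have "bounded (w ` K)"
    using assms by (intro compact_imp_bounded compact_continuous_image) (auto intro: continuous_on_subset)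
  then obtain M where M: "M > 0" "\<And>x. x \<in> K \<Longrightarrow> norm (w x) \<le> M"
    unfolding bounded_pos by auto
  have "norm (w x) \<le> M" if "x \<in> \<Omega>" for x
    using M assms(4)[of x] that by (cases "x \<in> K") auto
  then show ?thesis
    by (intro integrable_const_bound[where B = M] measurable_L_continuous assms AE_I2)
      (simp add: space_L)
qed

lemma integrable_indicator_graph:
  fixes w :: "'a \<Rightarrow> 'c::euclidean_space"
  assumes w: "integrable L w" and A: "A \<in> sets (restrict_space borel (\<Omega> \<times> \<Gamma>))"
  shows "integrable L (\<lambda>x. indicat_real A (x, u x) *\<^sub>R w x)"
proof (rule Bochner_Integration.integrable_bound[OF w])
  show "(\<lambda>x. indicat_real A (x, u x) *\<^sub>R w x) \<in> borel_measurable L"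
    using measurable_indicator_graph[OF A] borel_measurable_integrable[OF w]
    by (rule borel_measurable_scaleR)
qed (auto simp: indicator_def)

text \<open>For disjoint sets the partial sums of indicators stay below 1, so
  \<open>norm (w x)\<close> dominates and countable additivity is dominated convergence.\<close>

lemma radon_measure_on_graph_density:
  fixes w :: "'a \<Rightarrow> 'c::euclidean_space"
  assumes w: "integrable L w"
  shows "radon_measure_on (\<Omega> \<times> \<Gamma>) (graph_density \<Omega> u w)"
  unfolding radon_measure_on_def
proof (intro allI impI)
  fix A :: "nat \<Rightarrow> ('a \<times> 'b) set"
  assume A: "range A \<subseteq> sets (restrict_space borel (\<Omega> \<times> \<Gamma>))" and disj: "disjoint_family A"
  have UA: "(\<Union>n. A n) \<in> sets (restrict_space borel (\<Omega> \<times> \<Gamma>))" using A by auto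
  have sums: "(\<lambda>n. indicat_real (A n) t) sums indicat_real (\<Union>n. A n) t" for t
    using disj by (intro indicator_sums) (auto simp: disjoint_family_on_def)
  have int: "integrable L (\<lambda>x. indicat_real (A n) (x, u x) *\<^sub>R w x)" for n
    using A by (intro integrable_indicator_graph w) auto
  have "(\<lambda>n. \<integral>x. (\<Sum>i<n. indicat_real (A i) (x, u x) *\<^sub>R w x) \<partial>L)
      \<longlonglongrightarrow> (\<integral>x. indicat_real (\<Union>n. A n) (x, u x) *\<^sub>R w x \<partial>L)"
  proof (rule integral_dominated_convergence[where w = "\<lambda>x. norm (w x)"])
    show "AE x in L. (\<lambda>n. \<Sum>i<n. indicat_real (A i) (x, u x) *\<^sub>R w x)
        \<longlonglongrightarrow> indicat_real (\<Union>n. A n) (x, u x) *\<^sub>R w x"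
      using sums_scaleR_left[OF sums] by (auto simp: sums_def)
    show "AE x in L. norm (\<Sum>i<n. indicat_real (A i) (x, u x) *\<^sub>R w x) \<le> norm (w x)" for n
    proof (rule AE_I2)
      fix x
      have "(\<Sum>i<n. indicat_real (A i) (x, u x)) \<le> indicat_real (\<Union>n. A n) (x, u x)"
        using sum_le_suminf[OF sums_summable[OF sums], of "{..<n}" "(x, u x)"] sums_unique[OF sums]
        by auto
      also have "\<dots> \<le> 1" by (simp add: indicator_def)
      finally have "(\<Sum>i<n. indicat_real (A i) (x, u x)) * norm (w x) \<le> 1 * norm (w x)"
        by (rule mult_right_mono) simp
      moreover have "(\<Sum>i<n. indicat_real (A i) (x, u x)) \<ge> 0" by (intro sum_nonneg) auto
      ultimately show "norm (\<Sum>i<n. indicat_real (A i) (x, u x) *\<^sub>R w x) \<le> norm (w x)"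
        by (simp flip: scaleR_sum_left)
    qed
    show "(\<lambda>x. \<Sum>i<n. indicat_real (A i) (x, u x) *\<^sub>R w x) \<in> borel_measurable L" for n
      by (intro borel_measurable_sum borel_measurable_integrable int)
    show "(\<lambda>x. indicat_real (\<Union>n. A n) (x, u x) *\<^sub>R w x) \<in> borel_measurable L"
      by (intro borel_measurable_integrable integrable_indicator_graph w UA)
  qed (use w in auto)
  then show "(\<lambda>n. graph_density \<Omega> u w (A n)) sums graph_density \<Omega> u w (\<Union>n. A n)"
    unfolding graph_density_def sums_def by (simp only: Bochner_Integration.integral_sum[OF int])
qed

text \<open>The Hahn decomposition is explicit: among the Borel subsets of \<open>A\<close>, the
  part of \<open>A\<close> lying over the points with w \<ge> 0 attains the supremum. Hence the
  positive part is the image of the measure with density max(w, 0); the truncation is performed by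
  \<open>ennreal\<close>.\<close>

lemma pos_part_graph_density:
  fixes w :: "'a \<Rightarrow> real"
  assumes w: "integrable L w"
  shows "pos_part_measure (\<Omega> \<times> \<Gamma>) (graph_density \<Omega> u w) =
    distr (density L (\<lambda>x. ennreal (w x))) (restrict_space borel (\<Omega> \<times> \<Gamma>)) (\<lambda>x. (x, u x))"
    (is "_ = ?M")
proof -
  let ?R = "restrict_space borel (\<Omega> \<times> \<Gamma>)"
  let ?S = "sets ?R"
  note [measurable] = borel_measurable_integrable[OF w]
  have spaceR: "space ?R = \<Omega> \<times> \<Gamma>" by (simp add: space_restrict_space)
  have "pos_part_measure (\<Omega> \<times> \<Gamma>) (graph_density \<Omega> u w) = measure_of (\<Omega> \<times> \<Gamma>) ?S (emeasure ?M)"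
    unfolding pos_part_measure_def
  proof (rule measure_of_eq)
    show "?S \<subseteq> Pow (\<Omega> \<times> \<Gamma>)" using sets.space_closed[of ?R] spaceR by simp
    fix A assume "A \<in> sigma_sets (\<Omega> \<times> \<Gamma>) ?S"
    then have A: "A \<in> ?S" using sets.sigma_sets_eq[of ?R] spaceR by simp
    have intA: "integrable L (\<lambda>x. indicat_real A (x, u x) * max 0 (w x))"
    proof (rule Bochner_Integration.integrable_bound[OF w])
      show "(\<lambda>x. indicat_real A (x, u x) * max 0 (w x)) \<in> borel_measurable L"
        using measurable_indicator_graph[OF A] by (rule borel_measurable_times) simp
    qed (auto simp: indicator_def)
    have M: "emeasure ?M A = ennreal (\<integral>x. indicat_real A (x, u x) * max 0 (w x) \<partial>L)"
    proof -
      have "emeasure ?M A = emeasure (density L (\<lambda>x. ennreal (w x))) ((\<lambda>x. (x, u x)) -` A \<inter> space L)"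
        using measurable_graph_map A by (subst emeasure_distr) auto
      also have "\<dots> = (\<integral>\<^sup>+x. ennreal (w x) * indicator ((\<lambda>x. (x, u x)) -` A \<inter> space L) x \<partial>L)"
        using measurable_sets[OF measurable_graph_map A] by (subst emeasure_density) auto
      also have "\<dots> = (\<integral>\<^sup>+x. ennreal (indicat_real A (x, u x) * max 0 (w x)) \<partial>L)"
        by (intro nn_integral_cong) (auto simp: indicator_def max_def ennreal_neg)
      also have "\<dots> = ennreal (\<integral>x. indicat_real A (x, u x) * max 0 (w x) \<partial>L)"
        using intA by (intro nn_integral_eq_integral) auto
      finally show ?thesis .
    qed
    show "(SUP B\<in>{B \<in> ?S. B \<subseteq> A}. ennreal (graph_density \<Omega> u w B)) = emeasure ?M A"
    proof (rule antisym)
      show "(SUP B\<in>{B \<in> ?S. B \<subseteq> A}. ennreal (graph_density \<Omega> u w B)) \<le> emeasure ?M A"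
        unfolding M
      proof (intro SUP_least ennreal_leI)
        fix B assume B: "B \<in> {B \<in> ?S. B \<subseteq> A}"
        have "integrable L (\<lambda>x. indicat_real B (x, u x) *\<^sub>R w x)"
          using B by (intro integrable_indicator_graph w) auto
        then show "graph_density \<Omega> u w B \<le> (\<integral>x. indicat_real A (x, u x) * max 0 (w x) \<partial>L)"
          unfolding graph_density_def
          by (intro integral_mono intA) (use B in \<open>auto simp: indicator_def\<close>)
      qed
      \<comment> \<open>The Hahn set is a condition on the first coordinate only, so its
        measurability follows from that of \<open>w\<close> on \<Omega>.\<close>
      have "(\<lambda>t. w (fst t)) \<in> borel_measurable ?R"
      proof (rule measurable_compose[where N = L])
        show "fst \<in> measurable ?R L"
          unfolding measurable_cong_sets[OF refl sets_L]
          by (intro measurable_restrict_space2 measurable_restrict_space1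
              borel_measurable_continuous_onI continuous_intros) (auto simp: spaceR)
      qed simp
      then have "{t \<in> space ?R. 0 \<le> w (fst t)} \<in> ?S" by simp
      then have "A \<inter> {t \<in> space ?R. 0 \<le> w (fst t)} \<in> ?S" using A by blast
      moreover have "graph_density \<Omega> u w (A \<inter> {t \<in> space ?R. 0 \<le> w (fst t)}) =
          (\<integral>x. indicat_real A (x, u x) * max 0 (w x) \<partial>L)"
        unfolding graph_density_def using range_u
        by (intro Bochner_Integration.integral_cong)
          (auto simp: indicator_def max_def spaceR space_L)
      ultimately show "emeasure ?M A \<le> (SUP B\<in>{B \<in> ?S. B \<subseteq> A}. ennreal (graph_density \<Omega> u w B))"
        unfolding M by (intro SUP_upper2[of "A \<inter> {t \<in> space ?R. 0 \<le> w (fst t)}"]) auto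
    qed
  qed
  also have "\<dots> = ?M" using measure_of_of_measure[of ?M] spaceR by simp
  finally show ?thesis .
qed

lemma signed_integral_graph_density:
  fixes w :: "'a \<Rightarrow> real"
  assumes w: "integrable L w"
    and \<phi>: "continuous_on (\<Omega> \<times> \<Gamma>) \<phi>" "bounded (\<phi> ` (\<Omega> \<times> \<Gamma>))"
  shows "signed_integral (\<Omega> \<times> \<Gamma>) (graph_density \<Omega> u w) \<phi> = (\<integral>x. \<phi> (x, u x) * w x \<partial>L)"
proof -
  have \<phi>m: "\<phi> \<in> borel_measurable (restrict_space borel (\<Omega> \<times> \<Gamma>))"
    using \<phi>(1) by (rule borel_measurable_continuous_on_restrict)
  have gm: "(\<lambda>x. \<phi> (x, u x)) \<in> borel_measurable L"
    by (rule measurable_compose[OF measurable_graph_map \<phi>m])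
  obtain C where C: "\<And>t. t \<in> \<Omega> \<times> \<Gamma> \<Longrightarrow> \<bar>\<phi> t\<bar> \<le> C"
    using \<phi>(2) unfolding bounded_iff by auto
  have "\<bar>\<phi> (x, u x)\<bar> \<le> C" if "x \<in> \<Omega>" for x using range_u that by (intro C) auto
  then have bd: "\<bar>\<phi> (x, u x)\<bar> * \<bar>v\<bar> \<le> \<bar>C\<bar> * \<bar>v\<bar>" if "x \<in> \<Omega>" for x v
    using that by (intro mult_right_mono) fastforce+
  \<comment> \<open>Kept general in \<open>v\<close> because it is applied to \<open>w\<close> and
    to \<open>- w\<close>, whose positive part is the negative part of \<open>w\<close>.\<close>
  have P: "integral\<^sup>L (pos_part_measure (\<Omega> \<times> \<Gamma>) (graph_density \<Omega> u v)) \<phi> =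
      (\<integral>x. max 0 (v x) * \<phi> (x, u x) \<partial>L) \<and> integrable L (\<lambda>x. max 0 (v x) * \<phi> (x, u x))"
    if v: "integrable L v" for v
  proof
    note [measurable] = borel_measurable_integrable[OF v]
    have eq: "(\<lambda>x. ennreal (v x)) = (\<lambda>x. ennreal (max 0 (v x)))"
      by (auto simp: fun_eq_iff max_def ennreal_neg)
    have "integral\<^sup>L (pos_part_measure (\<Omega> \<times> \<Gamma>) (graph_density \<Omega> u v)) \<phi> =
        integral\<^sup>L (density L (\<lambda>x. ennreal (v x))) (\<lambda>x. \<phi> (x, u x))"
      unfolding pos_part_graph_density[OF v]
      using measurable_graph_map by (intro integral_distr \<phi>m) simp
    also have "\<dots> = (\<integral>x. max 0 (v x) * \<phi> (x, u x) \<partial>L)"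
      unfolding eq using gm by (subst integral_real_density) auto
    finally show "integral\<^sup>L (pos_part_measure (\<Omega> \<times> \<Gamma>) (graph_density \<Omega> u v)) \<phi> =
      (\<integral>x. max 0 (v x) * \<phi> (x, u x) \<partial>L)" .
    show "integrable L (\<lambda>x. max 0 (v x) * \<phi> (x, u x))"
    proof (rule Bochner_Integration.integrable_bound[OF integrable_mult_right[OF v, of C]])
      show "(\<lambda>x. max 0 (v x) * \<phi> (x, u x)) \<in> borel_measurable L" using gm by measurable
      show "AE x in L. norm (max 0 (v x) * \<phi> (x, u x)) \<le> norm (C * v x)"
      proof (rule AE_I2)
        fix x assume "x \<in> space L"
        then have "\<bar>\<phi> (x, u x)\<bar> * \<bar>v x\<bar> \<le> \<bar>C\<bar> * \<bar>v x\<bar>" by (intro bd) (simp add: space_L)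
        moreover have "max 0 (v x) * \<bar>\<phi> (x, u x)\<bar> \<le> \<bar>v x\<bar> * \<bar>\<phi> (x, u x)\<bar>"
          by (intro mult_right_mono) auto
        ultimately show "norm (max 0 (v x) * \<phi> (x, u x)) \<le> norm (C * v x)"
          by (simp add: abs_mult mult.commute)
      qed
    qed
  qed
  have neg: "(\<lambda>A. - graph_density \<Omega> u w A) = graph_density \<Omega> u (\<lambda>x. - w x)"
    by (auto simp: fun_eq_iff graph_density_def)
  have "signed_integral (\<Omega> \<times> \<Gamma>) (graph_density \<Omega> u w) \<phi> =
      (\<integral>x. max 0 (w x) * \<phi> (x, u x) \<partial>L) - (\<integral>x. max 0 (- w x) * \<phi> (x, u x) \<partial>L)"
    unfolding signed_integral_def neg using P[OF w] P[of "\<lambda>x. - w x"] w by simp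
  also have "\<dots> = (\<integral>x. max 0 (w x) * \<phi> (x, u x) - max 0 (- w x) * \<phi> (x, u x) \<partial>L)"
    using P[OF w] P[of "\<lambda>x. - w x"] w by simp
  also have "\<dots> = (\<integral>x. \<phi> (x, u x) * w x \<partial>L)"
    by (intro Bochner_Integration.integral_cong) (auto simp: max_def)
  finally show ?thesis .
qed

lemma integrable_inner_bounded:
  fixes w :: "'a \<Rightarrow> 'c::euclidean_space"
  assumes w: "integrable L w"
    and \<phi>: "continuous_on (\<Omega> \<times> \<Gamma>) \<phi>" "bounded (\<phi> ` (\<Omega> \<times> \<Gamma>))"
  shows "integrable L (\<lambda>x. \<phi> (x, u x) \<bullet> w x)"
proof -
  have \<phi>m: "\<phi> \<in> borel_measurable (restrict_space borel (\<Omega> \<times> \<Gamma>))"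
    using \<phi>(1) by (rule borel_measurable_continuous_on_restrict)
  have gm: "(\<lambda>x. \<phi> (x, u x)) \<in> borel_measurable L"
    by (rule measurable_compose[OF measurable_graph_map \<phi>m])
  obtain C where C: "\<And>t. t \<in> \<Omega> \<times> \<Gamma> \<Longrightarrow> norm (\<phi> t) \<le> C"
    using \<phi>(2) unfolding bounded_iff by auto
  show ?thesis
  proof (rule Bochner_Integration.integrable_bound[OF integrable_mult_right[OF integrable_norm[OF w], of C]])
    show "(\<lambda>x. \<phi> (x, u x) \<bullet> w x) \<in> borel_measurable L"
      using gm borel_measurable_integrable[OF w] by measurable
    show "AE x in L. norm (\<phi> (x, u x) \<bullet> w x) \<le> norm (C * norm (w x))"
    proof (rule AE_I2)
      fix x assume "x \<in> space L"
      then have "norm (\<phi> (x, u x)) \<le> C" using range_u by (intro C) (auto simp: space_L)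
      then have "norm (\<phi> (x, u x)) * norm (w x) \<le> C * norm (w x)" by (intro mult_right_mono) auto
      then show "norm (\<phi> (x, u x) \<bullet> w x) \<le> norm (C * norm (w x))"
        using Cauchy_Schwarz_ineq2[of "\<phi> (x, u x)" "w x"] by simp
    qed
  qed
qed

lemma vector_integral_graph_density:
  fixes w :: "'a \<Rightarrow> 'c::euclidean_space"
  assumes w: "integrable L w"
    and \<phi>: "continuous_on (\<Omega> \<times> \<Gamma>) \<phi>" "bounded (\<phi> ` (\<Omega> \<times> \<Gamma>))"
  shows "vector_integral (\<Omega> \<times> \<Gamma>) (graph_density \<Omega> u w) \<phi> = (\<integral>x. \<phi> (x, u x) \<bullet> w x \<partial>L)"
proof -
  have bounded_comp: "bounded ((\<lambda>t. \<phi> t \<bullet> b) ` (\<Omega> \<times> \<Gamma>))" for b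
    using bounded_linear_image[OF \<phi>(2) bounded_linear_inner_left[of b]] by (simp add: image_image)
  have comp: "graph_density \<Omega> u w A \<bullet> b = graph_density \<Omega> u (\<lambda>x. w x \<bullet> b) A"
    if A: "A \<in> sets (restrict_space borel (\<Omega> \<times> \<Gamma>))" for A b
    unfolding graph_density_def
    using integral_inner_left[of b L "\<lambda>x. indicat_real A (x, u x) *\<^sub>R w x"]
      integrable_indicator_graph[OF w A] by simp
  have int: "integrable L (\<lambda>x. (\<phi> (x, u x) \<bullet> b) * (w x \<bullet> b))" if "b \<in> Basis" for b
    using integrable_inner_bounded[OF _ _ bounded_comp, of "\<lambda>x. w x \<bullet> b" b] w \<phi>(1)
    by (simp add: continuous_on_inner)
  have "signed_integral (\<Omega> \<times> \<Gamma>) (\<lambda>A. graph_density \<Omega> u w A \<bullet> b) (\<lambda>t. \<phi> t \<bullet> b) =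
      (\<integral>x. (\<phi> (x, u x) \<bullet> b) * (w x \<bullet> b) \<partial>L)" for b
  proof -
    have "signed_integral (\<Omega> \<times> \<Gamma>) (\<lambda>A. graph_density \<Omega> u w A \<bullet> b) (\<lambda>t. \<phi> t \<bullet> b) =
      signed_integral (\<Omega> \<times> \<Gamma>) (graph_density \<Omega> u (\<lambda>x. w x \<bullet> b)) (\<lambda>t. \<phi> t \<bullet> b)"
      by (rule signed_integral_cong) (auto simp: comp)
    also have "\<dots> = (\<integral>x. (\<phi> (x, u x) \<bullet> b) * (w x \<bullet> b) \<partial>L)"
      using w \<phi>(1) by (intro signed_integral_graph_density bounded_comp) (auto intro!: continuous_intros)
    finally show ?thesis .
  qed
  then have "vector_integral (\<Omega> \<times> \<Gamma>) (graph_density \<Omega> u w) \<phi> =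
      (\<Sum>b\<in>Basis. \<integral>x. (\<phi> (x, u x) \<bullet> b) * (w x \<bullet> b) \<partial>L)"
    unfolding vector_integral_def by simp
  also have "\<dots> = (\<integral>x. \<phi> (x, u x) \<bullet> w x \<partial>L)"
    using int by (subst euclidean_inner, subst Bochner_Integration.integral_sum) auto
  finally show ?thesis .
qed

end

section \<open>Convex duality\<close>

text \<open>Faithful only where the conjugate is finite, since \<open>real_of_ereal\<close> sends
  infinite values to 0. The boundedness hypothesis on the conjugate guarantees finiteness at every
  point used.\<close>

abbreviation rconj :: "('a \<Rightarrow> 'b::real_inner \<Rightarrow> ennreal) \<Rightarrow> 'a \<Rightarrow> 'b \<Rightarrow> real" where
  "rconj f t \<xi> \<equiv> real_of_ereal (conj_fun f t \<xi>)"

text \<open>A negative left side is truncated to 0 by \<open>ennreal\<close>, which is harmless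
  because \<open>f\<close> is nonnegative.\<close>

lemma fenchel_young:
  assumes "\<bar>conj_fun f t \<xi>\<bar> \<noteq> \<infinity>"
  shows "ennreal (\<xi> \<bullet> p - rconj f t \<xi>) \<le> f t p"
proof (cases "f t p")
  case (real r)
  have "ereal (\<xi> \<bullet> p) - enn2ereal (f t p) \<le> conj_fun f t \<xi>"
    unfolding conj_fun_def by (rule SUP_upper) simp
  then have "\<xi> \<bullet> p - r \<le> rconj f t \<xi>"
    using assms real by (cases "conj_fun f t \<xi>") auto
  then show ?thesis using real by (simp add: ennreal_leI)
qed auto

lemma fenchel_young_real:
  assumes "\<bar>conj_fun f t \<xi>\<bar> \<noteq> \<infinity>" "f t p < \<infinity>"
  shows "\<xi> \<bullet> p - enn2real (f t p) \<le> rconj f t \<xi>"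
proof -
  obtain r where r: "f t p = ennreal r" "r \<ge> 0" using assms(2) by (cases "f t p") auto
  have "ereal (\<xi> \<bullet> p) - enn2ereal (f t p) \<le> conj_fun f t \<xi>"
    unfolding conj_fun_def by (rule SUP_upper) simp
  then show ?thesis
    using assms r by (cases "conj_fun f t \<xi>") auto
qed

text \<open>Points with \<open>f t p\<close> infinite contribute minus infinity to the supremum, so
  the real-valued bound at the remaining points suffices.\<close>

lemma rconj_least:
  assumes "\<bar>conj_fun f t \<xi>\<bar> \<noteq> \<infinity>"
    and le: "\<And>p. f t p < \<infinity> \<Longrightarrow> \<xi> \<bullet> p - enn2real (f t p) \<le> M"
  shows "rconj f t \<xi> \<le> M"
proof -
  have "conj_fun f t \<xi> \<le> ereal M"
    unfolding conj_fun_def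
  proof (rule SUP_least)
    fix p
    show "ereal (\<xi> \<bullet> p) - enn2ereal (f t p) \<le> ereal M"
    proof (cases "f t p")
      case (real r)
      then show ?thesis using le[of p] by simp
    next
      case top
      then show ?thesis by simp
    qed
  qed
  then show ?thesis using assms(1) by (cases "conj_fun f t \<xi>") auto
qed

text \<open>Convexity of the conjugate for weights of total at most 1. Reducing the coefficient of
  \<open>f t p\<close> from 1 to the total weight can only enlarge the bound because f \<ge>
  0.\<close>

lemma rconj_weighted_sum:
  assumes fin: "\<And>\<xi>. \<bar>conj_fun f t \<xi>\<bar> \<noteq> \<infinity>"
    and "\<And>i. i \<in> I \<Longrightarrow> 0 \<le> c i" "(\<Sum>i\<in>I. c i) \<le> 1"
  shows "rconj f t (\<Sum>i\<in>I. c i *\<^sub>R \<xi> i) \<le> (\<Sum>i\<in>I. c i * rconj f t (\<xi> i))"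
proof (rule rconj_least[OF fin])
  fix p assume p: "f t p < \<infinity>"
  have "(\<Sum>i\<in>I. c i * (\<xi> i \<bullet> p - enn2real (f t p))) \<le> (\<Sum>i\<in>I. c i * rconj f t (\<xi> i))"
    using assms(2) by (intro sum_mono mult_left_mono fenchel_young_real[OF fin p])
  moreover have "(\<Sum>i\<in>I. c i * (\<xi> i \<bullet> p - enn2real (f t p))) =
      (\<Sum>i\<in>I. c i *\<^sub>R \<xi> i) \<bullet> p - (\<Sum>i\<in>I. c i) * enn2real (f t p)"
    by (simp add: inner_sum_left sum_distrib_right right_diff_distrib sum_subtractf)
  moreover have "(\<Sum>i\<in>I. c i) * enn2real (f t p) \<le> 1 * enn2real (f t p)"
    using assms(3) by (intro mult_right_mono) auto
  ultimately show "(\<Sum>i\<in>I. c i *\<^sub>R \<xi> i) \<bullet> p - enn2real (f t p) \<le> (\<Sum>i\<in>I. c i * rconj f t (\<xi> i))"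
    by linarith
qed

section \<open>The Fenchel-Moreau theorem by separation from the epigraph\<close>

lemma lsc_on_slice:
  assumes "lsc_on (U \<times> UNIV) (\<lambda>(t, p). f t p)" "t \<in> U"
  shows "lsc_on UNIV (f t)"
  unfolding lsc_on_def
proof
  fix p
  have "f t p \<le> Liminf (at (t, p) within U \<times> UNIV) (\<lambda>(t, p). f t p)"
    using assms unfolding lsc_on_def by force
  then have ev: "\<forall>\<^sub>F s in at (t, p) within U \<times> UNIV. y < (case s of (t, p) \<Rightarrow> f t p)" if "y < f t p" for y
    using that unfolding le_Liminf_iff by blast
  have lim: "filterlim (Pair t) (at (t, p) within U \<times> UNIV) (at p)"
    unfolding filterlim_at using assms(2)
    by (auto simp: eventually_at_filter intro!: tendsto_intros)
  show "f t p \<le> Liminf (at p within UNIV) (f t)"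
    unfolding le_Liminf_iff
  proof (intro allI impI)
    fix y assume "y < f t p"
    from eventually_compose_filterlim[OF ev[OF this] lim]
    show "\<forall>\<^sub>F q in at p within UNIV. y < f t q" by simp
  qed
qed

lemma closed_epigraph:
  fixes g :: "'b::euclidean_space \<Rightarrow> ennreal"
  assumes lsc: "lsc_on UNIV g"
  shows "closed {(q, a). 0 \<le> a \<and> g q \<le> ennreal a}"
  unfolding closed_sequential_limits
proof (intro allI impI)
  fix X l assume X: "(\<forall>n. X n \<in> {(q, a). 0 \<le> a \<and> g q \<le> ennreal a}) \<and> X \<longlonglongrightarrow> l"
  obtain q a where l: "l = (q, a)" by (cases l)
  have q: "(\<lambda>n. fst (X n)) \<longlonglongrightarrow> q" and a: "(\<lambda>n. snd (X n)) \<longlonglongrightarrow> a"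
    using X tendsto_fst[of X l] tendsto_snd[of X l] by (auto simp: l)
  have Xn: "0 \<le> snd (X n)" "g (fst (X n)) \<le> ennreal (snd (X n))" for n
    using X by (auto simp: case_prod_beta)
  have "g q \<le> ennreal a"
  proof (rule dense_le)
    fix y assume y: "y < g q"
    \<comment> \<open>\<open>Liminf (at q)\<close> ignores \<open>q\<close> itself, but the
      approximating sequence may hit \<open>q\<close>. Since \<open>y < g q\<close> as well, the
      estimate extends to the full neighbourhood filter.\<close>
    have "g q \<le> Liminf (at q) g" using lsc by (auto simp: lsc_on_def)
    then have "\<forall>\<^sub>F p in at q. y < g p" using y unfolding le_Liminf_iff by blast
    then have "\<forall>\<^sub>F p in nhds q. y < g p"
      using y by (auto simp: eventually_at_filter elim: eventually_mono)
    then have "\<forall>\<^sub>F n in sequentially. y < g (fst (X n))"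
      using q by (rule eventually_compose_filterlim)
    then have "\<forall>\<^sub>F n in sequentially. y \<le> ennreal (snd (X n))"
      by eventually_elim (use Xn(2) in \<open>force intro: less_imp_le order.strict_trans2\<close>)
    moreover have "(\<lambda>n. ennreal (snd (X n))) \<longlonglongrightarrow> ennreal a"
      using a by (rule tendsto_ennrealI)
    ultimately show "y \<le> ennreal a"
      by (intro tendsto_lowerbound[of _ _ sequentially]) auto
  qed
  moreover have "0 \<le> a" using a Xn(1) by (intro LIMSEQ_le_const[of _ a]) auto
  ultimately show "l \<in> {(q, a). 0 \<le> a \<and> g q \<le> ennreal a}" by (simp add: l)
qed

lemma convex_epigraph:
  assumes g: "convex_ennreal g"
  shows "convex {(q, a). 0 \<le> a \<and> g q \<le> ennreal a}"
proof (rule convexI)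
  fix x y :: "'a \<times> real" and s t :: real
  assume x: "x \<in> {(q, a). 0 \<le> a \<and> g q \<le> ennreal a}" and y: "y \<in> {(q, a). 0 \<le> a \<and> g q \<le> ennreal a}"
    and st: "0 \<le> s" "0 \<le> t" "s + t = 1"
  obtain p a q b where xy: "x = (p, a)" "y = (q, b)" by (cases x, cases y)
  have s: "s = 1 - t" using st by simp
  have "t \<in> {0..1}" using st by simp
  then have "g (s *\<^sub>R p + t *\<^sub>R q) \<le> ennreal s * g p + ennreal t * g q"
    unfolding s using g unfolding convex_ennreal_def by blast
  also have "\<dots> \<le> ennreal s * ennreal a + ennreal t * ennreal b"
    using x y by (intro add_mono mult_left_mono) (auto simp: xy)
  also have "\<dots> = ennreal (s * a + t * b)"
    using x y st by (simp add: xy ennreal_mult ennreal_plus)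
  finally show "s *\<^sub>R x + t *\<^sub>R y \<in> {(q, a). 0 \<le> a \<and> g q \<le> ennreal a}"
    using x y st by (simp add: xy)
qed

text \<open>A hyperplane separates (p, c) from the closed convex epigraph. If it is not vertical,
  dividing by its last coefficient gives an affine minorant of \<open>f t\<close> whose value at
  \<open>p\<close> exceeds \<open>c\<close>; its slope is the required \<xi>.\<close>

lemma fenchel_moreau:
  fixes f :: "'t \<Rightarrow> 'b::euclidean_space \<Rightarrow> ennreal"
  assumes convex: "convex_ennreal (f t)" and lsc: "lsc_on UNIV (f t)"
    and fin: "\<And>\<xi>. \<bar>conj_fun f t \<xi>\<bar> \<noteq> \<infinity>" and c: "ennreal c < f t p"
  shows "\<exists>\<xi>. c < \<xi> \<bullet> p - rconj f t \<xi>"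
proof -
  let ?E = "{(q, a). 0 \<le> a \<and> f t q \<le> ennreal a}"
  have "(p, c) \<notin> ?E" using c by auto
  from separating_hyperplane_closed_point[OF convex_epigraph[OF convex] closed_epigraph[OF lsc] this]
  obtain v b where v: "v \<bullet> (p, c) < b" "\<forall>x\<in>?E. b < v \<bullet> x" by blast
  obtain \<alpha> \<gamma> where "v = (\<alpha>, \<gamma>)" by (cases v)
  with v have sep: "\<alpha> \<bullet> p + \<gamma> * c < b"
    and epi: "\<And>q a. 0 \<le> a \<Longrightarrow> f t q \<le> ennreal a \<Longrightarrow> b < \<alpha> \<bullet> q + \<gamma> * a"
    by auto
  have epi': "b < \<alpha> \<bullet> q + \<gamma> * enn2real (f t q)" if "f t q < \<infinity>" for q
    using that by (intro epi) auto
  obtain q0 where q0: "f t q0 < \<infinity>"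
  proof -
    have "\<exists>q. f t q < \<infinity>"
    proof (rule ccontr)
      assume "\<nexists>q. f t q < \<infinity>"
      then have "f t q = \<infinity>" for q by (metis infinity_ennreal_def top.not_eq_extremum)
      then have "conj_fun f t 0 = - \<infinity>" by (simp add: conj_fun_def)
      then show False using fin[of 0] by simp
    qed
    then show ?thesis using that by blast
  qed
  have "\<gamma> \<ge> 0"
  proof (rule ccontr)
    assume "\<not> \<gamma> \<ge> 0"
    then have \<gamma>: "\<gamma> < 0" by simp
    define a where "a = enn2real (f t q0)"
    \<comment> \<open>The epigraph is unbounded upwards. With a negative last coefficient, raising
      the point over \<open>q0\<close> by exactly \<open>s\<close> would bring it onto the
      separating hyperplane.\<close>
    define s where "s = (\<alpha> \<bullet> q0 + \<gamma> * a - b) / (- \<gamma>)"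
    have "s \<ge> 0" unfolding s_def using epi'[OF q0] \<gamma> by (intro divide_nonneg_pos) (auto simp: a_def)
    have "f t q0 \<le> ennreal (a + s)"
      using q0 \<open>s \<ge> 0\<close> by (cases "f t q0") (auto simp: a_def intro: ennreal_leI)
    then have "b < \<alpha> \<bullet> q0 + \<gamma> * (a + s)" using \<open>s \<ge> 0\<close> by (intro epi) (auto simp: a_def)
    also have "\<alpha> \<bullet> q0 + \<gamma> * (a + s) = b" using \<gamma> by (simp add: s_def field_simps)
    finally show False by simp
  qed
  then consider "\<gamma> > 0" | "\<gamma> = 0" by linarith
  then show ?thesis
  proof cases
    case 1
    let ?\<xi> = "(- 1 / \<gamma>) *\<^sub>R \<alpha>"
    have "rconj f t ?\<xi> \<le> - b / \<gamma>"
    proof (rule rconj_least[OF fin])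
      fix q assume "f t q < \<infinity>"
      from divide_strict_right_mono[OF epi'[OF this] 1]
      have "b / \<gamma> < (\<alpha> \<bullet> q) / \<gamma> + enn2real (f t q)" using 1 by (simp add: add_divide_distrib)
      then show "?\<xi> \<bullet> q - enn2real (f t q) \<le> - b / \<gamma>" by simp
    qed
    moreover have "c < ?\<xi> \<bullet> p + b / \<gamma>" using sep 1 by (simp add: field_simps)
    ultimately show ?thesis by (intro exI[of _ ?\<xi>]) auto
  next
    case 2
    \<comment> \<open>The separating hyperplane is vertical; steeper and steeper functionals still work because the
        conjugate is finite.\<close>
    define d where "d = b - \<alpha> \<bullet> p"
    have d: "d > 0" using sep 2 by (simp add: d_def)
    \<comment> \<open>At \<open>p\<close> the functional gains \<open>l * d\<close>, while using the
      minorant of slope 0 costs \<open>rconj f t 0\<close>. The factor is chosen so that the gain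
      exceeds that cost together with \<open>c\<close>.\<close>
    define l where "l = (\<bar>c\<bar> + \<bar>rconj f t 0\<bar> + 1) / d"
    have "\<bar>c\<bar> + \<bar>rconj f t 0\<bar> + 1 > 0" by linarith
    then have l: "l > 0" unfolding l_def using d by (rule divide_pos_pos)
    let ?\<xi> = "(- l) *\<^sub>R \<alpha>"
    have "rconj f t ?\<xi> \<le> - l * b + rconj f t 0"
    proof (rule rconj_least[OF fin])
      fix q assume q: "f t q < \<infinity>"
      have "l * b \<le> l * (\<alpha> \<bullet> q)" using epi'[OF q] 2 l by (intro mult_left_mono) auto
      moreover have "- enn2real (f t q) \<le> rconj f t 0"
        using fenchel_young_real[OF fin q, of 0] by simp
      ultimately show "?\<xi> \<bullet> q - enn2real (f t q) \<le> - l * b + rconj f t 0" by simp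
    qed
    moreover have "l * d = \<bar>c\<bar> + \<bar>rconj f t 0\<bar> + 1" using d by (simp add: l_def)
    then have "l * b - l * (\<alpha> \<bullet> p) = \<bar>c\<bar> + \<bar>rconj f t 0\<bar> + 1"
      by (simp add: d_def right_diff_distrib)
    moreover have "?\<xi> \<bullet> p = - (l * (\<alpha> \<bullet> p))" by simp
    ultimately have "c < ?\<xi> \<bullet> p - rconj f t ?\<xi>" by linarith
    then show ?thesis by blast
  qed
qed

section \<open>Approximation of the energy from below\<close>

lemma SUP_ennreal_Max:
  fixes h :: "nat \<Rightarrow> real"
  shows "ennreal (Max (h ` {..n})) \<le> (SUP m. ennreal (h m))"
proof -
  have "Max (h ` {..n}) \<in> h ` {..n}" by (intro Max_in) auto
  then obtain m where "Max (h ` {..n}) = h m" by blast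
  then show ?thesis using SUP_upper[of m UNIV "\<lambda>m. ennreal (h m)"] by simp
qed

lemma continuous_on_Max_atMost:
  fixes h :: "nat \<Rightarrow> 'a::topological_space \<Rightarrow> real"
  assumes "\<And>m. continuous_on S (h m)"
  shows "continuous_on S (\<lambda>x. Max ((\<lambda>m. h m x) ` {..n}))"
proof (induction n)
  case 0
  show ?case using assms by simp
next
  case (Suc n)
  have "Max ((\<lambda>m. h m x) ` {..Suc n}) = max (h (Suc n) x) (Max ((\<lambda>m. h m x) ` {..n}))" for x
    by (simp add: atMost_Suc)
  then show ?case
    by (simp only: continuous_on_max[OF assms Suc])
qed

text \<open>Finite maxima on a compact exhaustion already give an integral above \<open>c\<close>.
  At each point some index attains the maximum, and by continuity it stays nearly optimal close by.
  A C2 partition of unity glues finitely many such choices at a small loss.\<close>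

lemma (in graph) approximation_by_C2_weights:
  fixes h :: "nat \<Rightarrow> 'a \<Rightarrow> real"
  assumes h: "\<And>m. continuous_on \<Omega> (h m)" and h0: "\<And>x. x \<in> \<Omega> \<Longrightarrow> 0 \<le> h 0 x"
    and c: "ennreal c < (\<integral>\<^sup>+x. (SUP m. ennreal (h m x)) \<partial>L)"
  obtains F :: "'a set" and m :: "'a \<Rightarrow> nat" and \<beta> :: "'a \<Rightarrow> 'a \<Rightarrow> real" and K
  where "finite F" "\<And>i. C2_on UNIV (\<beta> i)" "\<And>i y. 0 \<le> \<beta> i y" "\<And>y. (\<Sum>i\<in>F. \<beta> i y) \<le> 1"
    "compact K" "K \<subseteq> \<Omega>" "\<And>i y. i \<in> F \<Longrightarrow> y \<notin> K \<Longrightarrow> \<beta> i y = 0"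
    "c < (\<integral>x. (\<Sum>i\<in>F. \<beta> i x * h (m i) x) \<partial>L)"
proof -
  interpret L: finite_measure L by (rule finite_measure_L)
  define g where "g = (\<lambda>n x. Max ((\<lambda>m. h m x) ` {..n}))"
  have g_ge: "h k x \<le> g n x" if "k \<le> n" for k n x
    unfolding g_def using that by (intro Max_ge) auto
  have g_in: "\<exists>k. h k x = g n x" for n x
  proof -
    have "g n x \<in> (\<lambda>m. h m x) ` {..n}" unfolding g_def by (intro Max_in) auto
    then show ?thesis by auto
  qed
  have g0: "0 \<le> g n x" if "x \<in> \<Omega>" for n x
    using h0[OF that] g_ge[of 0 n x] by simp
  have g_mono: "g n x \<le> g n' x" if "n \<le> n'" for n n' x
    unfolding g_def using that by (intro Max_mono) auto
  have g_cont: "continuous_on \<Omega> (g n)" for n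
    unfolding g_def using h by (rule continuous_on_Max_atMost)
  obtain C where C: "\<And>n. compact (C n)" "\<And>n. C n \<subseteq> \<Omega>" "\<And>n. C n \<subseteq> interior (C (Suc n))"
    "\<Union>(range C) = \<Omega>"
    using open_Union_compact_subsets[OF open_domain] by metis
  have "C n \<subseteq> C (Suc n)" for n using C(3)[of n] interior_subset by (rule order_trans)
  then have C_mono: "C n \<subseteq> C n'" if "n \<le> n'" for n n'
    using that by (rule lift_Suc_mono_le)
  \<comment> \<open>Cutting down to a compact set makes the maximum integrable. The sequence is
    increasing on \<Omega> because the maxima are nonnegative there, which is the purpose of
    \<open>h0\<close>.\<close>
  define G where "G = (\<lambda>n x. indicat_real (C n) x * g n x)"
  have indC: "(\<lambda>x. indicat_real (C n) x) \<in> borel_measurable L" for n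
    using C(1)[of n] by (intro measurable_restrict_space1) (auto simp: compact_imp_closed)
  have mG: "G n \<in> borel_measurable L" for n
    unfolding G_def using indC measurable_L_continuous[OF g_cont] by (intro borel_measurable_times)
  have G0: "0 \<le> G n x" if "x \<in> \<Omega>" for n x using g0[OF that] by (simp add: G_def)
  have intG: "integrable L (G n)" for n
  proof -
    have "bounded (g n ` C n)"
      by (intro compact_imp_bounded compact_continuous_image C(1) continuous_on_subset[OF g_cont C(2)])
    then obtain M where M: "M > 0" "\<And>x. x \<in> C n \<Longrightarrow> \<bar>g n x\<bar> \<le> M"
      unfolding bounded_pos by auto
    have "norm (G n x) \<le> M" for x
      using M by (cases "x \<in> C n") (auto simp: G_def)
    then show ?thesis by (intro L.integrable_const_bound[where B = M] mG) simp
  qed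
  have "(\<integral>\<^sup>+x. (SUP m. ennreal (h m x)) \<partial>L) = (\<integral>\<^sup>+x. (SUP n. ennreal (G n x)) \<partial>L)"
  proof (rule nn_integral_cong, rule antisym)
    fix x assume "x \<in> space L"
    then have x: "x \<in> \<Omega>" by (simp add: space_L)
    then obtain k where k: "x \<in> C k" using C(4) by blast
    show "(SUP m. ennreal (h m x)) \<le> (SUP n. ennreal (G n x))"
    proof (rule SUP_least)
      fix m
      have "x \<in> C (max m k)" using k C_mono[of k "max m k"] by auto
      then have "h m x \<le> G (max m k) x" using g_ge[of m "max m k" x] by (simp add: G_def)
      then show "ennreal (h m x) \<le> (SUP n. ennreal (G n x))"
        by (intro SUP_upper2[of "max m k"]) (auto intro: ennreal_leI)
    qed
    show "(SUP n. ennreal (G n x)) \<le> (SUP m. ennreal (h m x))"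
    proof (rule SUP_least)
      fix n
      have "G n x \<le> g n x" using g0[OF x, of n] by (simp add: G_def indicator_def)
      then have "ennreal (G n x) \<le> ennreal (g n x)" by (rule ennreal_leI)
      also have "\<dots> \<le> (SUP m. ennreal (h m x))" unfolding g_def by (rule SUP_ennreal_Max)
      finally show "ennreal (G n x) \<le> (SUP m. ennreal (h m x))" .
    qed
  qed
  \<comment> \<open>Monotone convergence is applied to a sequence increasing at every point of the
    type, while the maxima are nonnegative only on \<Omega>; the indicator removes the other points
    without changing the integral.\<close>
  also have "\<dots> = (\<integral>\<^sup>+x. (SUP n. ennreal (indicator \<Omega> x * G n x)) \<partial>L)"
    by (rule nn_integral_cong) (simp add: space_L)
  also have "\<dots> = (SUP n. \<integral>\<^sup>+x. ennreal (indicator \<Omega> x * G n x) \<partial>L)"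
  proof (rule nn_integral_monotone_convergence_SUP)
    show "incseq (\<lambda>n x. ennreal (indicator \<Omega> x * G n x))"
    proof (intro incseq_SucI le_funI ennreal_leI)
      fix n x
      show "indicator \<Omega> x * G n x \<le> indicator \<Omega> x * G (Suc n) x"
      proof (cases "x \<in> \<Omega>")
        case True
        then show ?thesis
          using C_mono[of n "Suc n"] g_mono[of n "Suc n" x] g0[OF True, of "Suc n"]
          by (auto simp: G_def indicator_def)
      qed simp
    qed
    show "(\<lambda>x. ennreal (indicator \<Omega> x * G n x)) \<in> borel_measurable L" for n
    proof (rule measurable_cong[THEN iffD2])
      show "(\<lambda>x. ennreal (G n x)) \<in> borel_measurable L" using mG by measurable
    qed (simp add: space_L)
  qed
  also have "\<dots> = (SUP n. \<integral>\<^sup>+x. ennreal (G n x) \<partial>L)"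
    by (intro SUP_cong nn_integral_cong) (auto simp: space_L)
  finally obtain n where n: "ennreal c < (\<integral>\<^sup>+x. ennreal (G n x) \<partial>L)"
    using c by (auto simp: less_SUP_iff)
  define I where "I = (\<integral>x. G n x \<partial>L)"
  have "(\<integral>\<^sup>+x. ennreal (G n x) \<partial>L) = ennreal I"
    unfolding I_def using intG G0 by (intro nn_integral_eq_integral AE_I2) (auto simp: space_L)
  then have cI: "c < I" using n by (metis ennreal_leI linorder_not_le)
  \<comment> \<open>Losing \<epsilon> at every point of \<Omega> must cost less than
    \<open>I - c\<close> in the integral; the summand 1 also protects against a null domain.\<close>
  define \<epsilon> where "\<epsilon> = (I - c) / (measure L (space L) + 1)"
  have mpos: "measure L (space L) + 1 > 0" by (simp add: add_nonneg_pos)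
  have \<epsilon>: "\<epsilon> > 0" unfolding \<epsilon>_def using cI mpos by (intro divide_pos_pos) auto
  have \<epsilon>I: "\<epsilon> * measure L (space L) < I - c"
  proof -
    have "\<epsilon> * (measure L (space L) + 1) = I - c" using mpos by (simp add: \<epsilon>_def)
    then show ?thesis using \<epsilon> by (simp add: algebra_simps)
  qed
  have "\<forall>x. \<exists>k. h k x = g n x" using g_in by blast
  from choice[OF this] obtain m where m: "\<And>x. h (m x) x = g n x" by blast
  \<comment> \<open>Where the index chosen at \<open>x\<close> falls short of the maximum by less
    than \<epsilon>; a neighbourhood of \<open>x\<close>, since there is no shortfall at
    \<open>x\<close>.\<close>
  define V where "V = (\<lambda>x. \<Omega> \<inter> (\<lambda>y. h (m x) y - g n y) -` {-\<epsilon><..})"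
  have V: "open (V x)" for x
    unfolding V_def by (intro continuous_open_preimage open_domain continuous_on_diff h g_cont) simp
  have xV: "x \<in> V x" if "x \<in> C n" for x
    using that C(2) \<epsilon> by (auto simp: V_def m)
  obtain F and \<beta> :: "'a \<Rightarrow> 'a \<Rightarrow> real" where F: "finite F" "F \<subseteq> C n" "\<And>x. C2_on UNIV (\<beta> x)"
    "\<And>x y. 0 \<le> \<beta> x y" "\<And>y. (\<Sum>x\<in>F. \<beta> x y) \<le> 1" "\<And>y. y \<in> C n \<Longrightarrow> (\<Sum>x\<in>F. \<beta> x y) = 1"
    "\<And>x. x \<in> F \<Longrightarrow> \<exists>D. compact D \<and> D \<subseteq> V x \<and> (\<forall>y. y \<notin> D \<longrightarrow> \<beta> x y = 0)"
    using C2_partition_of_unity[OF C(1)[of n] V xV] by metis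
  obtain D where D: "\<And>x. x \<in> F \<Longrightarrow> compact (D x)" "\<And>x. x \<in> F \<Longrightarrow> D x \<subseteq> V x"
    "\<And>x y. x \<in> F \<Longrightarrow> y \<notin> D x \<Longrightarrow> \<beta> x y = 0"
    using F(7) by metis
  define K where "K = (\<Union>x\<in>F. D x)"
  have K: "compact K" "K \<subseteq> \<Omega>"
    using F(1) D(1,2) by (auto simp: K_def V_def intro!: compact_UN)
  have K0: "\<beta> i y = 0" if "i \<in> F" "y \<notin> K" for i y
    using that D(3) by (auto simp: K_def)
  let ?S = "\<lambda>x. \<Sum>i\<in>F. \<beta> i x * h (m i) x"
  have lower: "G n y - \<epsilon> \<le> ?S y" if y: "y \<in> \<Omega>" for y
  proof -
    have "(\<Sum>i\<in>F. \<beta> i y) * (g n y - \<epsilon>) = (\<Sum>i\<in>F. \<beta> i y * (g n y - \<epsilon>))"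
      by (rule sum_distrib_right)
    also have "\<dots> \<le> ?S y"
    proof (rule sum_mono)
      fix i assume i: "i \<in> F"
      show "\<beta> i y * (g n y - \<epsilon>) \<le> \<beta> i y * h (m i) y"
      proof (cases "y \<in> D i")
        case True
        then have "y \<in> V i" using D(2) i by blast
        then show ?thesis using F(4) by (intro mult_left_mono) (auto simp: V_def)
      qed (simp add: D(3)[OF i])
    qed
    finally have 1: "(\<Sum>i\<in>F. \<beta> i y) * (g n y - \<epsilon>) \<le> ?S y" .
    show ?thesis
    proof (cases "y \<in> C n")
      case True
      then show ?thesis using 1 F(6)[OF True] by (simp add: G_def)
    next
      \<comment> \<open>Off \<open>C n\<close> the weights may sum to less than 1, but there only a
        lower bound by - \<epsilon> is needed: the maximum is nonnegative and the total weight is at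
        most 1.\<close>
      case False
      have s: "0 \<le> (\<Sum>i\<in>F. \<beta> i y)" using F(4) by (intro sum_nonneg) auto
      have "(\<Sum>i\<in>F. \<beta> i y) * \<epsilon> \<le> 1 * \<epsilon>" using F(5) \<epsilon> by (intro mult_right_mono) auto
      moreover have "0 \<le> (\<Sum>i\<in>F. \<beta> i y) * g n y" using s g0[OF y] by simp
      ultimately have "- \<epsilon> \<le> (\<Sum>i\<in>F. \<beta> i y) * (g n y - \<epsilon>)" by (simp add: right_diff_distrib)
      then show ?thesis using 1 False by (simp add: G_def)
    qed
  qed
  have intS: "integrable L ?S"
  proof (rule integrable_continuous_compact_support[OF _ K])
    have "continuous_on \<Omega> (\<beta> i)" for i
      using C1_on_imp_continuous_on[OF C2_on_imp_C1_on[OF F(3)]] continuous_on_subset by blast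
    then show "continuous_on \<Omega> ?S" by (intro continuous_intros h)
    show "?S x = 0" if "x \<in> \<Omega> - K" for x using that K0 by simp
  qed
  have "I - \<epsilon> * measure L (space L) = (\<integral>x. G n x - \<epsilon> \<partial>L)"
    using intG[of n] by (simp add: I_def mult.commute)
  also have "\<dots> \<le> (\<integral>x. ?S x \<partial>L)"
    using intG[of n] intS lower by (intro integral_mono) (auto simp: space_L)
  finally have "c < (\<integral>x. ?S x \<partial>L)" using \<epsilon>I by linarith
  from that[OF F(1,3,4,5) K K0 this] show ?thesis .
qed

section \<open>The canonical admissible pair\<close>

lemma cont_cpt_support_imp_C0_on: "cont_cpt_support U \<phi> \<Longrightarrow> C0_on U \<phi>"
  unfolding C0_on_def by (metis diff_self less_imp_le norm_zero)

lemma cont_cpt_support_bounded: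
  assumes "cont_cpt_support U \<phi>"
  shows "bounded (\<phi> ` U)"
proof -
  obtain K where K: "compact K" "K \<subseteq> U" "\<And>t. t \<in> U - K \<Longrightarrow> \<phi> t = 0" and c: "continuous_on U \<phi>"
    using assms unfolding cont_cpt_support_def by blast
  have "bounded (\<phi> ` K)"
    by (intro compact_imp_bounded compact_continuous_image K continuous_on_subset[OF c])
  then have "bounded (insert 0 (\<phi> ` K))" by simp
  then show ?thesis by (rule bounded_subset) (use K(3) in blast)
qed

lemma C0_on_bounded:
  assumes "C0_on U \<phi>"
  shows "bounded (\<phi> ` U)"
proof -
  obtain \<psi> where \<psi>: "cont_cpt_support U \<psi>" "\<And>t. t \<in> U \<Longrightarrow> norm (\<phi> t - \<psi> t) \<le> 1"
    using assms unfolding C0_on_def using zero_less_one by blast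
  obtain B where B: "\<And>t. t \<in> U \<Longrightarrow> norm (\<psi> t) \<le> B"
    using cont_cpt_support_bounded[OF \<psi>(1)] unfolding bounded_iff by auto
  have "norm (\<phi> t) \<le> B + 1" if "t \<in> U" for t
    using \<psi>(2)[OF that] B[OF that] norm_triangle_sub[of "\<phi> t" "\<psi> t"] by linarith
  then show ?thesis unfolding bounded_iff by auto
qed

lemma linear_sum_axis:
  fixes T :: "real^'n \<Rightarrow> 'b::real_vector"
  assumes "linear T"
  shows "T v = (\<Sum>k\<in>UNIV. v $ k *\<^sub>R T (axis k 1))"
proof -
  have "v = (\<Sum>k\<in>UNIV. v $ k *\<^sub>R axis k 1)"
    using basis_expansion[of v] by (simp add: scalar_mult_eq_scaleR)
  then have "T v = T (\<Sum>k\<in>UNIV. v $ k *\<^sub>R axis k 1)" by simp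
  also have "\<dots> = (\<Sum>k\<in>UNIV. v $ k *\<^sub>R T (axis k 1))"
    using assms by (simp add: linear_sum linear_cmul)
  finally show ?thesis .
qed

lemma (in graph) derivatives_eq_0_off_compact:
  fixes g :: "'a \<times> 'c::real_normed_vector \<Rightarrow> 'e::real_normed_vector"
  assumes g: "twice_derivative_on (\<Omega> \<times> UNIV) g g' g''" and "compact K"
    and zero: "\<And>x z. x \<in> \<Omega> - K \<Longrightarrow> g (x, z) = 0" and x: "x \<in> \<Omega> - K"
  shows "g' (x, z) w = 0" "g'' (x, z) v w = 0"
proof -
  have o: "open ((\<Omega> - K) \<times> (UNIV :: 'c set))"
    using open_domain assms(2) by (intro open_Times open_Diff compact_imp_closed) auto
  have s: "(\<Omega> - K) \<times> (UNIV :: 'c set) \<subseteq> \<Omega> \<times> UNIV" by auto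
  have y: "(x, z) \<in> (\<Omega> - K) \<times> UNIV" using x by auto
  have z: "g y = 0" if "y \<in> (\<Omega> - K) \<times> UNIV" for y using zero that by (cases y) auto
  show "g' (x, z) w = 0" "g'' (x, z) v w = 0"
    using twice_derivative_on_eq_0[OF g o s z y] by auto
qed

locale C2_graph = graph \<Omega> \<Gamma> u
  for \<Omega> :: "(real^'d::finite) set" and \<Gamma> :: "(real^'s::finite) set" and u +
  fixes u' :: "real^'d \<Rightarrow> real^'d \<Rightarrow> real^'s" and u'' :: "real^'d \<Rightarrow> real^'d \<Rightarrow> real^'d \<Rightarrow> real^'s"
  assumes u: "twice_derivative_on \<Omega> u u' u''" and compact_range: "compact \<Gamma>"
begin

definition Du :: "'d \<Rightarrow> real^'d \<Rightarrow> real^'s" where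
  "Du i x = u' x (axis i 1)"

definition DDu :: "'d \<Rightarrow> 'd \<Rightarrow> real^'d \<Rightarrow> real^'s" where
  "DDu i j x = u'' x (axis i 1) (axis j 1)"

text \<open>The tensor \<open>\<nabla>u \<otimes> \<nabla>u\<close> lacks the symmetry required of \<open>H\<close>; its symmetrization pairs in the
  same way with z-Hessians.\<close>

definition H_density :: "real^'d \<Rightarrow> real^'s^'d^'s^'d" where
  "H_density x = (\<chi> i k j l. (Du i x $ k * Du j x $ l + Du i x $ l * Du j x $ k) / 2)"

lemma part_deriv_u:
  assumes "x \<in> \<Omega>"
  shows "part_deriv i (\<lambda>y. u y $ k) x = Du i x $ k"
    and "hessian u x $ i $ j $ k = DDu i j x $ k"
proof -
  have t: "twice_derivative_on \<Omega> (\<lambda>y. u y $ k) (\<lambda>y w. u' y w $ k) (\<lambda>y v w. u'' y v w $ k)"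
    by (rule twice_derivative_on_bounded_linear[OF bounded_linear_vec_nth u])
  show "part_deriv i (\<lambda>y. u y $ k) x = Du i x $ k"
    using dir_deriv_eq[OF twice_derivative_onD(1)[OF t assms]] by (simp add: Du_def)
  show "hessian u x $ i $ j $ k = DDu i j x $ k"
    using dir_deriv_dir_deriv_eq[OF t open_domain assms] by (simp add: hessian_def DDu_def)
qed

lemma continuous_Du: "continuous_on \<Omega> (Du i)"
  unfolding Du_def by (rule twice_derivative_on_continuous[OF u])

lemma continuous_DDu: "continuous_on \<Omega> (DDu i j)"
  unfolding DDu_def by (rule twice_derivative_onD(3)[OF u])

lemma continuous_hessian: "continuous_on \<Omega> (hessian u)"
proof (rule continuous_on_eq[where f = "\<lambda>x. \<chi> i j. DDu i j x"])
  show "continuous_on \<Omega> (\<lambda>x. \<chi> i j. DDu i j x)" by (intro continuous_on_vec_lambda continuous_DDu)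
  show "(\<chi> i j. DDu i j x) = hessian u x" if "x \<in> \<Omega>" for x
    using part_deriv_u(2)[OF that] by (simp add: vec_eq_iff)
qed

lemma continuous_H_density: "continuous_on \<Omega> H_density"
  unfolding H_density_def by (intro continuous_on_vec_lambda continuous_intros continuous_Du) simp

text \<open>\<open>D\<close> is the i-th derivative of the sum over k of (d_j u_k)(x) (d_{z_k} g)(x,
  u(x)) minus the j-th derivative of (d_{x_i} g)(x, u(x)). Both functions have compact support, so
  both integrals vanish. In the difference the mixed x-z terms cancel by symmetry of
  \<open>g''\<close>, leaving exactly the terms of the constraint; no third derivative of
  \<open>u\<close> or \<open>g\<close> arises.\<close>

lemma integral_chain_rule_identity:
  fixes g :: "(real^'d) \<times> (real^'s) \<Rightarrow> real"
    and i j :: 'd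
  assumes g: "twice_derivative_on (\<Omega> \<times> UNIV) g g' g''"
    and K: "compact K" "K \<subseteq> \<Omega>" "\<And>x z. x \<in> \<Omega> - K \<Longrightarrow> g (x, z) = 0"
  defines "D \<equiv> \<lambda>x. (\<Sum>k\<in>UNIV. DDu i j x $ k * g' (x, u x) (0, axis k 1))
      + (\<Sum>k\<in>UNIV. \<Sum>l\<in>UNIV. Du j x $ k * Du i x $ l * g'' (x, u x) (0, axis l 1) (0, axis k 1))
      - g'' (x, u x) (axis i 1, 0) (axis j 1, 0)"
  shows "integrable L D" "(\<integral>x. D x \<partial>L) = 0"
proof -
  let ?A = "\<lambda>i. (axis i 1, 0) :: (real^'d) \<times> (real^'s)"
  let ?Z = "\<lambda>k. (0, axis k 1) :: (real^'d) \<times> (real^'s)"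
  have oU: "open (\<Omega> \<times> (UNIV :: (real^'s) set))" using open_domain by (intro open_Times) auto
  have g0: "g' (x, z) w = 0" "g'' (x, z) v w = 0" if "x \<in> \<Omega> - K" for x z v w
    using derivatives_eq_0_off_compact[OF g K(1) _ that] K(3) by auto
  have cG: "continuous_on \<Omega> (\<lambda>x. (x, u x))" using continuous_u by (intro continuous_intros)
  have G: "(\<lambda>x. (x, u x)) ` \<Omega> \<subseteq> \<Omega> \<times> UNIV" by auto
  have c1: "continuous_on \<Omega> (\<lambda>x. g' (x, u x) w)" for w
    by (rule continuous_on_compose2[OF twice_derivative_on_continuous(2)[OF g] cG G])
  have c2: "continuous_on \<Omega> (\<lambda>x. g'' (x, u x) v w)" for v w
    by (rule continuous_on_compose2[OF twice_derivative_onD(3)[OF g] cG G])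
  have sym: "g'' (x, u x) v w = g'' (x, u x) w v" if "x \<in> \<Omega>" for x v w
    using second_derivative_symmetric[OF g oU, of "(x, u x)"] that by auto
  have lin: "linear (\<lambda>v. g'' (x, u x) v w)" if "x \<in> \<Omega>" for x w
    by (rule has_derivative_linear[OF twice_derivative_onD(2)[OF g]]) (use that in auto)
  define W where "W = (\<lambda>x. \<Sum>k\<in>UNIV. Du j x $ k * g' (x, u x) (?Z k))"
  define W' where "W' = (\<lambda>x v. \<Sum>k\<in>UNIV. Du j x $ k * g'' (x, u x) (v, u' x v) (?Z k) +
      u'' x v (axis j 1) $ k * g' (x, u x) (?Z k))"
  define V where "V = (\<lambda>x. g' (x, u x) (?A i))"
  define V' where "V' = (\<lambda>x v. g'' (x, u x) (v, u' x v) (?A i))"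
  have dG: "((\<lambda>x. g' (x, u x) w) has_derivative (\<lambda>v. g'' (x, u x) (v, u' x v) w)) (at x)"
    if "x \<in> \<Omega>" for x w
  proof -
    have "((\<lambda>x. (x, u x)) has_derivative (\<lambda>v. (v, u' x v))) (at x)"
      using twice_derivative_onD(1)[OF u that] by (intro has_derivative_Pair has_derivative_ident)
    moreover have "((\<lambda>y. g' y w) has_derivative (\<lambda>v. g'' (x, u x) v w)) (at (x, u x))"
      using that by (intro twice_derivative_onD(2)[OF g]) auto
    ultimately show ?thesis by (rule has_derivative_compose)
  qed
  have dDu: "((\<lambda>x. Du j x $ k) has_derivative (\<lambda>v. u'' x v (axis j 1) $ k)) (at x)"
    if "x \<in> \<Omega>" for x k
    using twice_derivative_onD(2)[OF u that, of "axis j 1"]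
    by (auto simp: Du_def intro: bounded_linear.has_derivative[OF bounded_linear_vec_nth])
  have dW: "(W has_derivative W' x) (at x)" if "x \<in> \<Omega>" for x
    unfolding W_def W'_def using that
    by (intro has_derivative_sum has_derivative_mult dG dDu)
  have dV: "(V has_derivative V' x) (at x)" if "x \<in> \<Omega>" for x
    unfolding V_def V'_def using dG[OF that] .
  have expand: "g'' (x, u x) (axis m 1, u' x (axis m 1)) w =
      g'' (x, u x) (?A m) w + (\<Sum>k\<in>UNIV. Du m x $ k * g'' (x, u x) (?Z k) w)"
    if "x \<in> \<Omega>" for x m w
  proof -
    have l: "linear (\<lambda>z. g'' (x, u x) (0, z) w)"
      using linear_compose[OF _ lin[OF that], of "\<lambda>z. (0, z)" w]
      by (auto simp: o_def linear_iff)
    have "g'' (x, u x) (axis m 1, u' x (axis m 1)) w =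
        g'' (x, u x) ((axis m 1, 0) + (0, u' x (axis m 1))) w" by simp
    also have "\<dots> = g'' (x, u x) (?A m) w + g'' (x, u x) (0, u' x (axis m 1)) w"
      by (rule linear_add[OF lin[OF that]])
    finally show ?thesis
      using linear_sum_axis[OF l, of "u' x (axis m 1)"] by (simp add: Du_def)
  qed
  have W'i: "W' x (axis i 1) = (\<Sum>k\<in>UNIV. Du j x $ k * (g'' (x, u x) (?A i) (?Z k)
      + (\<Sum>l\<in>UNIV. Du i x $ l * g'' (x, u x) (?Z l) (?Z k))) + DDu i j x $ k * g' (x, u x) (?Z k))"
    if "x \<in> \<Omega>" for x
    unfolding W'_def expand[OF that] DDu_def ..
  have V'j: "V' x (axis j 1) = g'' (x, u x) (?A j) (?A i) + (\<Sum>k\<in>UNIV. Du j x $ k * g'' (x, u x) (?Z k) (?A i))"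
    if "x \<in> \<Omega>" for x
    unfolding V'_def expand[OF that] ..
  have cW: "continuous_on \<Omega> (\<lambda>x. W' x (axis i 1))"
    by (rule continuous_on_eq[OF _ W'i[symmetric]])
      (intro continuous_intros c1 c2 continuous_Du continuous_DDu)
  have cV: "continuous_on \<Omega> (\<lambda>x. V' x (axis j 1))"
    by (rule continuous_on_eq[OF _ V'j[symmetric]])
      (intro continuous_intros c1 c2 continuous_Du continuous_DDu)
  have W0: "(\<integral>x. W' x (axis i 1) \<partial>L) = 0"
    using K g0 by (intro integral_directional_derivative_eq_0[OF open_domain K(1,2) _ dW cW]) (auto simp: W_def)
  have V0: "(\<integral>x. V' x (axis j 1) \<partial>L) = 0"
    using K g0 by (intro integral_directional_derivative_eq_0[OF open_domain K(1,2) _ dV cV]) (auto simp: V_def)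
  have iW: "integrable L (\<lambda>x. W' x (axis i 1))"
    by (rule integrable_continuous_compact_support[OF cW K(1,2)]) (auto simp: W'_def g0)
  have iV: "integrable L (\<lambda>x. V' x (axis j 1))"
    by (rule integrable_continuous_compact_support[OF cV K(1,2)]) (auto simp: V'_def g0)
  have D: "D x = W' x (axis i 1) - V' x (axis j 1)" if "x \<in> space L" for x
  proof -
    have x: "x \<in> \<Omega>" using that by (simp add: space_L)
    show ?thesis
      unfolding W'i[OF x] V'j[OF x] D_def sym[OF x, of "?A j" "?A i"] sym[OF x, of "?A i" "?Z _"]
      by (simp add: distrib_left sum.distrib sum_distrib_left mult.assoc)
  qed
  show "integrable L D"
    using Bochner_Integration.integrable_diff[OF iW iV]
    by (rule Bochner_Integration.integrable_cong[THEN iffD1, rotated -1]) (auto simp: D)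
  have "(\<integral>x. D x \<partial>L) = (\<integral>x. W' x (axis i 1) - V' x (axis j 1) \<partial>L)"
    by (rule Bochner_Integration.integral_cong) (auto simp: D)
  then show "(\<integral>x. D x \<partial>L) = 0" using iW iV W0 V0 by simp
qed

text \<open>Here compactness of \<Gamma> pays off: support compact in \<open>x\<close> alone becomes
  compact support in the product, so derivatives of test functions are C0 functions.\<close>

lemma cont_cpt_support_Times:
  assumes "continuous_on (\<Omega> \<times> \<Gamma>) \<phi>" "compact K" "K \<subseteq> \<Omega>"
    "\<And>x z. x \<in> \<Omega> - K \<Longrightarrow> \<phi> (x, z) = 0"
  shows "cont_cpt_support (\<Omega> \<times> \<Gamma>) \<phi>"
  unfolding cont_cpt_support_def
  using assms compact_range by (intro conjI exI[of _ "K \<times> \<Gamma>"]) (auto intro: compact_Times)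

text \<open>The constraint is the sum over i and j of the chain rule identity for the scalar
  components of \<phi>.\<close>

lemma admissible_graph_pair:
  assumes \<delta>: "is_graph_measure \<Omega> \<Gamma> u \<delta>"
    and int_hessian: "integrable L (hessian u)" and int_H: "integrable L H_density"
  shows "(graph_density \<Omega> u H_density, graph_density \<Omega> u (hessian u)) \<in> admissible \<Omega> \<Gamma> \<delta>"
  unfolding admissible_def mem_Collect_eq prod.case
proof (intro conjI allI impI)
  show "radon_measure_on (\<Omega> \<times> \<Gamma>) (graph_density \<Omega> u H_density)"
    by (rule radon_measure_on_graph_density[OF int_H])
  show "radon_measure_on (\<Omega> \<times> \<Gamma>) (graph_density \<Omega> u (hessian u))"
    by (rule radon_measure_on_graph_density[OF int_hessian])
  show "symmetric_H (\<Omega> \<times> \<Gamma>) (graph_density \<Omega> u H_density)"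
    unfolding symmetric_H_def
  proof (intro ballI allI)
    fix A :: "((real^'d) \<times> (real^'s)) set" and i j k l
    assume A: "A \<in> sets (restrict_space borel (\<Omega> \<times> \<Gamma>))"
    have comp: "graph_density \<Omega> u H_density A $ a $ b $ c $ d =
        (\<integral>x. indicat_real A (x, u x) * H_density x $ a $ b $ c $ d \<partial>L)" for a b c d
    proof -
      have "bounded_linear (\<lambda>v::real^'s^'d^'s^'d. v $ a $ b $ c $ d)"
        by (intro bounded_linear_compose[OF bounded_linear_vec_nth] bounded_linear_vec_nth)
      from integral_bounded_linear[OF this integrable_indicator_graph[OF int_H A]]
      show ?thesis by (simp add: graph_density_def)
    qed
    have "H_density x $ i $ k $ j $ l = H_density x $ i $ l $ j $ k" for x
      by (simp add: H_density_def add.commute)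
    then show "graph_density \<Omega> u H_density A $ i $ k $ j $ l = graph_density \<Omega> u H_density A $ i $ l $ j $ k"
      unfolding comp by simp
  qed
  fix \<phi> :: "(real^'d) \<times> (real^'s) \<Rightarrow> real^'d^'d"
  assume "test_fun \<Omega> \<phi>"
  then obtain K where \<phi>: "C2_on (\<Omega> \<times> UNIV) \<phi>" and K: "compact K" "K \<subseteq> \<Omega>"
    and \<phi>0: "\<And>x z. x \<in> \<Omega> - K \<Longrightarrow> \<phi> (x, z) = 0"
    unfolding test_fun_def by blast
  obtain \<phi>' \<phi>'' where \<phi>': "twice_derivative_on (\<Omega> \<times> UNIV) \<phi> \<phi>' \<phi>''"
    using C2_on_obtain_derivatives[OF \<phi>] .
  have oU: "open (\<Omega> \<times> (UNIV :: (real^'s) set))" using open_domain by (intro open_Times) auto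
  have comp: "twice_derivative_on (\<Omega> \<times> UNIV) (\<lambda>t. \<phi> t $ i $ j) (\<lambda>t w. \<phi>' t w $ i $ j)
      (\<lambda>t v w. \<phi>'' t v w $ i $ j)" for i j
  proof -
    have "bounded_linear (\<lambda>v::real^'d^'d. v $ i $ j)"
      by (intro bounded_linear_compose[OF bounded_linear_vec_nth] bounded_linear_vec_nth)
    from twice_derivative_on_bounded_linear[OF this \<phi>'] show ?thesis .
  qed
  have zero: "\<phi>' (x, z) w = 0" "\<phi>'' (x, z) v w = 0" if "x \<in> \<Omega> - K" for x z v w
    using derivatives_eq_0_off_compact[OF \<phi>' K(1) _ that] \<phi>0 by auto
  let ?A = "\<lambda>i. (axis i 1, 0) :: (real^'d) \<times> (real^'s)"
  let ?Z = "\<lambda>k. (0, axis k 1) :: (real^'d) \<times> (real^'s)"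
  \<comment> \<open>Expressed through genuine derivatives, these are known to be continuous and
    compactly supported on \<Omega> \<times> \<Gamma>. The \<open>deriv\<close>-based originals are
    identified with them only there, which is all the integrals see.\<close>
  define d where "d = (\<lambda>t. \<Sum>i\<in>UNIV. \<Sum>j\<in>UNIV. \<phi>'' t (?A i) (?A j) $ i $ j)"
  define gr where "gr = (\<lambda>t. \<chi> i j k. \<phi>' t (?Z k) $ i $ j)"
  define he where "he = (\<lambda>t. \<chi> i k j l. \<phi>'' t (?Z k) (?Z l) $ i $ j)"
  have d: "div2_x \<phi> t = d t" if "t \<in> \<Omega> \<times> \<Gamma>" for t
    unfolding div2_x_def d_def using that
    by (intro sum.cong refl dir_deriv_dir_deriv_eq[OF comp oU]) auto
  have gr: "grad_z \<phi> t = gr t" if "t \<in> \<Omega> \<times> \<Gamma>" for t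
    unfolding grad_z_def gr_def vec_eq_iff using that
    by (auto intro!: dir_deriv_eq[OF twice_derivative_onD(1)[OF comp]])
  have he: "hess_z \<phi> t = he t" if "t \<in> \<Omega> \<times> \<Gamma>" for t
    unfolding hess_z_def he_def vec_eq_iff using that
    by (auto intro!: dir_deriv_dir_deriv_eq[OF comp oU])
  have sub: "\<Omega> \<times> \<Gamma> \<subseteq> \<Omega> \<times> UNIV" by auto
  have cd: "cont_cpt_support (\<Omega> \<times> \<Gamma>) d" unfolding d_def
    by (intro cont_cpt_support_Times[OF _ K] continuous_on_sum
        continuous_on_subset[OF twice_derivative_onD(3)[OF comp] sub]) (auto simp: zero(2) intro!: sum.neutral)
  have cgr: "cont_cpt_support (\<Omega> \<times> \<Gamma>) gr" unfolding gr_def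
    by (intro cont_cpt_support_Times[OF _ K] continuous_on_vec_lambda
        continuous_on_subset[OF twice_derivative_on_continuous(2)[OF comp] sub])
      (simp add: zero vec_eq_iff)
  have che: "cont_cpt_support (\<Omega> \<times> \<Gamma>) he" unfolding he_def
    by (intro cont_cpt_support_Times[OF _ K] continuous_on_vec_lambda
        continuous_on_subset[OF twice_derivative_onD(3)[OF comp] sub]) (simp add: zero vec_eq_iff)
  note ccont = cont_cpt_support_def[THEN iffD1, THEN conjunct1]
  have 1: "signed_integral (\<Omega> \<times> \<Gamma>) \<delta> (div2_x \<phi>) = (\<integral>x. d (x, u x) \<partial>L)"
  proof -
    have "signed_integral (\<Omega> \<times> \<Gamma>) \<delta> (div2_x \<phi>) = signed_integral (\<Omega> \<times> \<Gamma>) \<delta> d"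
      by (rule signed_integral_cong) (auto simp: d)
    also have "\<dots> = (LINT x:\<Omega>|lborel. d (x, u x))"
      using \<delta> cont_cpt_support_imp_C0_on[OF cd] unfolding is_graph_measure_def by blast
    also have "\<dots> = (\<integral>x. d (x, u x) \<partial>L)"
      unfolding set_lebesgue_integral_def using open_domain by (subst integral_restrict_space) auto
    finally show ?thesis .
  qed
  have 2: "vector_integral (\<Omega> \<times> \<Gamma>) (graph_density \<Omega> u (hessian u)) (grad_z \<phi>) =
      (\<integral>x. gr (x, u x) \<bullet> hessian u x \<partial>L)"
  proof -
    have "vector_integral (\<Omega> \<times> \<Gamma>) (graph_density \<Omega> u (hessian u)) (grad_z \<phi>) =
        vector_integral (\<Omega> \<times> \<Gamma>) (graph_density \<Omega> u (hessian u)) gr"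
      unfolding vector_integral_def by (intro sum.cong refl signed_integral_cong) (auto simp: gr)
    also have "\<dots> = (\<integral>x. gr (x, u x) \<bullet> hessian u x \<partial>L)"
      by (rule vector_integral_graph_density[OF int_hessian ccont[OF cgr] cont_cpt_support_bounded[OF cgr]])
    finally show ?thesis .
  qed
  have 3: "vector_integral (\<Omega> \<times> \<Gamma>) (graph_density \<Omega> u H_density) (hess_z \<phi>) =
      (\<integral>x. he (x, u x) \<bullet> H_density x \<partial>L)"
  proof -
    have "vector_integral (\<Omega> \<times> \<Gamma>) (graph_density \<Omega> u H_density) (hess_z \<phi>) =
        vector_integral (\<Omega> \<times> \<Gamma>) (graph_density \<Omega> u H_density) he"
      unfolding vector_integral_def by (intro sum.cong refl signed_integral_cong) (auto simp: he)
    also have "\<dots> = (\<integral>x. he (x, u x) \<bullet> H_density x \<partial>L)"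
      by (rule vector_integral_graph_density[OF int_H ccont[OF che] cont_cpt_support_bounded[OF che]])
    finally show ?thesis .
  qed
  define D where "D = (\<lambda>i j x. (\<Sum>k\<in>UNIV. DDu i j x $ k * \<phi>' (x, u x) (?Z k) $ i $ j)
      + (\<Sum>k\<in>UNIV. \<Sum>l\<in>UNIV. Du j x $ k * Du i x $ l * \<phi>'' (x, u x) (?Z l) (?Z k) $ i $ j)
      - \<phi>'' (x, u x) (?A i) (?A j) $ i $ j)"
  have D: "integrable L (D i j)" "(\<integral>x. D i j x \<partial>L) = 0" for i j
    unfolding D_def
    using integral_chain_rule_identity[OF comp[of i j] K, where i = i and j = j] \<phi>0 by auto
  have sum_D: "- d (x, u x) + gr (x, u x) \<bullet> hessian u x + he (x, u x) \<bullet> H_density x =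
      (\<Sum>i\<in>UNIV. \<Sum>j\<in>UNIV. D i j x)" if "x \<in> space L" for x
  proof -
    have x: "x \<in> \<Omega>" using that by (simp add: space_L)
    have G: "gr (x, u x) \<bullet> hessian u x =
        (\<Sum>i\<in>UNIV. \<Sum>j\<in>UNIV. \<Sum>k\<in>UNIV. DDu i j x $ k * \<phi>' (x, u x) (?Z k) $ i $ j)"
      by (simp add: inner_vec_def gr_def part_deriv_u(2)[OF x] mult.commute)
    let ?q = "\<lambda>i j k l. \<phi>'' (x, u x) (?Z k) (?Z l) $ i $ j"
    have sym: "?q i j k l = ?q i j l k" for i j k l
      using second_derivative_symmetric[OF comp oU, of "(x, u x)"] x by auto
    \<comment> \<open>Undoes the symmetrization of \<open>H_density\<close>: the two halves are
      exchanged by swapping \<open>k\<close> and \<open>l\<close>, under which the z-Hessian of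
      \<phi> is invariant.\<close>
    have H2: "(\<Sum>k\<in>UNIV. \<Sum>l\<in>UNIV. ?q i j k l * ((Du i x $ k * Du j x $ l + Du i x $ l * Du j x $ k) / 2)) =
        (\<Sum>k\<in>UNIV. \<Sum>l\<in>UNIV. Du j x $ k * Du i x $ l * ?q i j l k)" (is "?l = ?r") for i j
    proof -
      have swap: "(\<Sum>k\<in>UNIV. \<Sum>l\<in>UNIV. Du i x $ k * Du j x $ l * ?q i j k l) = ?r"
        by (subst sum.swap) (simp add: mult.commute)
      have "?l = ((\<Sum>k\<in>UNIV. \<Sum>l\<in>UNIV. Du i x $ k * Du j x $ l * ?q i j k l) +
          (\<Sum>k\<in>UNIV. \<Sum>l\<in>UNIV. Du j x $ k * Du i x $ l * ?q i j k l)) / 2"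
        by (simp add: sum.distrib[symmetric] sum_divide_distrib algebra_simps add_divide_distrib)
      also have "(\<Sum>k\<in>UNIV. \<Sum>l\<in>UNIV. Du j x $ k * Du i x $ l * ?q i j k l) = ?r"
        by (intro sum.cong refl arg_cong2[where f = "(*)"] sym)
      finally show ?thesis unfolding swap by simp
    qed
    have "he (x, u x) \<bullet> H_density x = (\<Sum>i\<in>UNIV. \<Sum>k\<in>UNIV. \<Sum>j\<in>UNIV. \<Sum>l\<in>UNIV.
        ?q i j k l * ((Du i x $ k * Du j x $ l + Du i x $ l * Du j x $ k) / 2))"
      by (simp add: inner_vec_def he_def H_density_def)
    also have "\<dots> = (\<Sum>i\<in>UNIV. \<Sum>j\<in>UNIV. \<Sum>k\<in>UNIV. \<Sum>l\<in>UNIV.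
        ?q i j k l * ((Du i x $ k * Du j x $ l + Du i x $ l * Du j x $ k) / 2))"
      by (intro sum.cong refl sum.swap)
    also have "\<dots> = (\<Sum>i\<in>UNIV. \<Sum>j\<in>UNIV. \<Sum>k\<in>UNIV. \<Sum>l\<in>UNIV. Du j x $ k * Du i x $ l * ?q i j l k)"
      unfolding H2 ..
    finally show ?thesis
      unfolding G d_def D_def by (simp add: sum.distrib sum_subtractf)
  qed
  have "integrable L (\<lambda>x. d (x, u x))"
    using integrable_inner_bounded[of "\<lambda>_. 1", OF _ ccont[OF cd] cont_cpt_support_bounded[OF cd]]
      finite_measure.integrable_const[OF finite_measure_L, of "1::real"] by simp
  moreover have "integrable L (\<lambda>x. gr (x, u x) \<bullet> hessian u x)"
    by (rule integrable_inner_bounded[OF int_hessian ccont[OF cgr] cont_cpt_support_bounded[OF cgr]])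
  moreover have "integrable L (\<lambda>x. he (x, u x) \<bullet> H_density x)"
    by (rule integrable_inner_bounded[OF int_H ccont[OF che] cont_cpt_support_bounded[OF che]])
  ultimately have "- (\<integral>x. d (x, u x) \<partial>L) + (\<integral>x. gr (x, u x) \<bullet> hessian u x \<partial>L) + (\<integral>x. he (x, u x) \<bullet> H_density x \<partial>L)
      = (\<integral>x. - d (x, u x) + gr (x, u x) \<bullet> hessian u x + he (x, u x) \<bullet> H_density x \<partial>L)"
    by simp
  also have "\<dots> = (\<integral>x. (\<Sum>i\<in>UNIV. \<Sum>j\<in>UNIV. D i j x) \<partial>L)"
    by (rule Bochner_Integration.integral_cong[OF refl sum_D])
  also have "\<dots> = 0" using D by simp
  finally show "- signed_integral (\<Omega> \<times> \<Gamma>) \<delta> (div2_x \<phi>)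
      + vector_integral (\<Omega> \<times> \<Gamma>) (graph_density \<Omega> u (hessian u)) (grad_z \<phi>)
      + vector_integral (\<Omega> \<times> \<Gamma>) (graph_density \<Omega> u H_density) (hess_z \<phi>) = 0"
    unfolding 1 2 3 .
qed

end

section \<open>Lower and upper bound\<close>

lemma vector_integral_zero: "vector_integral U \<nu> (\<lambda>_. 0) = 0"
  by (simp add: vector_integral_def signed_integral_def)

lemma C0_on_fst_snd:
  assumes "C0_on U (\<lambda>t. (\<phi> t, \<eta> t))"
  shows "C0_on U \<phi>" "C0_on U \<eta>"
proof -
  have "\<exists>\<psi>. cont_cpt_support U \<psi> \<and> (\<forall>t\<in>U. norm (\<phi> t - \<psi> t) \<le> e)"
    "\<exists>\<psi>. cont_cpt_support U \<psi> \<and> (\<forall>t\<in>U. norm (\<eta> t - \<psi> t) \<le> e)" if e: "e > 0" for e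
  proof -
    obtain \<psi> where \<psi>: "cont_cpt_support U \<psi>" "\<And>t. t \<in> U \<Longrightarrow> norm ((\<phi> t, \<eta> t) - \<psi> t) \<le> e"
      using assms e unfolding C0_on_def by blast
    have 1: "norm (\<phi> t - fst (\<psi> t)) \<le> e" "norm (\<eta> t - snd (\<psi> t)) \<le> e" if "t \<in> U" for t
    proof -
      have "(\<phi> t, \<eta> t) - \<psi> t = (\<phi> t - fst (\<psi> t), \<eta> t - snd (\<psi> t))" by (simp add: prod_eq_iff)
      then show "norm (\<phi> t - fst (\<psi> t)) \<le> e" "norm (\<eta> t - snd (\<psi> t)) \<le> e"
        using \<psi>(2)[OF that] by (metis norm_fst_le order_trans, metis norm_snd_le order_trans)
    qed
    have "cont_cpt_support U (\<lambda>t. fst (\<psi> t))" "cont_cpt_support U (\<lambda>t. snd (\<psi> t))"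
      using \<psi>(1) unfolding cont_cpt_support_def
      by (metis continuous_on_fst fst_zero, metis continuous_on_snd snd_zero)
    with 1 show "\<exists>\<psi>. cont_cpt_support U \<psi> \<and> (\<forall>t\<in>U. norm (\<phi> t - \<psi> t) \<le> e)"
      "\<exists>\<psi>. cont_cpt_support U \<psi> \<and> (\<forall>t\<in>U. norm (\<eta> t - \<psi> t) \<le> e)" by blast+
  qed
  then show "C0_on U \<phi>" "C0_on U \<eta>" unfolding C0_on_def by blast+
qed

text \<open>The negative part of \<open>w\<close> only lowers the left side, and
  \<open>nn_integral\<close> is monotone even for a \<open>g\<close> that is not known to be
  measurable.\<close>

lemma integral_le_nn_integral:
  fixes w :: "'a \<Rightarrow> real"
  assumes "integrable M w" "\<And>x. x \<in> space M \<Longrightarrow> ennreal (w x) \<le> g x" "(\<integral>\<^sup>+x. g x \<partial>M) < \<infinity>"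
  shows "(\<integral>x. w x \<partial>M) \<le> enn2real (\<integral>\<^sup>+x. g x \<partial>M)"
proof -
  have "(\<integral>x. w x \<partial>M) \<le> enn2real (\<integral>\<^sup>+x. ennreal (w x) \<partial>M)"
    using real_lebesgue_integral_def[OF assms(1)] by simp
  also have "\<dots> \<le> enn2real (\<integral>\<^sup>+x. g x \<partial>M)"
    using assms(2,3) by (intro enn2real_mono nn_integral_mono) auto
  finally show ?thesis .
qed

context C2_graph
begin

lemma signed_integral_graph_measure:
  assumes "is_graph_measure \<Omega> \<Gamma> u \<delta>" "C0_on (\<Omega> \<times> \<Gamma>) \<eta>"
  shows "signed_integral (\<Omega> \<times> \<Gamma>) \<delta> \<eta> = (\<integral>x. \<eta> (x, u x) \<partial>L)"
proof -
  have "signed_integral (\<Omega> \<times> \<Gamma>) \<delta> \<eta> = (LINT x:\<Omega>|lborel. \<eta> (x, u x))"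
    using assms unfolding is_graph_measure_def by blast
  also have "\<dots> = (\<integral>x. \<eta> (x, u x) \<partial>L)"
    unfolding set_lebesgue_integral_def using open_domain by (subst integral_restrict_space) auto
  finally show ?thesis .
qed

lemma integrable_C0_on_graph:
  fixes \<eta> :: "(real^'d) \<times> (real^'s) \<Rightarrow> real"
  assumes "C0_on (\<Omega> \<times> \<Gamma>) \<eta>"
  shows "integrable L (\<lambda>x. \<eta> (x, u x))"
  using integrable_inner_bounded[of "\<lambda>_. 1", OF _ C0_on_imp_continuous_on[OF assms] C0_on_bounded[OF assms]]
    finite_measure.integrable_const[OF finite_measure_L, of "1::real"] by simp

lemma vector_integral_admissible:
  fixes \<xi> :: "real^'d \<Rightarrow> real^'s^'d^'d"
  assumes \<delta>: "is_graph_measure \<Omega> \<Gamma> u \<delta>"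
    and int: "integrable L (hessian u)" "integrable L H_density"
    and HE: "(H, E) \<in> admissible \<Omega> \<Gamma> \<delta>"
    and \<xi>: "C2_on UNIV \<xi>" and K: "compact K" "K \<subseteq> \<Omega>" "\<And>x. x \<notin> K \<Longrightarrow> \<xi> x = 0"
  shows "vector_integral (\<Omega> \<times> \<Gamma>) E (\<lambda>t. \<xi> (fst t)) = (\<integral>x. \<xi> x \<bullet> hessian u x \<partial>L)"
proof -
  \<comment> \<open>\<psi> is affine in z with z-gradient \<xi>, so the H-term of the constraint vanishes.\<close>
  define P where "P = (\<lambda>(p :: real^'s^'d^'d) (z :: real^'s). (\<chi> i j. p $ i $ j \<bullet> z) :: real^'d^'d)"
  define \<psi> where "\<psi> = (\<lambda>t. P (\<xi> (fst t)) (snd t))"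
  have "bilinear P"
    unfolding bilinear_def P_def
    by (auto simp: linear_iff vec_eq_iff inner_add_left inner_add_right)
  then have P: "bounded_bilinear P" by (simp add: bilinear_conv_bounded_bilinear)
  have fs: "C2_on UNIV (\<lambda>t::(real^'d) \<times> (real^'s). fst t)" "C2_on UNIV (\<lambda>t::(real^'d) \<times> (real^'s). snd t)"
    by (intro C2_on_bounded_linear bounded_linear_fst bounded_linear_snd)+
  have P0: "P 0 z = 0" for z by (simp add: P_def vec_eq_iff)
  have "C2_on UNIV \<psi>"
    unfolding \<psi>_def
    by (rule bounded_bilinear.C2_on[OF P C2_on_UNIV_compose[OF \<xi> fs(1)] fs(2)])
  then have "C2_on (\<Omega> \<times> UNIV) \<psi>" by (rule C2_on_subset) simp
  then have test: "test_fun \<Omega> \<psi>"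
    unfolding test_fun_def using K by (auto intro!: exI[of _ K] simp: \<psi>_def P0)
  have part: "part_z k (\<lambda>t. \<psi> t $ i $ j) t = \<xi> (fst t) $ i $ j $ k" for i j k t
  proof -
    have "((\<lambda>h. \<psi> (t + h *\<^sub>R (0, axis k 1)) $ i $ j) has_real_derivative \<xi> (fst t) $ i $ j $ k) (at 0)"
      unfolding \<psi>_def P_def
      by (auto intro!: derivative_eq_intros simp: inner_add_right inner_axis)
    then show ?thesis unfolding dir_deriv_def by (rule DERIV_imp_deriv)
  qed
  have grad: "grad_z \<psi> = (\<lambda>t. \<xi> (fst t))"
    unfolding grad_z_def part by (auto simp: fun_eq_iff vec_eq_iff)
  have hess: "hess_z \<psi> = (\<lambda>_. 0)"
    unfolding hess_z_def part by (auto simp: fun_eq_iff vec_eq_iff dir_deriv_def)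
  \<comment> \<open>The right side does not mention \<open>E'\<close>, so all admissible pairs give
    the same value, which can be computed from the canonical one.\<close>
  have eq: "vector_integral (\<Omega> \<times> \<Gamma>) E' (\<lambda>t. \<xi> (fst t)) = signed_integral (\<Omega> \<times> \<Gamma>) \<delta> (div2_x \<psi>)"
    if "(H', E') \<in> admissible \<Omega> \<Gamma> \<delta>" for H' E'
    using that test unfolding admissible_def
    by (auto simp: grad hess vector_integral_zero dest!: spec[of _ \<psi>])
  have "continuous_on (\<Omega> \<times> \<Gamma>) (\<lambda>t. \<xi> (fst t))"
    using C1_on_imp_continuous_on[OF C2_on_imp_C1_on[OF \<xi>]]
    by (auto intro!: continuous_on_compose2[of UNIV \<xi>] continuous_intros)
  then have "cont_cpt_support (\<Omega> \<times> \<Gamma>) (\<lambda>t. \<xi> (fst t))"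
    using K by (intro cont_cpt_support_Times[OF _ K(1,2)]) auto
  then have "vector_integral (\<Omega> \<times> \<Gamma>) (graph_density \<Omega> u (hessian u)) (\<lambda>t. \<xi> (fst t)) =
      (\<integral>x. \<xi> x \<bullet> hessian u x \<partial>L)"
    using vector_integral_graph_density[OF int(1), of "\<lambda>t. \<xi> (fst t)"]
      cont_cpt_support_bounded cont_cpt_support_def by fastforce
  then show ?thesis
    using eq[OF HE] eq[OF admissible_graph_pair[OF \<delta> int]] by simp
qed

lemma BB_functional_ge:
  fixes f :: "(real^'d) \<times> (real^'s) \<Rightarrow> real^'s^'d^'d \<Rightarrow> ennreal"
  assumes \<delta>: "is_graph_measure \<Omega> \<Gamma> u \<delta>"
    and int: "integrable L (hessian u)" "integrable L H_density"
    and HE: "(H, E) \<in> admissible \<Omega> \<Gamma> \<delta>"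
    and fin: "\<And>t \<xi>. t \<in> \<Omega> \<times> \<Gamma> \<Longrightarrow> \<bar>conj_fun f t \<xi>\<bar> \<noteq> \<infinity>"
    and cont: "\<And>\<xi>. continuous_on (\<Omega> \<times> \<Gamma>) (\<lambda>t. rconj f t \<xi>)"
    and \<beta>: "\<And>i. C2_on UNIV (\<beta> i)" "\<And>i y. 0 \<le> \<beta> i y" "\<And>y. (\<Sum>i\<in>F. \<beta> i y) \<le> (1::real)"
    and K: "compact K" "K \<subseteq> \<Omega>" "\<And>i y. i \<in> F \<Longrightarrow> y \<notin> K \<Longrightarrow> \<beta> i y = 0"
  shows "ereal (\<integral>x. (\<Sum>i\<in>F. \<beta> i x * (\<xi> i \<bullet> hessian u x - rconj f (x, u x) (\<xi> i))) \<partial>L)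
    \<le> BB_functional (\<Omega> \<times> \<Gamma>) f E \<delta>"
proof -
  \<comment> \<open>By convexity of the conjugate the pair is feasible, with no cutoff needed: the weight missing from
      the sum falls on the zero vector, where the conjugate is nonpositive.\<close>
  define \<Xi> where "\<Xi> = (\<lambda>x. \<Sum>i\<in>F. \<beta> i x *\<^sub>R \<xi> i)"
  \<comment> \<open>The weighted sum of conjugates, instead of the conjugate of the sum, keeps the
    integrand linear in the weights, as in \<open>approximation_by_C2_weights\<close>.\<close>
  define \<eta> where "\<eta> = (\<lambda>t. - (\<Sum>i\<in>F. \<beta> i (fst t) * rconj f t (\<xi> i)))"
  have \<Xi>: "C2_on UNIV \<Xi>"
    unfolding \<Xi>_def
    by (intro C2_on_sum bounded_bilinear.C2_on[OF bounded_bilinear_scaleR] \<beta> C2_on_const)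
  have \<Xi>0: "\<Xi> x = 0" if "x \<notin> K" for x unfolding \<Xi>_def using K(3) that by simp
  have \<beta>c: "continuous_on S (\<beta> i)" for i S
    using C1_on_imp_continuous_on[OF C2_on_imp_C1_on[OF \<beta>(1)]] continuous_on_subset by blast
  have \<beta>fst: "continuous_on (\<Omega> \<times> \<Gamma>) (\<lambda>t. \<beta> i (fst t))" for i
    by (rule continuous_on_compose2[OF \<beta>c[of UNIV]]) (auto intro!: continuous_intros)
  have "continuous_on (\<Omega> \<times> \<Gamma>) (\<lambda>t. (\<Xi> (fst t), \<eta> t))"
    unfolding \<Xi>_def \<eta>_def by (intro continuous_intros \<beta>fst cont)
  then have "cont_cpt_support (\<Omega> \<times> \<Gamma>) (\<lambda>t. (\<Xi> (fst t), \<eta> t))"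
    by (rule cont_cpt_support_Times[OF _ K(1,2)]) (auto simp: \<Xi>0 \<eta>_def K(3) zero_prod_def)
  then have C0: "C0_on (\<Omega> \<times> \<Gamma>) (\<lambda>t. (\<Xi> (fst t), \<eta> t))" by (rule cont_cpt_support_imp_C0_on)
  note C0' = C0_on_fst_snd[OF C0]
  have "conj_fun f t (\<Xi> (fst t)) + ereal (\<eta> t) \<le> 0" if t: "t \<in> \<Omega> \<times> \<Gamma>" for t
  proof -
    have "rconj f t (\<Xi> (fst t)) \<le> - \<eta> t"
      unfolding \<Xi>_def \<eta>_def minus_minus by (rule rconj_weighted_sum[OF fin[OF t] \<beta>(2,3)])
    then show ?thesis using fin[OF t, of "\<Xi> (fst t)"] by (cases "conj_fun f t (\<Xi> (fst t))") auto
  qed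
  then have mem: "(\<lambda>t. \<Xi> (fst t), \<eta>) \<in> BB_constraints (\<Omega> \<times> \<Gamma>) f"
    unfolding BB_constraints_def mem_Collect_eq prod.case using C0 by blast
  have i1: "integrable L (\<lambda>x. \<Xi> x \<bullet> hessian u x)"
    using integrable_inner_bounded[OF int(1) C0_on_imp_continuous_on[OF C0'(1)] C0_on_bounded[OF C0'(1)]] by simp
  have i2: "integrable L (\<lambda>x. \<eta> (x, u x))" by (rule integrable_C0_on_graph[OF C0'(2)])
  have "(\<integral>x. (\<Sum>i\<in>F. \<beta> i x * (\<xi> i \<bullet> hessian u x - rconj f (x, u x) (\<xi> i))) \<partial>L) =
      (\<integral>x. \<Xi> x \<bullet> hessian u x + \<eta> (x, u x) \<partial>L)"
    by (intro Bochner_Integration.integral_cong refl)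
      (simp add: \<Xi>_def \<eta>_def inner_sum_left right_diff_distrib sum_subtractf)
  also have "\<dots> = vector_integral (\<Omega> \<times> \<Gamma>) E (\<lambda>t. \<Xi> (fst t)) + signed_integral (\<Omega> \<times> \<Gamma>) \<delta> \<eta>"
    using i1 i2 vector_integral_admissible[OF \<delta> int HE \<Xi> K(1,2) \<Xi>0]
      signed_integral_graph_measure[OF \<delta> C0'(2)] by simp
  also have "ereal \<dots> \<le> BB_functional (\<Omega> \<times> \<Gamma>) f E \<delta>"
    unfolding BB_functional_def by (rule SUP_upper2[OF mem]) simp
  finally show ?thesis .
qed

lemma BB_functional_graph_pair_le:
  fixes f :: "(real^'d) \<times> (real^'s) \<Rightarrow> real^'s^'d^'d \<Rightarrow> ennreal"
  assumes \<delta>: "is_graph_measure \<Omega> \<Gamma> u \<delta>" and int: "integrable L (hessian u)"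
    and fin: "\<And>t \<xi>. t \<in> \<Omega> \<times> \<Gamma> \<Longrightarrow> \<bar>conj_fun f t \<xi>\<bar> \<noteq> \<infinity>"
    and energy: "(\<integral>\<^sup>+x. f (x, u x) (hessian u x) \<partial>L) < \<infinity>"
  shows "BB_functional (\<Omega> \<times> \<Gamma>) f (graph_density \<Omega> u (hessian u)) \<delta> \<le>
    ereal (enn2real (\<integral>\<^sup>+x. f (x, u x) (hessian u x) \<partial>L))"
  unfolding BB_functional_def
proof (rule SUP_least, clarify)
  fix \<phi> \<eta> assume "(\<phi>, \<eta>) \<in> BB_constraints (\<Omega> \<times> \<Gamma>) f"
  then have C0: "C0_on (\<Omega> \<times> \<Gamma>) (\<lambda>t. (\<phi> t, \<eta> t))"
    and le: "\<And>t. t \<in> \<Omega> \<times> \<Gamma> \<Longrightarrow> conj_fun f t (\<phi> t) + ereal (\<eta> t) \<le> 0"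
    unfolding BB_constraints_def by auto
  note C0' = C0_on_fst_snd[OF C0]
  have i1: "integrable L (\<lambda>x. \<phi> (x, u x) \<bullet> hessian u x)"
    by (rule integrable_inner_bounded[OF int C0_on_imp_continuous_on[OF C0'(1)] C0_on_bounded[OF C0'(1)]])
  have i2: "integrable L (\<lambda>x. \<eta> (x, u x))" by (rule integrable_C0_on_graph[OF C0'(2)])
  have "vector_integral (\<Omega> \<times> \<Gamma>) (graph_density \<Omega> u (hessian u)) \<phi> + signed_integral (\<Omega> \<times> \<Gamma>) \<delta> \<eta> =
      (\<integral>x. \<phi> (x, u x) \<bullet> hessian u x + \<eta> (x, u x) \<partial>L)"
    using i1 i2 signed_integral_graph_measure[OF \<delta> C0'(2)]
      vector_integral_graph_density[OF int C0_on_imp_continuous_on[OF C0'(1)] C0_on_bounded[OF C0'(1)]]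
    by simp
  also have "\<dots> \<le> enn2real (\<integral>\<^sup>+x. f (x, u x) (hessian u x) \<partial>L)"
  proof (rule integral_le_nn_integral[OF _ _ energy])
    show "integrable L (\<lambda>x. \<phi> (x, u x) \<bullet> hessian u x + \<eta> (x, u x))" using i1 i2 by simp
    fix x assume "x \<in> space L"
    then have t: "(x, u x) \<in> \<Omega> \<times> \<Gamma>" using range_u by (auto simp: space_L)
    have "rconj f (x, u x) (\<phi> (x, u x)) + \<eta> (x, u x) \<le> 0"
      using le[OF t] fin[OF t, of "\<phi> (x, u x)"] by (cases "conj_fun f (x, u x) (\<phi> (x, u x))") auto
    then have "ennreal (\<phi> (x, u x) \<bullet> hessian u x + \<eta> (x, u x)) \<le>
        ennreal (\<phi> (x, u x) \<bullet> hessian u x - rconj f (x, u x) (\<phi> (x, u x)))"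
      by (intro ennreal_leI) simp
    also have "\<dots> \<le> f (x, u x) (hessian u x)" by (rule fenchel_young[OF fin[OF t]])
    finally show "ennreal (\<phi> (x, u x) \<bullet> hessian u x + \<eta> (x, u x)) \<le> f (x, u x) (hessian u x)" .
  qed
  finally show "ereal (vector_integral (\<Omega> \<times> \<Gamma>) (graph_density \<Omega> u (hessian u)) \<phi> +
      signed_integral (\<Omega> \<times> \<Gamma>) \<delta> \<eta>) \<le> ereal (enn2real (\<integral>\<^sup>+x. f (x, u x) (hessian u x) \<partial>L))"
    by simp
qed

section \<open>Integrability of the densities of the canonical pair\<close>

lemma integrable_H_density:
  assumes "\<And>i k. integrable L (\<lambda>x. (Du i x $ k)\<^sup>2)"
  shows "integrable L H_density"
proof -
  have m: "(\<lambda>x. Du i x $ k) \<in> borel_measurable L" for i k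
    by (intro measurable_L_continuous continuous_intros continuous_Du)
  have prod: "integrable L (\<lambda>x. Du i x $ k * Du j x $ l)" for i j k l
  proof (rule Bochner_Integration.integrable_bound[OF Bochner_Integration.integrable_add[OF assms[of i k] assms[of j l]]])
    show "(\<lambda>x. Du i x $ k * Du j x $ l) \<in> borel_measurable L" using m by (intro borel_measurable_times)
    have "\<bar>a * b\<bar> \<le> a\<^sup>2 + b\<^sup>2" for a b :: real
    proof -
      have "2 * (\<bar>a\<bar> * \<bar>b\<bar>) \<le> a\<^sup>2 + b\<^sup>2" using sum_squares_bound[of "\<bar>a\<bar>" "\<bar>b\<bar>"] by simp
      moreover have "0 \<le> \<bar>a\<bar> * \<bar>b\<bar>" by simp
      ultimately show ?thesis unfolding abs_mult by linarith
    qed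
    then show "AE x in L. norm (Du i x $ k * Du j x $ l) \<le> norm ((Du i x $ k)\<^sup>2 + (Du j x $ l)\<^sup>2)"
      by simp
  qed
  have norm_le: "norm v \<le> (\<Sum>i\<in>UNIV. norm (v $ i))" for v :: "'z::real_normed_vector ^ 'n::finite"
    unfolding norm_vec_def by (rule L2_set_le_sum) simp
  show ?thesis
  proof (rule Bochner_Integration.integrable_bound)
    show "integrable L (\<lambda>x. \<Sum>i\<in>UNIV. \<Sum>k\<in>UNIV. \<Sum>j\<in>UNIV. \<Sum>l\<in>UNIV. \<bar>H_density x $ i $ k $ j $ l\<bar>)"
      unfolding H_density_def
      by (intro Bochner_Integration.integrable_sum integrable_abs) (simp add: prod)
    show "H_density \<in> borel_measurable L" by (intro measurable_L_continuous continuous_H_density)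
    have "norm (H_density x) \<le> (\<Sum>i\<in>UNIV. \<Sum>k\<in>UNIV. \<Sum>j\<in>UNIV. \<Sum>l\<in>UNIV. \<bar>H_density x $ i $ k $ j $ l\<bar>)" for x
      by (rule order_trans[OF norm_le], rule sum_mono, rule order_trans[OF norm_le], rule sum_mono,
          rule order_trans[OF norm_le], rule sum_mono, rule order_trans[OF norm_le], rule sum_mono) simp
    then show "AE x in L. norm (H_density x) \<le> norm (\<Sum>i\<in>UNIV. \<Sum>k\<in>UNIV. \<Sum>j\<in>UNIV. \<Sum>l\<in>UNIV. \<bar>H_density x $ i $ k $ j $ l\<bar>)"
      by (intro AE_I2 order_trans[OF _ abs_ge_self[THEN order_trans[OF _ eq_refl[OF real_norm_def[symmetric]]]]])
  qed
qed

text \<open>Linear growth is enough here: Fenchel-Young with the unit vector \<open>sgn p\<close>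
  bounds \<open>norm p\<close> by a constant plus \<open>f t p\<close>, and \<Omega> has finite
  measure.\<close>

lemma integrable_hessian:
  fixes f :: "(real^'d) \<times> (real^'s) \<Rightarrow> real^'s^'d^'d \<Rightarrow> ennreal"
  assumes fin: "\<And>t \<xi>. t \<in> \<Omega> \<times> \<Gamma> \<Longrightarrow> \<bar>conj_fun f t \<xi>\<bar> \<noteq> \<infinity>"
    and C: "\<And>t \<xi>. t \<in> \<Omega> \<times> \<Gamma> \<Longrightarrow> norm \<xi> \<le> 1 \<Longrightarrow> rconj f t \<xi> \<le> C"
    and energy: "(\<integral>\<^sup>+x. f (x, u x) (hessian u x) \<partial>L) < \<infinity>"
  shows "integrable L (hessian u)"
proof (rule integrableI_bounded)
  interpret L: finite_measure L by (rule finite_measure_L)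
  show "hessian u \<in> borel_measurable L" by (intro measurable_L_continuous continuous_hessian)
  have le: "ennreal (norm p) \<le> ennreal \<bar>C\<bar> + f t p" if t: "t \<in> \<Omega> \<times> \<Gamma>" for t p
  proof -
    have n: "norm (sgn p) \<le> 1" by (simp add: norm_sgn)
    have "sgn p \<bullet> p = norm p"
      by (cases "p = 0") (simp_all add: sgn_div_norm dot_square_norm power2_eq_square)
    then have "norm p \<le> \<bar>C\<bar> + max 0 (sgn p \<bullet> p - rconj f t (sgn p))"
      using C[OF t n] by linarith
    then have "ennreal (norm p) \<le> ennreal (\<bar>C\<bar> + max 0 (sgn p \<bullet> p - rconj f t (sgn p)))"
      by (rule ennreal_leI)
    also have "\<dots> = ennreal \<bar>C\<bar> + ennreal (sgn p \<bullet> p - rconj f t (sgn p))"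
      by (subst ennreal_plus) (auto simp: max_def ennreal_neg)
    also have "\<dots> \<le> ennreal \<bar>C\<bar> + f t p" by (intro add_left_mono fenchel_young fin t)
    finally show ?thesis .
  qed
  \<comment> \<open>The truncated difference is measurable and lies below the energy density. It
    allows the integral to be split without measurability of the energy density itself.\<close>
  let ?g = "\<lambda>x. ennreal (norm (hessian u x)) - ennreal \<bar>C\<bar>"
  have g: "?g \<in> borel_measurable L"
    using measurable_L_continuous[OF continuous_hessian] by measurable
  have "(\<integral>\<^sup>+x. ennreal (norm (hessian u x)) \<partial>L) \<le> (\<integral>\<^sup>+x. ennreal \<bar>C\<bar> + ?g x \<partial>L)"
  proof (rule nn_integral_mono)
    fix x show "ennreal (norm (hessian u x)) \<le> ennreal \<bar>C\<bar> + ?g x"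
      by (metis add.commute ennreal_minus_le_iff order_refl)
  qed
  also have "\<dots> = (\<integral>\<^sup>+x. ennreal \<bar>C\<bar> \<partial>L) + (\<integral>\<^sup>+x. ?g x \<partial>L)"
    using g by (intro nn_integral_add) auto
  also have "\<dots> \<le> ennreal \<bar>C\<bar> * emeasure L (space L) + (\<integral>\<^sup>+x. f (x, u x) (hessian u x) \<partial>L)"
  proof (intro add_mono nn_integral_mono)
    fix x assume "x \<in> space L"
    then have "(x, u x) \<in> \<Omega> \<times> \<Gamma>" using range_u by (auto simp: space_L)
    from le[OF this, of "hessian u x"] show "?g x \<le> f (x, u x) (hessian u x)"
      by (simp add: ennreal_minus_le_iff)
  qed simp
  also have "\<dots> < \<infinity>"
  proof -
    have "emeasure L (space L) < top" using L.emeasure_finite top.not_eq_extremum by blast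
    then show ?thesis using energy by (simp add: ennreal_mult_less_top)
  qed
  finally show "(\<integral>\<^sup>+x. ennreal (norm (hessian u x)) \<partial>L) < \<infinity>" .
qed

lemma BB_functional_ge_energy:
  fixes f :: "(real^'d) \<times> (real^'s) \<Rightarrow> real^'s^'d^'d \<Rightarrow> ennreal"
  assumes \<delta>: "is_graph_measure \<Omega> \<Gamma> u \<delta>"
    and int: "integrable L (hessian u)" "integrable L H_density"
    and HE: "(H, E) \<in> admissible \<Omega> \<Gamma> \<delta>"
    and lsc: "lsc_on ((\<Omega> \<times> \<Gamma>) \<times> UNIV) (\<lambda>(t, p). f t p)"
    and convex: "\<And>t. t \<in> \<Omega> \<times> \<Gamma> \<Longrightarrow> convex_ennreal (f t)"
    and fin: "\<And>t \<xi>. t \<in> \<Omega> \<times> \<Gamma> \<Longrightarrow> \<bar>conj_fun f t \<xi>\<bar> \<noteq> \<infinity>"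
    and cont: "continuous_on ((\<Omega> \<times> \<Gamma>) \<times> UNIV) (\<lambda>(t, \<xi>). rconj f t \<xi>)"
    and energy: "(\<integral>\<^sup>+x. f (x, u x) (hessian u x) \<partial>L) < \<infinity>"
  shows "ereal (enn2real (\<integral>\<^sup>+x. f (x, u x) (hessian u x) \<partial>L)) \<le> BB_functional (\<Omega> \<times> \<Gamma>) f E \<delta>"
proof (rule ccontr)
  let ?B = "BB_functional (\<Omega> \<times> \<Gamma>) f E \<delta>" and ?I = "\<integral>\<^sup>+x. f (x, u x) (hessian u x) \<partial>L"
  have cont1: "continuous_on (\<Omega> \<times> \<Gamma>) (\<lambda>t. rconj f t \<xi>)" for \<xi>
  proof -
    have "continuous_on (\<Omega> \<times> \<Gamma>) (\<lambda>t. (\<lambda>(t, \<xi>). rconj f t \<xi>) (t, \<xi>))"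
      by (rule continuous_on_compose2[OF cont]) (auto intro!: continuous_intros)
    then show ?thesis by simp
  qed
  have cont2: "continuous_on UNIV (rconj f t)" if "t \<in> \<Omega> \<times> \<Gamma>" for t
  proof -
    have "continuous_on UNIV (\<lambda>\<xi>. (\<lambda>(t, \<xi>). rconj f t \<xi>) (t, \<xi>))"
      by (rule continuous_on_compose2[OF cont]) (use that in \<open>auto intro!: continuous_intros\<close>)
    then show ?thesis by simp
  qed
  note ge = BB_functional_ge[OF \<delta> int HE fin cont1]
  assume "\<not> ereal (enn2real ?I) \<le> ?B"
  then obtain c where c: "?B < ereal c" "c < enn2real ?I"
    using ereal_dense2[of ?B "ereal (enn2real ?I)"] by (auto simp: not_le)
  \<comment> \<open>The empty family of weights corresponds to the zero competitor. A nonnegative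
    \<open>c\<close> is needed because \<open>ennreal c\<close> would otherwise be
    truncated.\<close>
  have "0 \<le> ?B" using ge[of "\<lambda>_ _. 0" "{}" "{}"] by (simp add: C2_on_const zero_ereal_def)
  then have "0 \<le> c" using c(1) by (metis ereal_less_eq(3) less_imp_le order_trans zero_ereal_def)
  then have cI: "ennreal c < ?I"
    using c(2) energy by (cases ?I) (auto simp: ennreal_less_iff)
  obtain D :: "(real^'s^'d^'d) set" where D: "countable D" "\<And>X. open X \<Longrightarrow> X \<noteq> {} \<Longrightarrow> \<exists>d\<in>D. d \<in> X"
    using countable_dense_setE by metis
  have "D \<noteq> {}" using D(2)[of UNIV] by auto
  \<comment> \<open>Index 0 is reserved for the zero functional, which makes \<open>h 0\<close>
    equal to minus the conjugate at 0 and hence nonnegative, as the approximation lemma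
    demands.\<close>
  define d where "d = case_nat 0 (from_nat_into D)"
  have d: "\<exists>n. d n \<in> X" if X: "open X" "X \<noteq> {}" for X
  proof -
    obtain y where "y \<in> D" "y \<in> X" using D(2)[OF X] by blast
    moreover obtain n where "from_nat_into D n = y"
      using from_nat_into_surj[OF D(1) \<open>y \<in> D\<close>] by blast
    ultimately have "d (Suc n) \<in> X" by (simp add: d_def)
    then show ?thesis by blast
  qed
  define h where "h = (\<lambda>m x. d m \<bullet> hessian u x - rconj f (x, u x) (d m))"
  have t: "(x, u x) \<in> \<Omega> \<times> \<Gamma>" if "x \<in> \<Omega>" for x using that range_u by auto
  have h_cont: "continuous_on \<Omega> (h m)" for m
    unfolding h_def
    by (intro continuous_intros continuous_hessian continuous_on_compose2[OF cont1] continuous_u) (use t in auto)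
  have h0: "0 \<le> h 0 x" if "x \<in> \<Omega>" for x
    using rconj_least[OF fin[OF t[OF that]], of 0 0] by (simp add: h_def d_def)
  have "(SUP m. ennreal (h m x)) = f (x, u x) (hessian u x)" if "x \<in> space L" for x
  proof (rule antisym)
    have x: "x \<in> \<Omega>" using that by (simp add: space_L)
    show "(SUP m. ennreal (h m x)) \<le> f (x, u x) (hessian u x)"
      unfolding h_def by (intro SUP_least fenchel_young fin t x)
    show "f (x, u x) (hessian u x) \<le> (SUP m. ennreal (h m x))"
    proof (rule dense_le)
      fix y assume y: "y < f (x, u x) (hessian u x)"
      then obtain a where a: "y = ennreal a" by (cases y) auto
      \<comment> \<open>Duality yields one good functional; continuity of the conjugate makes the
        set of good ones open, so the countable dense sequence meets it.\<close>
      define X where "X = {\<xi>. a < \<xi> \<bullet> hessian u x - rconj f (x, u x) \<xi>}"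
      have "open X"
        unfolding X_def by (intro open_Collect_less continuous_intros cont2 t x)
      moreover have "X \<noteq> {}"
        using fenchel_moreau[OF convex[OF t[OF x]] lsc_on_slice[OF lsc t[OF x]] fin[OF t[OF x]] y[unfolded a]]
        by (auto simp: X_def)
      ultimately obtain n where "d n \<in> X" using d by blast
      then have "a < h n x" by (simp add: X_def h_def)
      then show "y \<le> (SUP m. ennreal (h m x))"
        unfolding a by (intro SUP_upper2[of n]) (auto intro: ennreal_leI)
    qed
  qed
  then have less: "ennreal c < (\<integral>\<^sup>+x. (SUP m. ennreal (h m x)) \<partial>L)"
    using cI by (simp cong: nn_integral_cong)
  show False
  proof (rule approximation_by_C2_weights[OF h_cont h0 less])
    fix F :: "(real^'d) set" and m \<beta> K
    assume F: "\<And>i. C2_on UNIV (\<beta> i)" "\<And>i y. 0 \<le> \<beta> i y" "\<And>y. (\<Sum>i\<in>F. \<beta> i y) \<le> 1"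
      "compact K" "K \<subseteq> \<Omega>" "\<And>i y. i \<in> F \<Longrightarrow> y \<notin> K \<Longrightarrow> \<beta> i y = 0"
      and c': "c < (\<integral>x. (\<Sum>i\<in>F. \<beta> i x * h (m i) x) \<partial>L)"
    have "ereal c < ereal (\<integral>x. (\<Sum>i\<in>F. \<beta> i x * h (m i) x) \<partial>L)" using c' by simp
    also have "\<dots> \<le> ?B" unfolding h_def by (rule ge[OF _ F])
    finally show False using c(1) by simp
  qed
qed

end

theorem mainTheorem6:
  fixes \<Omega> :: "(real^'d::finite) set"
    and \<Gamma> :: "(real^'s::finite) set"
    and f :: "(real^'d) \<times> (real^'s) \<Rightarrow> real^'s^'d^'d \<Rightarrow> ennreal"
    and u :: "real^'d \<Rightarrow> real^'s"
    and \<delta>u :: "((real^'d) \<times> (real^'s)) set \<Rightarrow> real"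
  assumes "open \<Omega>" and "bounded \<Omega>" and "compact \<Gamma>"
    and f_lsc: "lsc_on ((\<Omega> \<times> \<Gamma>) \<times> UNIV) (\<lambda>(t, p). f t p)"
    and f_convex: "\<And>t. t \<in> \<Omega> \<times> \<Gamma> \<Longrightarrow> convex_ennreal (f t)"
    and f_zero: "locally_bounded_on (\<Omega> \<times> \<Gamma>) (\<lambda>t. f t 0)"
    and conj_cont: "continuous_on ((\<Omega> \<times> \<Gamma>) \<times> UNIV) (\<lambda>(t, \<xi>). conj_fun f t \<xi>)"
    and conj_bdd: "\<And>r. r > 0 \<Longrightarrow>
      (SUP (t, \<xi>)\<in>(\<Omega> \<times> \<Gamma>) \<times> ball 0 r. \<bar>conj_fun f t \<xi>\<bar>) < \<infinity>"
    and u_C2: "C2_on \<Omega> u" and u_range: "u ` \<Omega> \<subseteq> \<Gamma>"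
    and u_grad_L2: "\<And>i k. set_integrable lborel \<Omega> (\<lambda>x. (part_deriv i (\<lambda>y. u y $ k) x)\<^sup>2)"
    and finite_energy: "energy \<Omega> f u < \<infinity>"
    and \<delta>u: "is_graph_measure \<Omega> \<Gamma> u \<delta>u"
  shows "lifted_functional \<Omega> \<Gamma> f \<delta>u = enn2ereal (energy \<Omega> f u)"
proof -
  obtain u' u'' where u: "twice_derivative_on \<Omega> u u' u''"
    using C2_on_obtain_derivatives[OF u_C2] .
  interpret C2_graph \<Omega> \<Gamma> u u' u''
    using assms(1-3) u u_range twice_derivative_on_continuous(1)[OF u] by unfold_locales auto
  have fin: "\<bar>conj_fun f t \<xi>\<bar> \<noteq> \<infinity>" if "t \<in> \<Omega> \<times> \<Gamma>" for t \<xi>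
  proof -
    have "\<bar>conj_fun f t \<xi>\<bar> \<le> (SUP (t, \<xi>)\<in>(\<Omega> \<times> \<Gamma>) \<times> ball 0 (norm \<xi> + 1). \<bar>conj_fun f t \<xi>\<bar>)"
      using that by (intro SUP_upper2[of "(t, \<xi>)"]) auto
    also have "\<dots> < \<infinity>" by (intro conj_bdd add_nonneg_pos) auto
    finally show ?thesis by simp
  qed
  \<comment> \<open>The hypothesis concerns open balls, so radius 2 is taken to contain the closed
    unit ball in which \<open>sgn p\<close> lies.\<close>
  define C where "C = real_of_ereal (SUP (t, \<xi>)\<in>(\<Omega> \<times> \<Gamma>) \<times> ball 0 2. \<bar>conj_fun f t \<xi>\<bar>)"
  have C: "rconj f t \<xi> \<le> C" if "t \<in> \<Omega> \<times> \<Gamma>" "norm \<xi> \<le> 1" for t \<xi>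
  proof -
    have "\<bar>conj_fun f t \<xi>\<bar> \<le> (SUP (t, \<xi>)\<in>(\<Omega> \<times> \<Gamma>) \<times> ball 0 2. \<bar>conj_fun f t \<xi>\<bar>)"
      using that by (intro SUP_upper2[of "(t, \<xi>)"]) auto
    then show ?thesis
      unfolding C_def using conj_bdd[of 2] fin[OF that(1), of \<xi>]
      by (cases "conj_fun f t \<xi>"; cases "SUP (t, \<xi>)\<in>(\<Omega> \<times> \<Gamma>) \<times> ball 0 2. \<bar>conj_fun f t \<xi>\<bar>") auto
  qed
  have cont: "continuous_on ((\<Omega> \<times> \<Gamma>) \<times> UNIV) (\<lambda>(t, \<xi>). rconj f t \<xi>)"
  proof -
    have "\<bar>case x of (t, \<xi>) \<Rightarrow> conj_fun f t \<xi>\<bar> \<noteq> \<infinity>" if "x \<in> (\<Omega> \<times> \<Gamma>) \<times> UNIV" for x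
      using that fin[of "fst x" "snd x"] by (simp add: case_prod_beta mem_Times_iff)
    from continuous_on_iff_real[OF this, THEN iffD1, OF _ conj_cont] show ?thesis
      by (simp add: o_def case_prod_beta)
  qed
  let ?I = "\<integral>\<^sup>+x. f (x, u x) (hessian u x) \<partial>L"
  have I: "energy \<Omega> f u = ?I"
    unfolding energy_def using open_domain by (subst nn_integral_restrict_space) auto
  have I_fin: "?I < \<infinity>" using finite_energy I by simp
  have int1: "integrable L (hessian u)"
    by (rule integrable_hessian[OF fin C I_fin])
  \<comment> \<open>Square integrability of the gradient enters here and gives the canonical
    \<open>H\<close> finite mass.\<close>
  have int2: "integrable L H_density"
  proof (rule integrable_H_density)
    fix i k
    have "integrable L (\<lambda>x. (part_deriv i (\<lambda>y. u y $ k) x)\<^sup>2)"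
      using u_grad_L2[of i k] open_domain
      by (subst integrable_restrict_space) (auto simp: set_integrable_def)
    then show "integrable L (\<lambda>x. (Du i x $ k)\<^sup>2)"
      by (rule Bochner_Integration.integrable_cong[THEN iffD1, rotated -1])
        (auto simp: space_L part_deriv_u)
  qed
  have "enn2ereal (energy \<Omega> f u) = ereal (enn2real ?I)"
    using I I_fin by (cases ?I) auto
  moreover have "lifted_functional \<Omega> \<Gamma> f \<delta>u = ereal (enn2real ?I)"
  proof (rule antisym)
    show "lifted_functional \<Omega> \<Gamma> f \<delta>u \<le> ereal (enn2real ?I)"
      unfolding lifted_functional_def
      using BB_functional_graph_pair_le[OF \<delta>u int1 fin I_fin] admissible_graph_pair[OF \<delta>u int1 int2]
      by (intro INF_lower2[of "(graph_density \<Omega> u H_density, graph_density \<Omega> u (hessian u))"]) auto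
    show "ereal (enn2real ?I) \<le> lifted_functional \<Omega> \<Gamma> f \<delta>u"
      unfolding lifted_functional_def
      using BB_functional_ge_energy[OF \<delta>u int1 int2 _ f_lsc f_convex fin cont I_fin]
      by (intro INF_greatest) auto
  qed
  ultimately show ?thesis by simp
qed

end
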